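(* Let $t\in(0,1)$ and $u\in\mathbb{C}$. For partitions $\mu,\lambda\in\mathbb{Y}$, \[ P_{\mu/\lambda}(u,ut,ut^2,\dots)=u^{|\mu|-|\lambda|}t^{n(\mu/\lambda)}\prod_{x\ge1}\frac{(t^{1+\mu'_x-\lambda'_x};t)_{m_x(\lambda)}}{(t;t)_{m_x(\mu)}}. \] For signatures $\lambda,\nu\in\mathrm{Sig}_n$, \[ Q_{\nu/\lambda}(u,ut,ut^2,\dots)=u^{|\nu|-|\lambda|}t^{n(\nu/\lambda)}\prod_{x\in\mathbb{Z}}\frac{(t^{1+\nu'_x-\lambda'_x};t)_{m_x(\lambda)}}{(t;t)_{m_x(\lambda)}}. \]
   Context: $\mathbb{Y}$ is the set of integer partitions; $\mathrm{Sig}_n=\{\lambda\in\mathbb{Z}^n:\lambda_1\ge\dots\ge\lambda_n\}$. For a partition or signature: $|\lambda|=\sum\lambda_i$, $m_x(\lambda)=\#\{i:\lambda_i=x\}$, $\lambda'_x=\#\{i:\lambda_i\ge x\}$ (for signatures, $i$ ranges over $1,\dots,n$). $(a;t)_m=\prod_{i=0}^{m-1}(1-at^i)$. $n(\nu/\lambda)=\sum_{i<j}\max(\nu_j-\lambda_i,0)$ (with $1\le i<j\le n$ for signatures, $1\le i<j$ for partitions). $P_{\mu/\lambda}$ for $\mu,\lambda\in\mathbb{Y}$ is the skew Hall–Littlewood symmetric function (Macdonald's), i.e. the element of the ring of symmetric functions whose image in $N$ variables, for $N$ large, is the polynomial $P_{\mu/\lambda}(x_1,\dots,x_N)$ defined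 by $P_\mu(x_1,\dots,x_{k+N})=\sum_{\lambda}P_{\mu/\lambda}(x_{k+1},\dots,x_{k+N})P_\lambda(x_1,\dots,x_k)$ with $P_\lambda(x_1,\dots,x_k;t)=\frac{1}{v_\lambda(t)}\sum_{\sigma\in S_k}\sigma(x^\lambda\prod_{i<j}\frac{x_i-tx_j}{x_i-x_j})$, $v_\lambda=\prod_x\frac{(t;t)_{m_x(\lambda)}}{(1-t)^{m_x(\lambda)}}$ (multiplicities of $0$ included). For $\lambda,\nu\in\mathrm{Sig}_n$: write $\alpha\prec_Q\beta$ if $\beta_i\ge\alpha_i$ ($i\le n$) and $\alpha_i\ge\beta_{i+1}$ ($i\le n-1$), $\varphi_{\beta/\alpha}=\prod_{x:m_x(\beta)=m_x(\alpha)+1}(1-t^{m_x(\beta)})$, and $Q_{\nu/\lambda}(y_1,\dots,y_J)=\sum\prod_{i=1}^Jy_i^{|\lambda^{(i)}|-|\lambda^{(i-1)}|}\varphi_{\lambda^{(i)}/\lambda^{(i-1)}}$ over chains $\lambda=\lambda^{(0)}\prec_Q\dots\prec_Q\lambda^{(J)}=\nu$. The evaluations at $u,ut,ut^2,\dots$ mean the limits as $N\to\infty$ of the evaluations at $u,ut,\dots,ut^{N-1}$ (equivalently, evaluation of the symmetric function where power sums are $p_k=u^k/(1-t^k)$). *)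

theory Defs
  imports
    Complex_Main
    "HOL-Library.Poly_Mapping"
    "HOL-Combinatorics.Permutations"
    "HOL-Computational_Algebra.Polynomial_Factorial"
begin

section \<open>Partitions and signatures\<close>

text \<open>Partitions are the lists of their positive parts in weakly decreasing order, signatures
  weakly decreasing integer lists of fixed length. Parts are indexed from 0. The size
  is \<^const>\<open>sum_list\<close> and the multiplicity of \<open>x\<close> is \<open>count_list lam x\<close>.\<close>

definition partitions :: "nat list set" where
  "partitions = {lam. sorted_wrt (\<ge>) lam \<and> 0 \<notin> set lam}"

definition Sig :: "nat \<Rightarrow> int list set" where
  "Sig n = {lam. length lam = n \<and> sorted_wrt (\<ge>) lam}"

definition conj_part :: "'a::linorder list \<Rightarrow> 'a \<Rightarrow> nat" where
  "conj_part lam x = length (filter (\<lambda>y. x \<le> y) lam)"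

text \<open>For partitions, the parts of \<open>lam\<close> past its length are 0, indices \<open>j\<close> past the length
  of \<open>\<mu>\<close> contribute 0, and truncated subtraction is the maximum of the difference and 0.\<close>

definition n_skew_part :: "nat list \<Rightarrow> nat list \<Rightarrow> nat" where
  "n_skew_part \<mu> lam = (\<Sum>j<length \<mu>. \<Sum>i<j. \<mu> ! j - nth_default 0 lam i)"

definition n_skew_sig :: "int list \<Rightarrow> int list \<Rightarrow> nat" where
  "n_skew_sig \<nu> lam = (\<Sum>j<length \<nu>. \<Sum>i<j. nat (max (\<nu> ! j - lam ! i) 0))"

definition qpoch :: "'a::comm_ring_1 \<Rightarrow> 'a \<Rightarrow> nat \<Rightarrow> 'a" where
  "qpoch a t m = (\<Prod>i<m. 1 - a * t ^ i)"


section \<open>Complex polynomials in variables indexed by the natural numbers\<close>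

type_synonym mpoly = "(nat \<Rightarrow>\<^sub>0 nat) \<Rightarrow>\<^sub>0 complex"

definition mConst :: "complex \<Rightarrow> mpoly" where
  "mConst c = Poly_Mapping.single 0 c"

definition mVar :: "nat \<Rightarrow> mpoly" where
  "mVar i = Poly_Mapping.single (Poly_Mapping.single i 1) 1"

text \<open>Coefficients are mapped through \<open>h\<close>: \<open>insertion id\<close> is evaluation at complex numbers and
  \<open>insertion mConst\<close> substitution of polynomials.\<close>

definition insertion :: "(complex \<Rightarrow> 'a::comm_semiring_1) \<Rightarrow> (nat \<Rightarrow> 'a) \<Rightarrow> mpoly \<Rightarrow> 'a" where
  "insertion h x p = (\<Sum>m\<in>Poly_Mapping.keys p. h (Poly_Mapping.lookup p m) *
     (\<Prod>i\<in>Poly_Mapping.keys m. x i ^ Poly_Mapping.lookup m i))"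

definition in_vars :: "nat \<Rightarrow> mpoly \<Rightarrow> bool" where
  "in_vars N p \<longleftrightarrow> (\<forall>m\<in>Poly_Mapping.keys p. Poly_Mapping.keys m \<subseteq> {..<N})"

definition total_degree_le :: "nat \<Rightarrow> mpoly \<Rightarrow> bool" where
  "total_degree_le d p \<longleftrightarrow>
     (\<forall>m\<in>Poly_Mapping.keys p. (\<Sum>i\<in>Poly_Mapping.keys m. Poly_Mapping.lookup m i) \<le> d)"

definition symmetric_in :: "nat \<Rightarrow> mpoly \<Rightarrow> bool" where
  "symmetric_in N p \<longleftrightarrow>
     in_vars N p \<and> (\<forall>\<sigma>. \<sigma> permutes {..<N} \<longrightarrow> insertion mConst (\<lambda>i. mVar (\<sigma> i)) p = p)"

text \<open>The ring of symmetric functions, as the inverse limit of the rings of symmetric polynomials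
  in \<open>N\<close> variables in the category of graded rings; \<open>f N\<close> is the image of \<open>f\<close> in \<open>N\<close> variables.\<close>

definition symmetric_functions :: "(nat \<Rightarrow> mpoly) set" where
  "symmetric_functions = {f.
     (\<forall>N. symmetric_in N (f N)) \<and>
     (\<forall>N. insertion mConst (\<lambda>i. if i < N then mVar i else 0) (f (Suc N)) = f N) \<and>
     (\<exists>d. \<forall>N. total_degree_le d (f N))}"


section \<open>Hall--Littlewood polynomials\<close>

definition HL_v :: "real \<Rightarrow> nat \<Rightarrow> nat list \<Rightarrow> real" where
  "HL_v t k lam = (let xs = lam @ replicate (k - length lam) 0 in
     \<Prod>x\<in>set xs. qpoch t t (count_list xs x) / (1 - t) ^ count_list xs x)"

text \<open>The symmetrization formula, read in the field of rational functions.\<close>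

definition HL_P_rat :: "real \<Rightarrow> nat \<Rightarrow> nat list \<Rightarrow> mpoly fract" where
  "HL_P_rat t k lam =
     (let X = (\<lambda>i. to_fract (mVar i)); c = (\<lambda>a::real. to_fract (mConst (of_real a))) in
      1 / c (HL_v t k lam) *
      (\<Sum>\<sigma> | \<sigma> permutes {..<k}.
         (\<Prod>i<k. X (\<sigma> i) ^ nth_default 0 lam i) *
         (\<Prod>(i, j)\<in>{(i, j). i < j \<and> j < k}.
            (X (\<sigma> i) - c t * X (\<sigma> j)) / (X (\<sigma> i) - X (\<sigma> j)))))"

text \<open>The polynomial in \<open>k\<close> variables; by convention it is 0 if \<open>lam\<close> has more than \<open>k\<close> parts.\<close>

definition HL_P :: "real \<Rightarrow> nat \<Rightarrow> nat list \<Rightarrow> mpoly" where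
  "HL_P t k lam = (if length lam \<le> k then (THE p. to_fract p = HL_P_rat t k lam) else 0)"

text \<open>\<open>skew_expansion t k N \<mu> c\<close>: the polynomials \<open>c lam\<close> in \<open>N\<close> variables are the coefficients when
  the polynomial of \<open>\<mu>\<close> in \<open>k + N\<close> variables is expanded in those of the partitions \<open>lam\<close> with at
  most \<open>k\<close> parts in the first \<open>k\<close> variables. The last \<open>N\<close> variables are substituted into \<open>c lam\<close>.\<close>

definition skew_expansion :: "real \<Rightarrow> nat \<Rightarrow> nat \<Rightarrow> nat list \<Rightarrow> (nat list \<Rightarrow> mpoly) \<Rightarrow> bool" where
  "skew_expansion t k N \<mu> c \<longleftrightarrow>
     finite {lam. c lam \<noteq> 0} \<and>
     (\<forall>lam. c lam \<noteq> 0 \<longrightarrow> lam \<in> partitions \<and> length lam \<le> k) \<and>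
     (\<forall>lam. in_vars N (c lam)) \<and>
     HL_P t (k + N) \<mu> =
       (\<Sum>lam | c lam \<noteq> 0. insertion mConst (\<lambda>i. mVar (k + i)) (c lam) * HL_P t k lam)"

definition skew_HL_poly :: "real \<Rightarrow> nat \<Rightarrow> nat \<Rightarrow> nat list \<Rightarrow> nat list \<Rightarrow> mpoly" where
  "skew_HL_poly t k N \<mu> lam = (THE c. skew_expansion t k N \<mu> c) lam"

text \<open>The skew Hall--Littlewood symmetric function. The expansion only determines a coefficient
  at \<open>lam\<close> if \<open>lam\<close> has at most \<open>k\<close> parts; the image in \<open>N\<close> variables does not depend on such \<open>k\<close>.\<close>

definition skew_HL_P :: "real \<Rightarrow> nat list \<Rightarrow> nat list \<Rightarrow> nat \<Rightarrow> mpoly" where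
  "skew_HL_P t \<mu> lam = (THE f. f \<in> symmetric_functions \<and>
     (\<forall>k\<ge>length lam. \<forall>\<^sub>F N in sequentially. f N = skew_HL_poly t k N \<mu> lam))"


section \<open>Dual skew functions indexed by signatures\<close>

definition prec_Q :: "nat \<Rightarrow> int list \<Rightarrow> int list \<Rightarrow> bool" where
  "prec_Q n \<alpha> \<beta> \<longleftrightarrow> (\<forall>i<n. \<alpha> ! i \<le> \<beta> ! i) \<and> (\<forall>i. Suc i < n \<longrightarrow> \<beta> ! Suc i \<le> \<alpha> ! i)"

definition HL_phi :: "real \<Rightarrow> int list \<Rightarrow> int list \<Rightarrow> real" where
  "HL_phi t \<beta> \<alpha> = (\<Prod>x | count_list \<beta> x = count_list \<alpha> x + 1. 1 - t ^ count_list \<beta> x)"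

definition Q_chains :: "nat \<Rightarrow> nat \<Rightarrow> int list \<Rightarrow> int list \<Rightarrow> int list list set" where
  "Q_chains n J \<nu> lam = {c. length c = Suc J \<and> set c \<subseteq> Sig n \<and> c ! 0 = lam \<and> c ! J = \<nu> \<and>
     (\<forall>i<J. prec_Q n (c ! i) (c ! Suc i))}"

text \<open>The variables are \<open>y 0, \<dots>, y (J - 1)\<close>; the exponents are nonnegative along a chain.\<close>

definition skew_HL_Q ::
  "real \<Rightarrow> nat \<Rightarrow> int list \<Rightarrow> int list \<Rightarrow> nat \<Rightarrow> (nat \<Rightarrow> complex) \<Rightarrow> complex" where
  "skew_HL_Q t n \<nu> lam J y = (\<Sum>c\<in>Q_chains n J \<nu> lam. \<Prod>i<J.
     y i powi (sum_list (c ! Suc i) - sum_list (c ! i)) * of_real (HL_phi t (c ! Suc i) (c ! i)))"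

end

theory Submission
  imports Defs
begin

text \<open>
  The one-variable branching rule for Hall--Littlewood polynomials is derived from the symmetrization
  formula. Isolating the last variable \<open>y\<close> of \<open>x\<^sub>1, \<dots>, x\<^sub>k, y\<close> gives a sum over its position, with the
  factors \<open>w\<^sub>i = (x\<^sub>i - t y) / (x\<^sub>i - y)\<close> for the variables to its left and \<open>v\<^sub>i = (y - t x\<^sub>i) / (y - x\<^sub>i)\<close>
  for those to its right. Symmetrization replaces \<open>v\<^sub>i w\<^sub>i\<^sub>+\<^sub>1\<close> by \<open>t\<close> next to anything symmetric in the two
  variables, and this turns the sum into a polynomial through a three-term recursion in the rows.

  Iterating the rule expresses the skew functions as sums over chains of interlacing partitions.
  Linear independence of the Hall--Littlewood polynomials makes the coefficients of the expansion
  unique, which also gives their symmetry and identifies the skew symmetric function.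

  For the specialization, splitting off the variable \<open>u\<close> and rescaling \<open>ut, ut\<^sup>2, \<dots>\<close> gives a linear
  recursion in the number of variables whose diagonal coefficient \<open>t\<close> to the power \<open>|\<nu>| - |\<lambda>|\<close> is less
  than 1 unless \<open>\<lambda> = \<nu>\<close>, so the limits exist and are determined by the fixed point equation. That the
  claimed product solves it amounts to: add a box to column \<open>x\<close> or not, going through the columns from
  right to left, with probabilities depending only on the choice made in column \<open>x + 1\<close>; the
  probabilities sum to 1. Partitions are reduced to signatures by padding with zeros.
\<close>

section \<open>Symmetrization\<close>

text \<open>With three or more rows, the sum over the position of \<open>y\<close> is not a
  polynomial before symmetrization: poles at \<open>z i = y\<close> remain, and they cancel only
  between different permutations. The rule that trades two adjacent fractions for \<open>t\<close>
  is valid only if everything else is symmetric in these two variables. Hence the recursion drops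
  two rows at once in its last term, and the coefficients first appear with a subtraction. The skew
  functions are given by definite descriptions, so existence and uniqueness must both be shown;
  explicit chain sums serve as witnesses. The chain weights of P and Q differ only by ratios of
  \<open>HL_b\<close>, so a single limit has to be computed, that of the Q sums. There the
  multiplicity of \<open>x\<close> changes by the box added in column \<open>x\<close> minus the box
  added in column \<open>x + 1\<close>. Every summand of the fixed point equation, divided by the
  claimed value, is therefore a product of factors that each see two adjacent columns. These factors
  are the probabilities \<open>column_prob\<close>.\<close>

definition hl_kernel :: "'a::field \<Rightarrow> nat \<Rightarrow> (nat \<Rightarrow> 'a) \<Rightarrow> 'a" where
  "hl_kernel t k z = (\<Prod>(i, j)\<in>{(i, j). i < j \<and> j < k}. (z i - t * z j) / (z i - z j))"

text \<open>The Hall-Littlewood symmetrizing operator. The argument \<open>g\<close> sees the whole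
  permuted assignment, so it may combine a prefix, a tail and a further fixed variable.\<close>

definition symmetrize :: "'a::field \<Rightarrow> nat \<Rightarrow> ((nat \<Rightarrow> 'a) \<Rightarrow> 'a) \<Rightarrow> (nat \<Rightarrow> 'a) \<Rightarrow> 'a" where
  "symmetrize t k g x = (\<Sum>\<sigma> | \<sigma> permutes {..<k}. g (x \<circ> \<sigma>) * hl_kernel t k (x \<circ> \<sigma>))"

lemma finite_pairs_less: "finite {(i, j). i < j \<and> j < (k::nat)}"
  by (rule finite_subset[of _ "{..<k} \<times> {..<k}"]) auto

lemma symmetrize_cong:
  assumes "\<And>\<sigma>. \<sigma> permutes {..<k} \<Longrightarrow> g (x \<circ> \<sigma>) = h (x \<circ> \<sigma>)"
  shows "symmetrize t k g x = symmetrize t k h x"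
  unfolding symmetrize_def by (intro sum.cong) (use assms in auto)

lemma symmetrize_add: "symmetrize t k (\<lambda>z. g z + h z) x = symmetrize t k g x + symmetrize t k h x"
  by (simp add: symmetrize_def distrib_right sum.distrib)

lemma symmetrize_diff: "symmetrize t k (\<lambda>z. g z - h z) x = symmetrize t k g x - symmetrize t k h x"
  by (simp add: symmetrize_def left_diff_distrib sum_subtractf)

lemma symmetrize_cmult: "symmetrize t k (\<lambda>z. c * g z) x = c * symmetrize t k g x"
  by (simp add: symmetrize_def sum_distrib_left mult.assoc)

lemma symmetrize_sum: "symmetrize t k (\<lambda>z. \<Sum>a\<in>A. g a z) x = (\<Sum>a\<in>A. symmetrize t k (g a) x)"
  unfolding symmetrize_def sum_distrib_right by (rule sum.swap)

lemma symmetrize_permute: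
  assumes "\<tau> permutes {..<k}"
  shows "symmetrize t k g (x \<circ> \<tau>) = symmetrize t k g x"
  unfolding symmetrize_def
  by (rule sum.reindex_bij_witness[where i = "\<lambda>\<sigma>. inv \<tau> \<circ> \<sigma>" and j = "\<lambda>\<sigma>. \<tau> \<circ> \<sigma>"])
     (use assms in \<open>auto simp: permutes_compose permutes_inv permutes_inv_o o_assoc
        permutes_inv_o(1)[OF assms, THEN arg_cong, of "\<lambda>f. f \<circ> _"] 
        permutes_inv_o(2)[OF assms, THEN arg_cong, of "\<lambda>f. f \<circ> _"]\<close>)

text \<open>The swap permutes all pairs other than \<open>(i, Suc i)\<close> among themselves, so
  only the factor of that pair changes. The cross-multiplied form avoids dividing by
  \<open>z i - t * z (Suc i)\<close>, which may vanish.\<close>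

lemma hl_kernel_adjacent:
  assumes "Suc i < k" and "z i \<noteq> z (Suc i)"
  shows "hl_kernel t k (z \<circ> transpose i (Suc i)) * (z i - t * z (Suc i)) =
    - (hl_kernel t k z * (z (Suc i) - t * z i))"
proof -
  define s where "s = transpose i (Suc i)"
  define P where "P = {(a, b). a < b \<and> b < k} - {(i, Suc i)}"
  define f where "f = (\<lambda>z :: nat \<Rightarrow> 'a. \<lambda>(a, b). (z a - t * z b) / (z a - z b))"
  have split: "hl_kernel t k y = f y (i, Suc i) * prod (f y) P" for y
    unfolding hl_kernel_def P_def f_def
    by (rule prod.remove[OF finite_pairs_less]) (use assms in auto)
  have inv: "prod (f (z \<circ> s)) P = prod (f z) P"
  proof (rule prod.reindex_bij_witness[where i = "map_prod s s" and j = "map_prod s s"])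
    show "map_prod s s p \<in> P" if "p \<in> P" for p
      using that assms(1) by (cases p) (simp add: P_def s_def transpose_def, presburger)
    then show "map_prod s s p \<in> P" if "p \<in> P" for p
      using that .
  qed (auto simp: s_def f_def)
  have a: "f (z \<circ> s) (i, Suc i) * (z i - t * z (Suc i)) = - (f z (i, Suc i) * (z (Suc i) - t * z i))"
    using assms(2) by (simp add: f_def s_def field_simps)
  show ?thesis
    unfolding s_def[symmetric] split inv
    using arg_cong[OF a, of "\<lambda>c. c * prod (f z) P"] by (simp add: mult_ac)
qed

text \<open>Composing the permutation with the swap of \<open>i\<close> and \<open>Suc i\<close>
  reverses the sign of its summand, so the sum is its own negative; this is where
  \<open>2 \<noteq> 0\<close> enters.\<close>

lemma symmetrize_adjacent:
  assumes two: "(2 :: 'a :: field) \<noteq> 0" and k: "Suc i < k" and inj: "inj_on x {..<k}"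
    and sym: "\<And>z. h (z \<circ> transpose i (Suc i)) = h z"
  shows "symmetrize (t :: 'a) k (\<lambda>z. h z * (z (Suc i) - t * z i)) x = 0"
proof -
  define s where "s = transpose i (Suc i)"
  define F where "F = (\<lambda>\<sigma>. h (x \<circ> \<sigma>) * ((x \<circ> \<sigma>) (Suc i) - t * (x \<circ> \<sigma>) i) * hl_kernel t k (x \<circ> \<sigma>))"
  have s: "s permutes {..<k}"
    using k by (auto simp: s_def intro: permutes_swap_id)
  have neg: "F (\<sigma> \<circ> s) = - F \<sigma>" if \<sigma>: "\<sigma> permutes {..<k}" for \<sigma>
  proof -
    have "\<sigma> i \<noteq> \<sigma> (Suc i)"
      using permutes_inj[OF \<sigma>] by (metis injD n_not_Suc_n)
    moreover have "\<sigma> i < k" "\<sigma> (Suc i) < k"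
      using permutes_in_image[OF \<sigma>] k by (metis lessThan_iff Suc_lessD)+
    ultimately have "(x \<circ> \<sigma>) i \<noteq> (x \<circ> \<sigma>) (Suc i)"
      using inj by (auto dest: inj_onD)
    from hl_kernel_adjacent[OF k this, of t]
    have "hl_kernel t k ((x \<circ> \<sigma>) \<circ> s) * ((x \<circ> \<sigma>) i - t * (x \<circ> \<sigma>) (Suc i)) =
      - (hl_kernel t k (x \<circ> \<sigma>) * ((x \<circ> \<sigma>) (Suc i) - t * (x \<circ> \<sigma>) i))"
      unfolding s_def .
    moreover have "F (\<sigma> \<circ> s) = h (x \<circ> \<sigma>) * (hl_kernel t k ((x \<circ> \<sigma>) \<circ> s) * ((x \<circ> \<sigma>) i - t * (x \<circ> \<sigma>) (Suc i)))"
      using sym[of "x \<circ> \<sigma>"] by (simp add: F_def s_def o_assoc)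
    ultimately show ?thesis by (simp add: F_def)
  qed
  have "sum F {\<sigma>. \<sigma> permutes {..<k}} = (\<Sum>\<sigma> | \<sigma> permutes {..<k}. F (\<sigma> \<circ> s))"
    by (rule sum.reindex_bij_witness[where i = "\<lambda>\<sigma>. \<sigma> \<circ> s" and j = "\<lambda>\<sigma>. \<sigma> \<circ> s"])
       (use s in \<open>auto simp: permutes_compose comp_assoc s_def\<close>)
  also have "\<dots> = - sum F {\<sigma>. \<sigma> permutes {..<k}}"
    by (simp add: neg sum_negf[symmetric])
  finally have "2 * sum F {\<sigma>. \<sigma> permutes {..<k}} = 0"
    by simp
  then show ?thesis
    using two by (simp add: symmetrize_def F_def)
qed

text \<open>With \<open>a\<close>, \<open>b\<close> for \<open>z i\<close>,
  \<open>z (Suc i)\<close>, the product of the two fractions is \<open>t\<close> plus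
  \<open>(1 - t) * y * (b - t * a) / ((y - a) * (b - y))\<close>. The denominator is symmetric in
  \<open>a\<close> and \<open>b\<close>, so \<open>symmetrize_adjacent\<close> annihilates the
  second part.\<close>

lemma symmetrize_straighten:
  assumes two: "(2 :: 'a :: field) \<noteq> 0" and k: "Suc i < k" and inj: "inj_on x {..<k}"
    and y: "y \<notin> x ` {..<k}" and sym: "\<And>z. h (z \<circ> transpose i (Suc i)) = h z"
  shows "symmetrize (t :: 'a) k
      (\<lambda>z. h z * ((y - t * z i) / (y - z i) * ((z (Suc i) - t * y) / (z (Suc i) - y)))) x
    = t * symmetrize t k h x"
proof -
  define g where "g = (\<lambda>z. h z * ((1 - t) * y / ((y - z i) * (z (Suc i) - y))))"
  have "symmetrize t k (\<lambda>z. h z * ((y - t * z i) / (y - z i) * ((z (Suc i) - t * y) / (z (Suc i) - y)))) x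
     = symmetrize t k (\<lambda>z. g z * (z (Suc i) - t * z i) + t * h z) x"
  proof (rule symmetrize_cong)
    fix \<sigma> assume \<sigma>: "\<sigma> permutes {..<k}"
    have "\<sigma> i < k" "\<sigma> (Suc i) < k"
      using permutes_in_image[OF \<sigma>] k by (metis lessThan_iff Suc_lessD)+
    then have ne: "y - (x \<circ> \<sigma>) i \<noteq> 0" "(x \<circ> \<sigma>) (Suc i) - y \<noteq> 0"
      using y by auto
    have key: "(y - t * a) / (y - a) * ((b - t * y) / (b - y)) =
        (1 - t) * y / ((y - a) * (b - y)) * (b - t * a) + t"
      if "y - a \<noteq> 0" "b - y \<noteq> 0" for a b
    proof -
      have "(y - t * a) * (b - t * y) = (1 - t) * y * (b - t * a) + t * ((y - a) * (b - y))"
        by (simp add: algebra_simps)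
      then have "(y - t * a) / (y - a) * ((b - t * y) / (b - y)) =
         ((1 - t) * y * (b - t * a) + t * ((y - a) * (b - y))) / ((y - a) * (b - y))"
        by simp
      then show ?thesis
        using that by (simp add: add_divide_distrib)
    qed
    show "h (x \<circ> \<sigma>) * ((y - t * (x \<circ> \<sigma>) i) / (y - (x \<circ> \<sigma>) i) *
          (((x \<circ> \<sigma>) (Suc i) - t * y) / ((x \<circ> \<sigma>) (Suc i) - y))) =
        g (x \<circ> \<sigma>) * ((x \<circ> \<sigma>) (Suc i) - t * (x \<circ> \<sigma>) i) + t * h (x \<circ> \<sigma>)"
      unfolding key[OF ne] g_def by (simp add: algebra_simps)
  qed
  also have "\<dots> = symmetrize t k (\<lambda>z. g z * (z (Suc i) - t * z i)) x + t * symmetrize t k h x"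
    by (simp add: symmetrize_add symmetrize_cmult)
  also have "symmetrize t k (\<lambda>z. g z * (z (Suc i) - t * z i)) x = 0"
  proof (rule symmetrize_adjacent[OF two k inj])
    have *: "(y - a) * (b - y) = (y - b) * (a - y)" for a b :: 'a
      by (simp add: algebra_simps)
    show "g (z \<circ> transpose i (Suc i)) = g z" for z
      using *[of "z i" "z (Suc i)"] by (simp add: g_def sym)
  qed
  finally show ?thesis by simp
qed

section \<open>Isolating the last variable\<close>

text \<open>Meant for lists padded by zeros to the number of variables, so the length drops by
  exactly one and the empty list has no predecessor.\<close>

fun interlacing :: "nat list \<Rightarrow> nat list set" where
  "interlacing [] = {}"
| "interlacing [a] = {[]}"
| "interlacing (a # b # ms) = (\<lambda>(l, ls). l # ls) ` ({b..a} \<times> interlacing (b # ms))"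

text \<open>The coefficients satisfy a recursion with subtraction, coming from the rule that replaces a
  product of two adjacent factors by \<open>t\<close>; their closed form is the product over multiplicities below.\<close>

definition branch_weight :: "'a::comm_ring_1 \<Rightarrow> nat \<Rightarrow> nat \<Rightarrow> nat \<Rightarrow> 'a" where
  "branch_weight t a b l = 1 - t + (if l = a then t else 0) + (if l = b then t else 0)"

fun branch_coeff :: "'a::comm_ring_1 \<Rightarrow> nat list \<Rightarrow> nat list \<Rightarrow> 'a" where
  "branch_coeff t (a # b # ms) (l # ls) = branch_weight t a b l * branch_coeff t (b # ms) ls -
     (if ms \<noteq> [] \<and> l = b \<and> ls = b # tl ls then t * branch_coeff t ms (tl ls) else 0)"
| "branch_coeff t [a] [] = 1"
| "branch_coeff t _ _ = 0"

definition monom_val :: "nat list \<Rightarrow> 'a::comm_ring_1 list \<Rightarrow> 'a" where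
  "monom_val ls zs = (\<Prod>i<length ls. zs ! i ^ (ls ! i))"

definition branch_poly :: "'a::comm_ring_1 \<Rightarrow> 'a \<Rightarrow> nat list \<Rightarrow> 'a list \<Rightarrow> 'a" where
  "branch_poly t y ms zs =
     (\<Sum>ls\<in>interlacing ms. branch_coeff t ms ls * y ^ (sum_list ms - sum_list ls) * monom_val ls zs)"

text \<open>The sum over the positions \<open>p\<close> at which \<open>y\<close> can be inserted
  among \<open>zs\<close>. Behind \<open>p\<close> each variable stands one position later and takes
  the exponent \<open>ms ! Suc i\<close>.\<close>

definition insertion_sum :: "'a::field \<Rightarrow> 'a \<Rightarrow> nat list \<Rightarrow> 'a list \<Rightarrow> 'a" where
  "insertion_sum t y ms zs = (\<Sum>p\<le>length zs. y ^ (ms ! p) *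
     (\<Prod>i<p. zs ! i ^ (ms ! i) * ((zs ! i - t * y) / (zs ! i - y))) *
     (\<Prod>i=p..<length zs. zs ! i ^ (ms ! Suc i) * ((y - t * zs ! i) / (y - zs ! i))))"

text \<open>The \<open>p = 0\<close> term of an insertion sum without its power of \<open>y\<close>.
  Solving for it in terms of shorter insertion sums is what closes the recursion.\<close>

definition tail_prod :: "'a::field \<Rightarrow> 'a \<Rightarrow> nat list \<Rightarrow> 'a list \<Rightarrow> 'a" where
  "tail_prod t y ms zs = (\<Prod>i<length zs. zs ! i ^ (ms ! i) * ((y - t * zs ! i) / (y - zs ! i)))"

lemma tail_prod_Nil [simp]: "tail_prod t y ms [] = 1"
  by (simp add: tail_prod_def)

lemma tail_prod_Cons [simp]:
  "tail_prod t y (m # ms) (z # zs) = z ^ m * ((y - t * z) / (y - z)) * tail_prod t y ms zs"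
  by (simp add: tail_prod_def prod.lessThan_Suc_shift del: prod.lessThan_Suc)

lemma insertion_sum_Cons:
  "insertion_sum t y (a # ms) (z # zs) =
     z ^ a * ((z - t * y) / (z - y)) * insertion_sum t y ms zs + y ^ a * tail_prod t y ms (z # zs)"
proof -
  have "insertion_sum t y (a # ms) (z # zs) = y ^ a * tail_prod t y ms (z # zs) +
     (\<Sum>p\<le>length zs. y ^ (ms ! p) *
     (z ^ a * ((z - t * y) / (z - y)) * (\<Prod>i<p. zs ! i ^ (ms ! i) * ((zs ! i - t * y) / (zs ! i - y)))) *
     (\<Prod>i=p..<length zs. zs ! i ^ (ms ! Suc i) * ((y - t * zs ! i) / (y - zs ! i))))"
    unfolding insertion_sum_def tail_prod_def
    by (simp only: length_Cons sum.atMost_Suc_shift prod.lessThan_Suc_shift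
        prod.shift_bounds_Suc_ivl lessThan_atLeast0[of "Suc (length zs)"] nth_Cons_0 nth_Cons_Suc
        lessThan_0 prod.empty mult_1_right)
  also have "\<dots> = y ^ a * tail_prod t y ms (z # zs) +
     z ^ a * ((z - t * y) / (z - y)) * insertion_sum t y ms zs"
    unfolding insertion_sum_def sum_distrib_left by (simp add: mult_ac)
  finally show ?thesis by simp
qed

lemma insertion_sum_Nil [simp]: "insertion_sum t y (a # ms) [] = y ^ a"
  by (simp add: insertion_sum_def)

text \<open>With \<open>c = a - b\<close>, both sides are \<open>z ^ b\<close> times
  \<open>(1 - t) * h + t * (z ^ c + y ^ c)\<close>, where \<open>h\<close> is the complete
  homogeneous sum of degree \<open>c\<close> and \<open>(z - y) * h = z ^ Suc c - y ^ Suc c\<close>.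
  The two end terms explain the summands of \<open>branch_weight\<close>, which becomes
  \<open>1 + t\<close> when both ends coincide.\<close>

lemma branch_weight_sum:
  fixes y z :: "'a::field"
  assumes "b \<le> a" "z \<noteq> y"
  shows "(\<Sum>l=b..a. branch_weight t a b l * z ^ l * y ^ (a - l)) =
    z ^ a * ((z - t * y) / (z - y)) + y ^ (a - b) * z ^ b * ((y - t * z) / (y - z))"
proof -
  obtain c where c: "a = b + c" using assms(1) le_Suc_ex by blast
  define h where "h = (\<Sum>j\<le>c. z ^ j * y ^ (c - j))"
  have zy: "z - y \<noteq> 0" using assms(2) by simp
  have h: "(z - y) * h = z ^ Suc c - y ^ Suc c"
    unfolding h_def diff_power_eq_sum lessThan_Suc_atMost
    by (simp add: mult.commute cong: sum.cong)
  have "(\<Sum>l=b..a. branch_weight t a b l * z ^ l * y ^ (a - l)) =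
      (\<Sum>j\<le>c. branch_weight t c 0 j * z ^ (b + j) * y ^ (c - j))"
    by (rule sum.reindex_bij_witness[where i = "\<lambda>j. b + j" and j = "\<lambda>l. l - b"])
       (auto simp: c branch_weight_def add.commute)
  also have "\<dots> = z ^ b * (\<Sum>j\<le>c. (1 - t) * (z ^ j * y ^ (c - j)) +
      (if j = c then t * z ^ c else 0) + (if j = 0 then t * y ^ c else 0))"
    unfolding sum_distrib_left branch_weight_def
    by (intro sum.cong) (auto simp: algebra_simps power_add)
  also have "\<dots> = z ^ b * ((1 - t) * h + t * (z ^ c + y ^ c))"
    by (simp only: sum.distrib sum_distrib_left[symmetric]) (simp add: h_def algebra_simps)
  finally have L: "(\<Sum>l=b..a. branch_weight t a b l * z ^ l * y ^ (a - l)) =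
    z ^ b * ((1 - t) * h + t * (z ^ c + y ^ c))" .
  have "(z - y) * ((1 - t) * h + t * (z ^ c + y ^ c)) =
     (1 - t) * ((z - y) * h) + t * (z - y) * (z ^ c + y ^ c)"
    by (simp add: algebra_simps)
  also have "\<dots> = z ^ c * (z - t * y) - y ^ c * (y - t * z)"
    unfolding h by (simp add: algebra_simps)
  finally have "(1 - t) * h + t * (z ^ c + y ^ c) = (z ^ c * (z - t * y) - y ^ c * (y - t * z)) / (z - y)"
    using zy by (simp add: field_simps)
  also have "\<dots> = z ^ c * ((z - t * y) / (z - y)) + y ^ c * ((y - t * z) / (y - z))"
  proof -
    have "y ^ c * ((y - t * z) / (y - z)) = - (y ^ c * (y - t * z) / (z - y))"
      by (metis minus_diff_eq minus_divide_right times_divide_eq_right)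
    then show ?thesis
      by (simp only: diff_divide_distrib[of "z ^ c * (z - t * y)"] times_divide_eq_right)
        (rule diff_conv_add_uminus)
  qed
  finally show ?thesis unfolding L by (simp add: c power_add algebra_simps)
qed

lemma interlacing_props:
  assumes "ls \<in> interlacing ms"
  shows "Suc (length ls) = length ms" "sum_list ls \<le> sum_list ms"
  using assms by (induction ms arbitrary: ls rule: interlacing.induct) fastforce+

lemma finite_interlacing [simp]: "finite (interlacing ms)"
  by (induction ms rule: interlacing.induct) auto

lemma monom_val_Nil [simp]: "monom_val [] zs = 1"
  by (simp add: monom_val_def)

lemma monom_val_Cons [simp]: "monom_val (l # ls) (z # zs) = z ^ l * monom_val ls zs"
  by (simp add: monom_val_def prod.lessThan_Suc_shift del: prod.lessThan_Suc)

lemma branch_poly_single [simp]: "branch_poly t y [a] zs = y ^ a"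
  by (simp add: branch_poly_def)

lemma sum_interlacing_Cons:
  "(\<Sum>ls\<in>interlacing (a # b # ms). f ls) = (\<Sum>l=b..a. \<Sum>ls\<in>interlacing (b # ms). f (l # ls))"
proof -
  have "(\<Sum>ls\<in>interlacing (a # b # ms). f ls) =
      (\<Sum>p\<in>{b..a} \<times> interlacing (b # ms). f (case p of (l, ls) \<Rightarrow> l # ls))"
    unfolding interlacing.simps
    by (subst sum.reindex) (auto simp: inj_on_def)
  also have "\<dots> = (\<Sum>l=b..a. \<Sum>ls\<in>interlacing (b # ms). f (l # ls))"
    by (simp add: sum.cartesian_product case_prod_unfold)
  finally show ?thesis .
qed

lemma branch_poly_Cons2:
  assumes "b \<le> a"
  shows "branch_poly t y [a, b] [z] = (\<Sum>l=b..a. branch_weight t a b l * z ^ l * y ^ (a - l)) * y ^ b"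
  unfolding branch_poly_def sum_interlacing_Cons
proof (simp add: sum_distrib_right, intro sum.cong refl)
  fix l assume "l \<in> {b..a}"
  then have "a + b - l = (a - l) + b" by simp
  then show "branch_weight t a b l * y ^ (a + b - l) * z ^ l = branch_weight t a b l * z ^ l * y ^ (a - l) * y ^ b"
    by (simp add: power_add mult_ac)
qed

text \<open>This is the recursion of \<open>insertion_sum_Cons3\<close> with the product of two
  fractions replaced by \<open>t\<close>; \<open>branch_coeff\<close> is designed for it. Its
  correction is present only when the first two entries of the smaller list both equal
  \<open>b\<close>.\<close>

lemma branch_poly_Cons3:
  assumes "b \<le> a" "c \<le> b"
  shows "branch_poly t y (a # b # c # ms) (z # z' # zs) =
     (\<Sum>l=b..a. branch_weight t a b l * z ^ l * y ^ (a - l)) * branch_poly t y (b # c # ms) (z' # zs) -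
     t * y ^ (a - b) * (z * z') ^ b * branch_poly t y (c # ms) zs"
proof -
  let ?ms = "c # ms"
  define g where "g = (\<lambda>l ls. (if l = b \<and> ls = b # tl ls then t * branch_coeff t ?ms (tl ls) else 0)
     * y ^ (sum_list (a # b # ?ms) - sum_list (l # ls)) * monom_val (l # ls) (z # z' # zs))"
  have "branch_poly t y (a # b # ?ms) (z # z' # zs) =
    (\<Sum>l=b..a. \<Sum>ls\<in>interlacing (b # ?ms).
       branch_weight t a b l * z ^ l * y ^ (a - l) *
       (branch_coeff t (b # ?ms) ls * y ^ (sum_list (b # ?ms) - sum_list ls) * monom_val ls (z' # zs)) - g l ls)"
    unfolding branch_poly_def sum_interlacing_Cons[of _ a b]
  proof (intro sum.cong refl)
    fix l ls assume l: "l \<in> {b..a}" and ls: "ls \<in> interlacing (b # ?ms)"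
    have "sum_list (a # b # ?ms) - sum_list (l # ls) = (a - l) + (sum_list (b # ?ms) - sum_list ls)"
      using l interlacing_props[OF ls] by simp
    then show "branch_coeff t (a # b # ?ms) (l # ls) * y ^ (sum_list (a # b # ?ms) - sum_list (l # ls)) *
         monom_val (l # ls) (z # z' # zs) =
       branch_weight t a b l * z ^ l * y ^ (a - l) *
       (branch_coeff t (b # ?ms) ls * y ^ (sum_list (b # ?ms) - sum_list ls) * monom_val ls (z' # zs)) - g l ls"
      by (simp add: g_def power_add algebra_simps)
  qed
  also have "\<dots> = (\<Sum>l=b..a. branch_weight t a b l * z ^ l * y ^ (a - l)) * branch_poly t y (b # ?ms) (z' # zs) -
      (\<Sum>l=b..a. \<Sum>ls\<in>interlacing (b # ?ms). g l ls)"
    by (simp add: sum_subtractf branch_poly_def sum_product)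
  also have "(\<Sum>l=b..a. \<Sum>ls\<in>interlacing (b # ?ms). g l ls) = (\<Sum>ls\<in>interlacing (b # ?ms). g b ls)"
  proof -
    have "(\<Sum>l=b..a. \<Sum>ls\<in>interlacing (b # ?ms). g l ls) =
       (\<Sum>l\<in>{b}. \<Sum>ls\<in>interlacing (b # ?ms). g l ls)"
      by (rule sum.mono_neutral_right) (use assms in \<open>auto simp: g_def\<close>)
    then show ?thesis by simp
  qed
  also have "\<dots> = (\<Sum>l=c..b. \<Sum>ls\<in>interlacing ?ms. g b (l # ls))"
    by (rule sum_interlacing_Cons)
  also have "\<dots> = (\<Sum>l\<in>{b}. \<Sum>ls\<in>interlacing ?ms. g b (l # ls))"
    by (rule sum.mono_neutral_right) (use assms in \<open>auto simp: g_def\<close>)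
  also have "\<dots> = t * y ^ (a - b) * (z * z') ^ b * branch_poly t y ?ms zs"
    unfolding branch_poly_def sum_distrib_left
  proof (simp, intro sum.cong refl)
    fix ls assume ls: "ls \<in> interlacing ?ms"
    have "a + (b + (c + sum_list ms)) - (b + (b + sum_list ls)) = (a - b) + (c + sum_list ms - sum_list ls)"
      using assms interlacing_props[OF ls] by simp
    then show "g b (b # ls) = t * y ^ (a - b) * (z * z') ^ b *
       (branch_coeff t ?ms ls * y ^ (c + sum_list ms - sum_list ls) * monom_val ls zs)"
      by (simp add: g_def power_add power_mult_distrib mult_ac)
  qed
  finally show ?thesis .
qed

text \<open>With one variable beside \<open>y\<close> the poles cancel without
  symmetrization.\<close>

lemma insertion_sum_Cons2:
  assumes "b \<le> a" "z \<noteq> y"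
  shows "insertion_sum t y [a, b] [z] = branch_poly t y [a, b] [z]"
  unfolding branch_poly_Cons2[OF assms(1)] branch_weight_sum[OF assms]
proof -
  have "y ^ a = y ^ (a - b) * y ^ b"
    using assms(1) by (simp add: power_add[symmetric])
  then show "insertion_sum t y [a, b] [z] =
     (z ^ a * ((z - t * y) / (z - y)) + y ^ (a - b) * z ^ b * ((y - t * z) / (y - z))) * y ^ b"
    unfolding insertion_sum_Cons insertion_sum_Nil tail_prod_Cons tail_prod_Nil
    by (simp only: distrib_right distrib_left mult_1_left mult_1_right mult_ac)
qed

text \<open>\<open>insertion_sum_Cons\<close> for \<open>b # ms\<close> is solved for its
  \<open>tail_prod\<close> and substituted. By \<open>branch_weight_sum\<close> the fractions of
  \<open>z\<close> in front of the first term combine to a polynomial, and what remains is exactly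
  the product handled by \<open>symmetrize_straighten\<close>.\<close>

lemma insertion_sum_Cons3:
  assumes "b \<le> a" "z \<noteq> y" "z' \<noteq> y"
  shows "insertion_sum t y (a # b # ms) (z # z' # zs) =
     (\<Sum>l=b..a. branch_weight t a b l * z ^ l * y ^ (a - l)) * insertion_sum t y (b # ms) (z' # zs) -
     y ^ (a - b) * (z * z') ^ b * ((y - t * z) / (y - z) * ((z' - t * y) / (z' - y))) *
       insertion_sum t y ms zs"
proof -
  have tp: "y ^ b * tail_prod t y ms (z' # zs) =
      insertion_sum t y (b # ms) (z' # zs) - z' ^ b * ((z' - t * y) / (z' - y)) * insertion_sum t y ms zs"
    by (simp add: insertion_sum_Cons)
  have "insertion_sum t y (a # b # ms) (z # z' # zs) =
     z ^ a * ((z - t * y) / (z - y)) * insertion_sum t y (b # ms) (z' # zs) +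
     y ^ (a - b) * y ^ b * (z ^ b * ((y - t * z) / (y - z)) * tail_prod t y ms (z' # zs))"
    unfolding insertion_sum_Cons[of t y a] tail_prod_Cons using assms(1) by (simp add: power_add[symmetric])
  also have "y ^ (a - b) * y ^ b * (z ^ b * ((y - t * z) / (y - z)) * tail_prod t y ms (z' # zs)) =
     y ^ (a - b) * z ^ b * ((y - t * z) / (y - z)) * (y ^ b * tail_prod t y ms (z' # zs))"
    by (simp add: mult_ac)
  finally show ?thesis
    unfolding tp branch_weight_sum[OF assms(1,2)] by (simp only: power_mult_distrib) (simp only: algebra_simps)
qed

text \<open>The arbitrary prefix factor \<open>A\<close> keeps the recursion on the remaining rows inside a single
  symmetrization over all variables.\<close>

lemma symmetrize_insertion_sum_prefix:
  assumes two: "(2 :: 'a :: field) \<noteq> 0" and inj: "inj_on x {..<n}" and y: "y \<notin> x ` {..<n}"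
    and "sorted_wrt (\<ge>) ms" "length ms = Suc (n - q)" "q \<le> n"
    and "\<And>z z'. (\<And>i. i < q \<Longrightarrow> z i = z' i) \<Longrightarrow> A z = A z'"
  shows "symmetrize (t :: 'a) n (\<lambda>z. A z * insertion_sum t y ms (map z [q..<n])) x =
    symmetrize t n (\<lambda>z. A z * branch_poly t y ms (map z [q..<n])) x"
  using assms(4-)
proof (induction "length ms" arbitrary: ms q A rule: less_induct)
  case less
  note loc = less.prems(4)
  have ney: "(x \<circ> \<sigma>) i \<noteq> y" if "\<sigma> permutes {..<n}" "i < n" for \<sigma> i
    using that y permutes_in_image[OF that(1), of i] by auto
  consider a where "ms = [a]" | a b where "ms = [a, b]" | a b c ms' where "ms = a # b # c # ms'"
  proof -
    obtain a ms1 where ms1: "ms = a # ms1"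
      using less.prems(2) by (cases ms) auto
    show ?thesis
    proof (cases ms1)
      case Nil
      then show ?thesis using ms1 that(1) by simp
    next
      case (Cons b ms2)
      show ?thesis
        using that(2)[of a b] that(3)[of a b] ms1 Cons by (cases ms2) simp_all
    qed
  qed
  then show ?case
  proof cases
    case 1
    then have "n = q" using less.prems by simp
    then show ?thesis using 1 by simp
  next
    case 2
    then have q: "q < n" "[q..<n] = [q]"
      using less.prems upt_conv_Cons[of q n] by auto
    have "b \<le> a" using less.prems(1) 2 by simp
    then show ?thesis
      by (intro symmetrize_cong) (simp only: 2 q list.map insertion_sum_Cons2[OF _ ney[OF _ q(1)]])
  next
    case 3
    define P where "P = (\<lambda>z. \<Sum>l=b..a. branch_weight t a b l * z ^ l * y ^ (a - l))"
    \<comment> \<open>\<open>B\<close> and \<open>D\<close> are the prefixes for one and for two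
      rows fewer. \<open>D\<close> is symmetric in \<open>z q\<close> and \<open>z (Suc q)\<close>,
      as straightening requires, because \<open>A\<close> only sees earlier variables.\<close>
    define B where "B = (\<lambda>z :: nat \<Rightarrow> 'a. A z * P (z q))"
    define D where "D = (\<lambda>z :: nat \<Rightarrow> 'a. A z * (y ^ (a - b) * (z q * z (Suc q)) ^ b))"
    define h where "h = (\<lambda>z. D z * insertion_sum t y (c # ms') (map z [Suc (Suc q)..<n]))"
    have q: "Suc q < n" "[q..<n] = q # Suc q # [Suc (Suc q)..<n]" "[Suc q..<n] = Suc q # [Suc (Suc q)..<n]"
    proof -
      show "Suc q < n" using less.prems(2) 3 by simp
      then show "[q..<n] = q # Suc q # [Suc (Suc q)..<n]" "[Suc q..<n] = Suc q # [Suc (Suc q)..<n]"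
        by (simp_all only: upt_conv_Cons Suc_lessD)
    qed
    have ba: "b \<le> a" "c \<le> b" using less.prems 3 by auto
    have "symmetrize t n (\<lambda>z. A z * insertion_sum t y ms (map z [q..<n])) x =
      symmetrize t n (\<lambda>z. B z * insertion_sum t y (b # c # ms') (map z [Suc q..<n]) -
         h z * ((y - t * z q) / (y - z q) * ((z (Suc q) - t * y) / (z (Suc q) - y)))) x"
    proof (rule symmetrize_cong)
      fix \<sigma> assume \<sigma>: "\<sigma> permutes {..<n}"
      note ne = ney[OF \<sigma> Suc_lessD[OF q(1)]] ney[OF \<sigma> q(1)]
      show "A (x \<circ> \<sigma>) * insertion_sum t y ms (map (x \<circ> \<sigma>) [q..<n]) =
         B (x \<circ> \<sigma>) * insertion_sum t y (b # c # ms') (map (x \<circ> \<sigma>) [Suc q..<n]) -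
         h (x \<circ> \<sigma>) * ((y - t * (x \<circ> \<sigma>) q) / (y - (x \<circ> \<sigma>) q) *
           (((x \<circ> \<sigma>) (Suc q) - t * y) / ((x \<circ> \<sigma>) (Suc q) - y)))"
        unfolding q 3 list.map insertion_sum_Cons3[OF ba(1) ne] h_def D_def B_def P_def
        by (simp only: right_diff_distrib mult_ac)
    qed
    also have "\<dots> = symmetrize t n (\<lambda>z. B z * insertion_sum t y (b # c # ms') (map z [Suc q..<n])) x -
       t * symmetrize t n h x"
    proof -
      have "h (z \<circ> transpose q (Suc q)) = h z" for z
      proof -
        have "A (z \<circ> transpose q (Suc q)) = A z"
          by (rule loc) (simp add: transpose_def)
        moreover have "map (z \<circ> transpose q (Suc q)) [Suc (Suc q)..<n] = map z [Suc (Suc q)..<n]"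
          by (auto simp: transpose_def)
        ultimately show ?thesis
          by (simp only: h_def D_def o_apply transpose_apply_first transpose_apply_second mult.commute)
      qed
      then show ?thesis
        by (simp only: symmetrize_diff symmetrize_straighten[OF two q(1) inj y])
    qed
    also have "symmetrize t n (\<lambda>z. B z * insertion_sum t y (b # c # ms') (map z [Suc q..<n])) x =
       symmetrize t n (\<lambda>z. B z * branch_poly t y (b # c # ms') (map z [Suc q..<n])) x"
    proof (rule less.hyps)
      show "B z = B z'" if "\<And>i. i < Suc q \<Longrightarrow> z i = z' i" for z z'
        using that loc[of z z'] by (simp add: B_def)
    qed (use 3 less.prems q in auto)
    also have "symmetrize t n h x =
       symmetrize t n (\<lambda>z. D z * branch_poly t y (c # ms') (map z [Suc (Suc q)..<n])) x"
      unfolding h_def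
    proof (rule less.hyps)
      show "D z = D z'" if "\<And>i. i < Suc (Suc q) \<Longrightarrow> z i = z' i" for z z'
        using that loc[of z z'] by (simp add: D_def)
    qed (use 3 less.prems q in auto)
    also have "symmetrize t n (\<lambda>z. B z * branch_poly t y (b # c # ms') (map z [Suc q..<n])) x -
        t * symmetrize t n (\<lambda>z. D z * branch_poly t y (c # ms') (map z [Suc (Suc q)..<n])) x =
      symmetrize t n (\<lambda>z. A z * branch_poly t y ms (map z [q..<n])) x"
      unfolding symmetrize_cmult[symmetric] symmetrize_diff[symmetric] q 3 list.map
        branch_poly_Cons3[OF ba] B_def D_def P_def
      by (rule symmetrize_cong) (simp only: right_diff_distrib mult_ac)
    finally show ?thesis .
  qed
qed

section \<open>Splitting the permutations by the position of the last variable\<close>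

definition hl_sum :: "'a::field \<Rightarrow> nat \<Rightarrow> nat list \<Rightarrow> (nat \<Rightarrow> 'a) \<Rightarrow> 'a" where
  "hl_sum t k ms = symmetrize t k (\<lambda>z. \<Prod>i<k. z i ^ (ms ! i))"

text \<open>Maps positions to variables: position \<open>p\<close> receives variable
  \<open>n\<close>, and the variables from \<open>p\<close> on move up by one position.\<close>

definition insert_at :: "nat \<Rightarrow> nat \<Rightarrow> nat \<Rightarrow> nat" where
  "insert_at n p i = (if i < p \<or> i > n then i else if i = p then n else i - 1)"

lemma insert_at_permutes:
  assumes "p \<le> n"
  shows "insert_at n p permutes {..<Suc n}"
proof (rule inj_imp_permutes)
  show "inj_on (insert_at n p) {..<Suc n}"
    using assms by (auto simp: inj_on_def insert_at_def split: if_splits)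
qed (use assms in \<open>auto simp: insert_at_def\<close>)

text \<open>The permutations \<open>insert_at n p\<close> represent the cosets of the permutations
  of \<open>{..<n}\<close>; the coset of \<sigma> is read off from \<open>inv \<sigma> n\<close>,
  the position of the last variable.\<close>

lemma sum_permutes_Suc:
  "(\<Sum>\<sigma> | \<sigma> permutes {..<Suc n}. F \<sigma>) =
   (\<Sum>p\<le>n. \<Sum>\<tau> | \<tau> permutes {..<n}. F (\<tau> \<circ> insert_at n p))"
proof -
  define c where "c = insert_at n"
  have c: "c p permutes {..<Suc n}" if "p \<le> n" for p
    unfolding c_def using that by (rule insert_at_permutes)
  have cp: "c p p = n" if "p \<le> n" for p
    using that by (simp add: c_def insert_at_def)
  have inv_cp: "inv (c p) n = p" if "p \<le> n" for p
    using cp[OF that] permutes_inverses(2)[OF c[OF that]] by metis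
  have "(\<Sum>p\<le>n. \<Sum>\<tau> | \<tau> permutes {..<n}. F (\<tau> \<circ> c p)) =
     (\<Sum>(p, \<tau>)\<in>{..n} \<times> {\<tau>. \<tau> permutes {..<n}}. F (\<tau> \<circ> c p))"
    by (simp add: sum.cartesian_product)
  also have "\<dots> = (\<Sum>\<sigma> | \<sigma> permutes {..<Suc n}. F \<sigma>)"
  proof (rule sum.reindex_bij_witness[where
        i = "\<lambda>\<sigma>. (inv \<sigma> n, \<sigma> \<circ> inv (c (inv \<sigma> n)))" and j = "\<lambda>(p, \<tau>). \<tau> \<circ> c p"])
    fix pt assume pt: "pt \<in> {..n} \<times> {\<tau>. \<tau> permutes {..<n}}"
    obtain p \<tau> where [simp]: "pt = (p, \<tau>)" by fastforce
    have p: "p \<le> n" and \<tau>: "\<tau> permutes {..<n}" using pt by auto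
    have \<tau>': "\<tau> permutes {..<Suc n}" using \<tau> by (rule permutes_subset) auto
    have \<sigma>: "(\<tau> \<circ> c p) permutes {..<Suc n}" by (rule permutes_compose[OF c[OF p] \<tau>'])
    then show "(case pt of (p, \<tau>) \<Rightarrow> \<tau> \<circ> c p) \<in> {\<sigma>. \<sigma> permutes {..<Suc n}}" by simp
    have "(\<tau> \<circ> c p) p = n"
      using cp[OF p] permutes_not_in[OF \<tau>] by simp
    then have "inv (\<tau> \<circ> c p) n = p"
      using permutes_inverses(2)[OF \<sigma>] by metis
    moreover have "\<tau> \<circ> c p \<circ> inv (c p) = \<tau>"
      by (simp add: comp_assoc permutes_inv_o[OF c[OF p]])
    ultimately show "(inv (case pt of (p, \<tau>) \<Rightarrow> \<tau> \<circ> c p) n, (case pt of (p, \<tau>) \<Rightarrow> \<tau> \<circ> c p) \<circ>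
       inv (c (inv (case pt of (p, \<tau>) \<Rightarrow> \<tau> \<circ> c p) n))) = pt"
      by simp
  next
    fix \<sigma> assume "\<sigma> \<in> {\<sigma>. \<sigma> permutes {..<Suc n}}"
    then have \<sigma>: "\<sigma> permutes {..<Suc n}" by simp
    define p where "p = inv \<sigma> n"
    have p: "p \<le> n"
      using permutes_in_image[OF permutes_inv[OF \<sigma>], of n] by (simp add: p_def)
    show "(case (inv \<sigma> n, \<sigma> \<circ> inv (c (inv \<sigma> n))) of (p, \<tau>) \<Rightarrow> \<tau> \<circ> c p) = \<sigma>"
      using p by (simp add: p_def[symmetric] comp_assoc permutes_inv_o[OF c[OF p]])
    have "(\<sigma> \<circ> inv (c p)) permutes {..<Suc n}"
      by (rule permutes_compose[OF permutes_inv[OF c[OF p]] \<sigma>])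
    moreover have "(\<sigma> \<circ> inv (c p)) n = n"
      using inv_cp[OF p] permutes_inverses(1)[OF \<sigma>] by (simp add: p_def)
    ultimately have "(\<sigma> \<circ> inv (c p)) permutes {..<n}"
      by (elim permutes_superset) auto
    then show "(inv \<sigma> n, \<sigma> \<circ> inv (c (inv \<sigma> n))) \<in> {..n} \<times> {\<tau>. \<tau> permutes {..<n}}"
      using p by (simp add: p_def)
  qed auto
  finally show ?thesis by (simp add: c_def)
qed

lemma prod_insert_at:
  assumes "p \<le> n"
  shows "(\<Prod>i<Suc n. f i (z (insert_at n p i))) =
    f p (z n) * (\<Prod>i<p. f i (z i)) * (\<Prod>i=p..<n. f (Suc i) (z i))"
proof -
  have "{..<Suc n} = insert p ({..<p} \<union> {Suc p..<Suc n})"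
    using assms by auto
  then have "(\<Prod>i<Suc n. f i (z (insert_at n p i))) =
      (\<Prod>i\<in>insert p ({..<p} \<union> {Suc p..<Suc n}). f i (z (insert_at n p i)))"
    by (simp only:)
  also have "\<dots> = f p (z (insert_at n p p)) *
      (\<Prod>i\<in>{..<p} \<union> {Suc p..<Suc n}. f i (z (insert_at n p i)))"
    by (rule prod.insert) auto
  also have "(\<Prod>i\<in>{..<p} \<union> {Suc p..<Suc n}. f i (z (insert_at n p i))) =
     (\<Prod>i<p. f i (z (insert_at n p i))) * (\<Prod>i=Suc p..<Suc n. f i (z (insert_at n p i)))"
    by (rule prod.union_disjoint) auto
  also have "(\<Prod>i=Suc p..<Suc n. f i (z (insert_at n p i))) = (\<Prod>i=p..<n. f (Suc i) (z i))"
    unfolding prod.shift_bounds_Suc_ivl by (rule prod.cong) (auto simp: insert_at_def)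
  also have "(\<Prod>i<p. f i (z (insert_at n p i))) = (\<Prod>i<p. f i (z i))"
    using assms by (intro prod.cong) (auto simp: insert_at_def)
  also have "insert_at n p p = n"
    using assms by (simp add: insert_at_def)
  finally show ?thesis by (simp add: mult.assoc)
qed

lemma hl_kernel_insert_at:
  assumes p: "p \<le> n"
  shows "hl_kernel t (Suc n) (z \<circ> insert_at n p) = hl_kernel t n z *
    (\<Prod>i<p. (z i - t * z n) / (z i - z n)) * (\<Prod>i=p..<n. (z n - t * z i) / (z n - z i))"
proof -
  \<comment> \<open>\<open>d\<close> enumerates the positions other than \<open>p\<close> in
    increasing order. Pairs of such positions give the kernel in \<open>n\<close> variables, pairs
    involving \<open>p\<close> give the two extra products.\<close>
  define d where "d = (\<lambda>i. if i < p then i else Suc i)"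
  define f where "f = (\<lambda>(i, j). (z (insert_at n p i) - t * z (insert_at n p j)) /
     (z (insert_at n p i) - z (insert_at n p j)))"
  have d: "insert_at n p (d i) = i" if "i < n" for i
    using that by (auto simp: d_def insert_at_def)
  have sets: "{(i, j). i < j \<and> j < Suc n} = map_prod d d ` {(i, j). i < j \<and> j < n} \<union>
      (\<lambda>i. (i, p)) ` {..<p} \<union> (\<lambda>i. (p, Suc i)) ` {p..<n}" (is "?L = ?A \<union> ?B \<union> ?C")
  proof (intro equalityI subsetI)
    fix q assume "q \<in> ?L"
    then obtain i j where q: "q = (i, j)" "i < j" "j < Suc n" by auto
    consider "j = p" | "i = p" | "i \<noteq> p" "j \<noteq> p" by blast
    then show "q \<in> ?A \<union> ?B \<union> ?C"
    proof cases
      case 2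
      then have "q = (\<lambda>i. (p, Suc i)) (j - 1)" "j - 1 \<in> {p..<n}" using q by auto
      then show ?thesis by blast
    next
      case 3
      define i' j' where "i' = insert_at n p i" and "j' = insert_at n p j"
      have "i = d i'" "j = d j'" "i' < j'" "j' < n"
        using 3 q p by (auto simp: i'_def j'_def d_def insert_at_def)
      then have "q = map_prod d d (i', j')" "(i', j') \<in> {(i, j). i < j \<and> j < n}"
        using q by auto
      then show ?thesis by blast
    qed (use q in auto)
  qed (use p in \<open>auto simp: d_def\<close>)
  have dis: "?A \<inter> ?B = {}" "(?A \<union> ?B) \<inter> ?C = {}"
    by (auto simp: d_def split: if_splits)
  have fin: "finite ?A" using finite_pairs_less by blast
  have "hl_kernel t (Suc n) (z \<circ> insert_at n p) = prod f ?L"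
    by (simp add: hl_kernel_def f_def)
  also have "\<dots> = prod f ?A * prod f ?B * prod f ?C"
    unfolding sets using dis fin by (subst prod.union_disjoint; simp)+
  also have "prod f ?A = hl_kernel t n z"
  proof -
    have "inj d" by (auto simp: inj_def d_def split: if_splits)
    then have "inj_on (map_prod d d) {(i, j). i < j \<and> j < n}"
      by (metis prod.inj_map inj_on_subset subset_UNIV)
    then show ?thesis
      unfolding hl_kernel_def by (subst prod.reindex) (auto intro!: prod.cong simp: f_def d)
  qed
  also have "prod f ?B = (\<Prod>i<p. (z i - t * z n) / (z i - z n))"
    using p by (subst prod.reindex) (auto intro!: prod.cong inj_onI simp: f_def insert_at_def)
  also have "prod f ?C = (\<Prod>i=p..<n. (z n - t * z i) / (z n - z i))"
    using p by (subst prod.reindex) (auto intro!: prod.cong inj_onI simp: f_def insert_at_def)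
  finally show ?thesis .
qed

lemma hl_sum_Suc:
  "hl_sum t (Suc n) ms x = symmetrize t n (\<lambda>z. insertion_sum t (x n) ms (map z [0..<n])) x"
proof -
  have "hl_sum t (Suc n) ms x = (\<Sum>p\<le>n. \<Sum>\<tau> | \<tau> permutes {..<n}.
     (\<Prod>i<Suc n. (x \<circ> \<tau>) (insert_at n p i) ^ (ms ! i)) * hl_kernel t (Suc n) ((x \<circ> \<tau>) \<circ> insert_at n p))"
    unfolding hl_sum_def symmetrize_def sum_permutes_Suc by (simp only: o_assoc o_apply)
  also have "\<dots> = (\<Sum>p\<le>n. \<Sum>\<tau> | \<tau> permutes {..<n}.
     x n ^ (ms ! p) * (\<Prod>i<p. (x \<circ> \<tau>) i ^ (ms ! i) * (((x \<circ> \<tau>) i - t * x n) / ((x \<circ> \<tau>) i - x n))) *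
     (\<Prod>i=p..<n. (x \<circ> \<tau>) i ^ (ms ! Suc i) * ((x n - t * (x \<circ> \<tau>) i) / (x n - (x \<circ> \<tau>) i))) *
     hl_kernel t n (x \<circ> \<tau>))"
  proof (intro sum.cong refl)
    fix p \<tau> assume "p \<in> {..n}" and "\<tau> \<in> {\<tau>. \<tau> permutes {..<n}}"
    then have p: "p \<le> n" and \<tau>: "\<tau> permutes {..<n}" by auto
    have "(x \<circ> \<tau>) n = x n"
      using permutes_not_in[OF \<tau>] by simp
    then show "(\<Prod>i<Suc n. (x \<circ> \<tau>) (insert_at n p i) ^ (ms ! i)) *
         hl_kernel t (Suc n) ((x \<circ> \<tau>) \<circ> insert_at n p) =
       x n ^ (ms ! p) * (\<Prod>i<p. (x \<circ> \<tau>) i ^ (ms ! i) * (((x \<circ> \<tau>) i - t * x n) / ((x \<circ> \<tau>) i - x n))) *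
       (\<Prod>i=p..<n. (x \<circ> \<tau>) i ^ (ms ! Suc i) * ((x n - t * (x \<circ> \<tau>) i) / (x n - (x \<circ> \<tau>) i))) *
       hl_kernel t n (x \<circ> \<tau>)"
      unfolding prod_insert_at[OF p, of "\<lambda>i a. a ^ (ms ! i)" "x \<circ> \<tau>"] hl_kernel_insert_at[OF p] prod.distrib
      by (simp only: mult_ac)
  qed
  also have "\<dots> = symmetrize t n (\<lambda>z. insertion_sum t (x n) ms (map z [0..<n])) x"
    unfolding symmetrize_def insertion_sum_def sum_distrib_right
    by (subst sum.swap) (auto intro!: sum.cong prod.cong simp: mult.assoc)
  finally show ?thesis .
qed

text \<open>The case of an empty prefix in \<open>symmetrize_insertion_sum_prefix\<close>. The
  variables are distinct so that no denominator of the kernel vanishes.\<close>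

theorem hl_sum_branching:
  assumes two: "(2 :: 'a :: field) \<noteq> 0" and inj: "inj_on x {..<Suc n}"
    and ms: "sorted_wrt (\<ge>) ms" "length ms = Suc n"
  shows "hl_sum (t :: 'a) (Suc n) ms x =
    (\<Sum>ls\<in>interlacing ms. branch_coeff t ms ls * x n ^ (sum_list ms - sum_list ls) * hl_sum t n ls x)"
proof -
  have notin: "x n \<notin> x ` {..<n}"
    using inj by (fastforce simp: inj_on_def)
  have "hl_sum t (Suc n) ms x = symmetrize t n (\<lambda>z. branch_poly t (x n) ms (map z [0..<n])) x"
    unfolding hl_sum_Suc
    using notin symmetrize_insertion_sum_prefix[of x n "x n" ms 0 "\<lambda>_. 1" t] assms
    by (auto simp: inj_on_def)
  also have "\<dots> = symmetrize t n (\<lambda>z. \<Sum>ls\<in>interlacing ms.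
     (branch_coeff t ms ls * x n ^ (sum_list ms - sum_list ls)) * (\<Prod>i<n. z i ^ (ls ! i))) x"
  proof (rule symmetrize_cong)
    have "monom_val ls (map z [0..<n]) = (\<Prod>i<n. z i ^ (ls ! i))" if "ls \<in> interlacing ms"
      for ls and z :: "nat \<Rightarrow> 'a"
      using interlacing_props(1)[OF that] ms by (simp add: monom_val_def)
    then show "branch_poly t (x n) ms (map (x \<circ> \<sigma>) [0..<n]) = (\<Sum>ls\<in>interlacing ms.
     (branch_coeff t ms ls * x n ^ (sum_list ms - sum_list ls)) * (\<Prod>i<n. (x \<circ> \<sigma>) i ^ (ls ! i)))" for \<sigma>
      by (auto simp: branch_poly_def intro!: sum.cong)
  qed
  finally show ?thesis
    by (simp add: symmetrize_sum symmetrize_cmult hl_sum_def)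
qed

section \<open>The branching coefficients\<close>

text \<open>The local factor at a value occurring \<open>m\<close> times in the larger and \<open>l\<close> times in the smaller
  of two interlacing lists.\<close>

definition mult_weight :: "'a::comm_ring_1 \<Rightarrow> nat \<Rightarrow> nat \<Rightarrow> 'a" where
  "mult_weight t m l = (if l = m then 1 else if l = Suc m then 1 - t
     else if m = Suc l then \<Sum>i<m. t ^ i else 0)"

lemma interlacing_le_hd:
  assumes "ls \<in> interlacing (a # ms)" "sorted_wrt (\<ge>) (a # ms)" "l \<in> set ls"
  shows "l \<le> a"
  using assms
proof (induction ms arbitrary: a ls)
  case (Cons b ms)
  then obtain l' ls' where "ls = l' # ls'" "l' \<le> a" "ls' \<in> interlacing (b # ms)"
    by auto
  with Cons.IH[of ls' b] Cons.prems show ?case by (fastforce dest: order_trans)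
qed simp

lemma sorted_interlacing:
  assumes "ls \<in> interlacing ms" "sorted_wrt (\<ge>) ms"
  shows "sorted_wrt (\<ge>) ls"
  using assms
proof (induction ms arbitrary: ls rule: interlacing.induct)
  case (3 a b ms)
  then obtain l ls' where "ls = l # ls'" "b \<le> l" "ls' \<in> interlacing (b # ms)"
    by auto
  with 3 interlacing_le_hd[of ls' b ms] show ?case by (fastforce dest: order_trans)
qed auto

text \<open>Passing to columns turns interlacing into a difference of 0 or 1. Multiplicities are
  differences of consecutive columns and are bounded from here.\<close>

lemma conj_part_interlacing:
  assumes "ls \<in> interlacing ms" "sorted_wrt (\<ge>) ms"
  shows "conj_part ls x \<le> conj_part ms x \<and> conj_part ms x \<le> Suc (conj_part ls x)"
  using assms
proof (induction ms arbitrary: ls rule: interlacing.induct)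
  case (3 a b ms)
  then obtain l ls' where ls: "ls = l # ls'" "b \<le> l" "l \<le> a" "ls' \<in> interlacing (b # ms)"
    by auto
  have *: "conj_part (b # ms) x = 0" if "l < x"
    using that ls 3(3) by (auto simp: conj_part_def filter_empty_conv)
  show ?case
    using 3(1)[OF ls(4)] 3(3) ls * by (auto simp: conj_part_def)
qed (auto simp: conj_part_def)

lemma conj_part_Suc_nat: "conj_part lam (x :: nat) = conj_part lam (Suc x) + count_list lam x"
  by (induction lam) (auto simp: conj_part_def)

lemma count_list_interlacing:
  assumes "ls \<in> interlacing ms" "sorted_wrt (\<ge>) ms"
  shows "count_list ls x \<le> Suc (count_list ms x)" "count_list ms x \<le> Suc (count_list ls x)"
  using conj_part_interlacing[OF assms, of x] conj_part_interlacing[OF assms, of "Suc x"]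
    conj_part_Suc_nat[of ls x] conj_part_Suc_nat[of ms x] by linarith+

text \<open>Nothing lies above the largest entry \<open>b\<close>, so its multiplicity is a column
  length itself. This excludes the surplus of one that \<open>count_list_interlacing\<close>
  allows.\<close>

lemma count_list_interlacing_hd:
  assumes "ls \<in> interlacing (b # ms)" "sorted_wrt (\<ge>) (b # ms)"
  shows "count_list ls b \<le> count_list (b # ms) b"
proof -
  have "conj_part (b # ms) (Suc b) = 0"
    using assms(2) by (auto simp: conj_part_def filter_empty_conv)
  then show ?thesis
    using conj_part_interlacing[OF assms, of b] conj_part_interlacing[OF assms, of "Suc b"]
    conj_part_Suc_nat[of ls b] conj_part_Suc_nat[of "b # ms" b] by linarith
qed

lemma mult_weight_simps [simp]:
  "mult_weight t m m = 1" "mult_weight t m (Suc m) = 1 - t"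
  "mult_weight t (Suc m) m = (\<Sum>i\<le>m. t ^ i)"
  by (auto simp: mult_weight_def lessThan_Suc_atMost)

text \<open>The effect of one more copy of the largest part in the smaller list alone, or in both
  lists. Both rest on \<open>1 + t * (1 + ... + t ^ j) = 1 + ... + t ^ Suc j\<close>; the factor
  \<open>1 + t\<close> is \<open>branch_weight\<close> at \<open>a = l = b\<close>.\<close>

lemma mult_weight_step:
  assumes "k \<le> m" "m \<le> Suc k" "0 < m"
  shows "mult_weight t m (Suc k) = mult_weight t m k -
      (if 0 < k then t * mult_weight t (m - 1) (k - 1) else 0)"
    and "mult_weight t (Suc m) (Suc k) = (1 + t) * mult_weight t m k -
      (if 0 < k then t * mult_weight t (m - 1) (k - 1) else 0)"
proof -
  have geo: "(\<Sum>i\<le>Suc j. t ^ i) = 1 + t * (\<Sum>i\<le>j. t ^ i)" for j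
    unfolding sum.atMost_Suc_shift by (simp add: sum_distrib_left)
  have "m = k \<or> m = Suc k" using assms by auto
  then show "mult_weight t m (Suc k) = mult_weight t m k -
      (if 0 < k then t * mult_weight t (m - 1) (k - 1) else 0)"
    and "mult_weight t (Suc m) (Suc k) = (1 + t) * mult_weight t m k -
      (if 0 < k then t * mult_weight t (m - 1) (k - 1) else 0)"
    using assms(3) by (cases k; auto simp: geo algebra_simps simp del: sum.atMost_Suc)+
qed

text \<open>Values occurring in neither list contribute 1, so any bound \<open>M\<close> on the
  parts gives the same product; a common range makes different lists comparable.\<close>

definition mult_prod :: "nat \<Rightarrow> 'a::comm_ring_1 \<Rightarrow> nat list \<Rightarrow> nat list \<Rightarrow> 'a" where
  "mult_prod M t ms ls = (\<Prod>x\<le>M. mult_weight t (count_list ms x) (count_list ls x))"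

text \<open>The closed form obeys the recursion of \<open>branch_coeff\<close>. Only the factors at
  the prepended values change, and values above \<open>b\<close> are new, since no entry of
  \<open>b # ms\<close> or \<open>ls\<close> exceeds \<open>b\<close>. The subtraction matters only
  for \<open>l = b\<close>, where \<open>mult_weight_step\<close> applies.\<close>

lemma mult_prod_Cons:
  assumes s: "sorted_wrt (\<ge>) (a # b # ms)" and M: "a \<le> M" and l: "b \<le> l" "l \<le> a"
    and ls: "ls \<in> interlacing (b # ms)"
  shows "mult_prod M t (a # b # ms) (l # ls) = branch_weight t a b l * mult_prod M t (b # ms) ls -
     (if ms \<noteq> [] \<and> l = b \<and> ls = b # tl ls then t * mult_prod M t ms (tl ls) else 0)"
proof -
  define g where "g = (\<lambda>(ms :: nat list) ls x. mult_weight t (count_list ms x) (count_list ls x))"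
  define R where "R = prod (g (b # ms) ls) ({..M} - {a, b, l})"
  have split: "mult_prod M t ms' ls' = R * prod (g ms' ls') {a, b, l}"
    if "\<And>x. x \<notin> {a, b, l} \<Longrightarrow> g ms' ls' x = g (b # ms) ls x" for ms' ls'
  proof -
    have "mult_prod M t ms' ls' = prod (g ms' ls') {..M}"
      by (simp add: mult_prod_def g_def)
    also have "\<dots> = prod (g ms' ls') ({..M} - {a, b, l}) * prod (g ms' ls') {a, b, l}"
      by (rule prod.subset_diff) (use s l M in auto)
    also have "prod (g ms' ls') ({..M} - {a, b, l}) = R"
      unfolding R_def using that by (intro prod.cong) auto
    finally show ?thesis .
  qed
  have s': "sorted_wrt (\<ge>) (b # ms)" using s by simp
  have split1: "mult_prod M t (a # b # ms) (l # ls) = R * prod (g (a # b # ms) (l # ls)) {a, b, l}"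
    by (rule split) (auto simp: g_def)
  have split2: "mult_prod M t (b # ms) ls = R * prod (g (b # ms) ls) {a, b, l}"
    by (rule split) simp
  have leb: "x \<le> b" if "x \<in> set ls \<union> set (b # ms)" for x
    using that interlacing_le_hd[OF ls s'] s' by auto
  have cnt0: "count_list ls x = 0" "count_list (b # ms) x = 0" if "b < x" for x
    using leb[of x] that by (auto simp: count_list_0_iff)
  consider "b < l" "l = a" | "b < l" "l < a" | "l = b" using l by linarith
  then show ?thesis
  proof cases
    case 1
    then have "{a, b, l} = {a, b}" "a \<noteq> b" by auto
    then show ?thesis
      unfolding split1 split2 using cnt0[of a] 1 by (simp add: g_def branch_weight_def)
  next
    case 2
    then have "a \<noteq> b" "l \<noteq> b" "a \<noteq> l" by auto
    then show ?thesis
      unfolding split1 split2 using cnt0[of a] cnt0[of l] 2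
      by (simp add: g_def branch_weight_def)
  next
    case 3
    define m where "m = count_list (b # ms) b"
    define k where "k = count_list ls b"
    have mk: "k \<le> m" "m \<le> Suc k" "0 < m"
      using count_list_interlacing_hd[OF ls s'] count_list_interlacing(2)[OF ls s', of b]
      by (auto simp: m_def k_def)
    \<comment> \<open>The entries of the weakly decreasing \<open>ls\<close> are at most
      \<open>b\<close>, so \<open>b\<close> occurs in \<open>ls\<close> exactly when it comes
      first.\<close>
    have hd: "ms \<noteq> [] \<and> ls = b # tl ls \<longleftrightarrow> 0 < k"
    proof
      assume "0 < k"
      then have "b \<in> set ls" by (metis k_def count_list_0_iff less_numeral_extra(3))
      then obtain y ys where ys: "ls = y # ys" "b \<in> set ls" by (cases ls) auto
      then have "b \<le> y" using sorted_interlacing[OF ls s'] by auto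
      with leb[of y] ys have "y = b" by auto
      then show "ms \<noteq> [] \<and> ls = b # tl ls"
        using ys interlacing_props(1)[OF ls] by auto
    next
      assume "ms \<noteq> [] \<and> ls = b # tl ls"
      then show "0 < k" by (metis k_def count_list.simps(2) zero_less_Suc add_gr_0 zero_less_one)
    qed
    define e where "e = (if 0 < k then t * mult_weight t (m - 1) (k - 1) else 0)"
    have third: "(if ms \<noteq> [] \<and> l = b \<and> ls = b # tl ls then t * mult_prod M t ms (tl ls) else 0) =
       e * (R * prod (g (b # ms) ls) ({a, b} - {b}))"
    proof (cases "0 < k")
      case True
      then have ls': "ls = b # tl ls" using hd by blast
      have g': "g ms (tl ls) x = g (b # ms) ls x" if "x \<noteq> b" for x
        using that by (subst (2) ls') (simp add: g_def)
      have gb: "g ms (tl ls) b = mult_weight t (m - 1) (k - 1)"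
        unfolding m_def k_def by (subst (2) ls') (simp add: g_def)
      have "mult_prod M t ms (tl ls) = R * prod (g ms (tl ls)) {a, b, l}"
        by (rule split) (use g' in auto)
      also have "prod (g ms (tl ls)) {a, b, l} = g ms (tl ls) b * prod (g ms (tl ls)) ({a, b} - {b})"
        using 3 by (subst prod.remove[of _ b]) auto
      also have "prod (g ms (tl ls)) ({a, b} - {b}) = prod (g (b # ms) ls) ({a, b} - {b})"
        using g' by (intro prod.cong) auto
      finally show ?thesis using True hd 3 by (simp add: gb e_def mult_ac)
    qed (use hd in \<open>auto simp: e_def\<close>)
    have gb: "g (b # ms) ls b = mult_weight t m k" by (simp add: g_def m_def k_def)
    show ?thesis
    proof (cases "a = b")
      case True
      have "g (b # b # ms) (b # ls) b = mult_weight t (Suc m) (Suc k)"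
        by (simp add: g_def m_def k_def)
      then have gB: "g (b # b # ms) (b # ls) b = (1 + t) * mult_weight t m k - e"
        unfolding mult_weight_step(2)[OF mk] e_def .
      show ?thesis
        unfolding split1 split2 third using True 3
        by (simp add: branch_weight_def gb gB algebra_simps)
    next
      case False
      then have "a > b" using l by simp
      have ga: "g (a # b # ms) (b # ls) a = 1" "g (b # ms) ls a = 1"
        using cnt0[of a] \<open>a > b\<close> by (simp_all add: g_def)
      have "g (a # b # ms) (l # ls) b = mult_weight t m (Suc k)"
        using False 3 by (simp add: g_def m_def k_def)
      then have gB: "g (a # b # ms) (b # ls) b = mult_weight t m k - e"
        unfolding mult_weight_step(1)[OF mk] e_def 3 .
      show ?thesis
        unfolding split1 split2 third using False 3
        by (simp add: branch_weight_def gb gB ga algebra_simps insert_Diff_if)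
    qed
  qed
qed

lemma branch_coeff_eq_mult_prod:
  assumes "ls \<in> interlacing ms" "sorted_wrt (\<ge>) ms" "set ms \<subseteq> {..M}"
  shows "branch_coeff t ms ls = mult_prod M t ms ls"
  using assms
proof (induction t ms ls rule: branch_coeff.induct)
  case (1 t a b ms l ls)
  then have l: "b \<le> l" "l \<le> a" and ls: "ls \<in> interlacing (b # ms)" by auto
  have tl: "tl ls \<in> interlacing ms" if "ms \<noteq> []"
    using that ls by (cases ms) auto
  have "branch_coeff t (b # ms) ls = mult_prod M t (b # ms) ls"
    using 1 ls by auto
  moreover have "branch_coeff t ms (tl ls) = mult_prod M t ms (tl ls)"
    if "ms \<noteq> [] \<and> l = b \<and> ls = b # tl ls"
    using 1(2)[OF that] tl that 1(4,5) by auto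
  ultimately show ?case
    using mult_prod_Cons[OF 1(4) _ l ls, of M t] 1(5) by simp
next
  case (2 t a)
  have "mult_prod M t [a] [] = 1"
    unfolding mult_prod_def
    by (intro prod.neutral) (auto simp: mult_weight_def)
  then show ?case by simp
qed auto

section \<open>Partitions and the branching rule\<close>

definition pad :: "nat \<Rightarrow> nat list \<Rightarrow> nat list" where
  "pad k lam = lam @ replicate (k - length lam) 0"

definition interlaces :: "nat list \<Rightarrow> nat list \<Rightarrow> bool" where
  "interlaces kap \<mu> \<longleftrightarrow> kap \<in> partitions \<and>
     (\<forall>i. nth_default 0 \<mu> (Suc i) \<le> nth_default 0 kap i \<and> nth_default 0 kap i \<le> nth_default 0 \<mu> i)"

text \<open>The one-variable weight usually written psi. Multiplicities are those of unpadded
  partitions, so the value 0 is not counted.\<close>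

definition HL_psi :: "'a::comm_ring_1 \<Rightarrow> nat list \<Rightarrow> nat list \<Rightarrow> 'a" where
  "HL_psi t \<mu> kap = (\<Prod>x | x \<in> set kap \<and> count_list kap x = Suc (count_list \<mu> x). 1 - t ^ count_list kap x)"

text \<open>For \<open>lam = []\<close> these are the Hall--Littlewood polynomials.\<close>

primrec skew_P :: "'a::comm_ring_1 \<Rightarrow> nat \<Rightarrow> nat list \<Rightarrow> nat list \<Rightarrow> (nat \<Rightarrow> 'a) \<Rightarrow> 'a" where
  "skew_P t 0 lam \<mu> x = (if lam = \<mu> then 1 else 0)"
| "skew_P t (Suc N) lam \<mu> x = (\<Sum>kap | interlaces kap \<mu>.
     HL_psi t \<mu> kap * x N ^ (sum_list \<mu> - sum_list kap) * skew_P t N lam kap x)"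

lemma length_pad: "length lam \<le> k \<Longrightarrow> length (pad k lam) = k"
  by (simp add: pad_def)

lemma nth_pad: "i < k \<Longrightarrow> pad k lam ! i = nth_default 0 lam i"
  by (auto simp: pad_def nth_append nth_default_def)

lemma sum_list_pad [simp]: "sum_list (pad k lam) = sum_list lam"
  by (simp add: pad_def sum_list_replicate)

lemma count_list_replicate: "count_list (replicate n x) y = (if x = y then n else 0)"
  by (induction n) auto

lemma count_list_pad: "count_list (pad k lam) x = count_list lam x + (if x = 0 then k - length lam else 0)"
  by (simp add: pad_def count_list_replicate)

lemma set_pad_subset: "set (pad k lam) \<subseteq> insert 0 (set lam)"
  by (auto simp: pad_def)

lemma sorted_pad: "lam \<in> partitions \<Longrightarrow> sorted_wrt (\<ge>) (pad k lam)"
proof -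
  have "sorted_wrt (\<ge>) (replicate n (0 :: nat))" for n
    by (induction n) auto
  then show "lam \<in> partitions \<Longrightarrow> sorted_wrt (\<ge>) (pad k lam)"
    by (auto simp: pad_def partitions_def sorted_wrt_append)
qed

lemma nth_default_partition_pos_iff:
  assumes "lam \<in> partitions"
  shows "0 < nth_default 0 lam i \<longleftrightarrow> i < length lam"
  using assms by (auto simp: partitions_def nth_default_def in_set_conv_nth)

lemma partition_eqI:
  assumes "lam \<in> partitions" "\<mu> \<in> partitions" "\<And>i. nth_default 0 lam i = nth_default 0 \<mu> i"
  shows "lam = \<mu>"
proof -
  have "i < length lam \<longleftrightarrow> i < length \<mu>" for i
    using nth_default_partition_pos_iff[OF assms(1)] nth_default_partition_pos_iff[OF assms(2)] assms(3)
    by metis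
  then have len: "length lam = length \<mu>" by (metis linorder_neqE_nat order_less_irrefl)
  show ?thesis
    by (rule nth_equalityI[OF len]) (use assms(3) len in \<open>metis nth_default_nth\<close>)
qed

lemma partition_antimono:
  assumes "lam \<in> partitions" "i \<le> j"
  shows "nth_default 0 lam j \<le> nth_default 0 lam i"
  using assms by (cases "i = j") (auto simp: partitions_def nth_default_def sorted_wrt_iff_nth_less)

definition of_padded :: "nat list \<Rightarrow> nat list" where
  "of_padded ls = filter (\<lambda>x. x \<noteq> 0) ls"

lemma of_padded_pad: "lam \<in> partitions \<Longrightarrow> of_padded (pad k lam) = lam"
  by (auto simp: of_padded_def pad_def partitions_def intro!: filter_True) (metis gr0I)

lemma of_padded_partition: "sorted_wrt (\<ge>) ls \<Longrightarrow> of_padded ls \<in> partitions"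
  by (auto simp: of_padded_def partitions_def sorted_wrt_filter)

lemma length_of_padded: "length (of_padded ls) \<le> length ls"
  by (simp add: of_padded_def)

lemma pad_of_padded: "sorted_wrt (\<ge>) ls \<Longrightarrow> pad (length ls) (of_padded ls) = ls"
proof (induction ls)
  case (Cons l ls)
  show ?case
  proof (cases "l = 0")
    case True
    then have "\<forall>x\<in>set ls. x = 0" using Cons.prems by auto
    then have "of_padded ls = []" "ls = replicate (length ls) 0"
      by (auto simp: of_padded_def filter_empty_conv replicate_length_same)
    then show ?thesis using True by (simp add: pad_def of_padded_def)
  next
    case False
    then show ?thesis using Cons by (simp add: pad_def of_padded_def)
  qed
qed (simp add: pad_def of_padded_def)

lemma in_interlacing_iff:
  "ls \<in> interlacing ms \<longleftrightarrow> Suc (length ls) = length ms \<and>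
     (\<forall>i<length ls. ms ! Suc i \<le> ls ! i \<and> ls ! i \<le> ms ! i)"
proof (induction ms arbitrary: ls rule: interlacing.induct)
  case (3 a b ms)
  show ?case
  proof (cases ls)
    case (Cons l ls')
    have "ls \<in> interlacing (a # b # ms) \<longleftrightarrow> b \<le> l \<and> l \<le> a \<and> ls' \<in> interlacing (b # ms)"
      unfolding Cons by auto
    then show ?thesis unfolding 3 Cons by (auto simp: All_less_Suc2)
  qed auto
qed auto

lemma bij_betw_pad_interlaces:
  assumes "\<mu> \<in> partitions" "length \<mu> \<le> Suc k"
  shows "bij_betw (pad k) {kap. interlaces kap \<mu> \<and> length kap \<le> k} (interlacing (pad (Suc k) \<mu>))"
proof (rule bij_betw_byWitness[where f' = of_padded])
  show "\<forall>kap\<in>{kap. interlaces kap \<mu> \<and> length kap \<le> k}. of_padded (pad k kap) = kap"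
    by (auto simp: interlaces_def of_padded_pad)
  have srt: "sorted_wrt (\<ge>) ls" "length ls = k" if "ls \<in> interlacing (pad (Suc k) \<mu>)" for ls
    using sorted_interlacing[OF that sorted_pad[OF assms(1)]] interlacing_props(1)[OF that]
      length_pad[OF assms(2)] by auto
  show "\<forall>ls\<in>interlacing (pad (Suc k) \<mu>). pad k (of_padded ls) = ls"
    using srt pad_of_padded by metis
  show "pad k ` {kap. interlaces kap \<mu> \<and> length kap \<le> k} \<subseteq> interlacing (pad (Suc k) \<mu>)"
    using assms by (auto simp: in_interlacing_iff length_pad nth_pad interlaces_def)
  show "of_padded ` interlacing (pad (Suc k) \<mu>) \<subseteq> {kap. interlaces kap \<mu> \<and> length kap \<le> k}"
  proof (intro image_subsetI CollectI conjI)
    fix ls assume ls: "ls \<in> interlacing (pad (Suc k) \<mu>)"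
    note s = srt[OF ls]
    show len: "length (of_padded ls) \<le> k" using s length_of_padded[of ls] by simp
    have eq: "nth_default 0 (of_padded ls) i = (if i < k then ls ! i else 0)" for i
      using nth_pad[of i k "of_padded ls"] pad_of_padded[OF s(1)] s(2) len
      by (auto simp: nth_default_def)
    show "interlaces (of_padded ls) \<mu>"
      unfolding interlaces_def eq
      using of_padded_partition[OF s(1)] ls assms(2) s(2)
      by (auto simp: in_interlacing_iff nth_pad nth_default_def)
  qed
qed

lemma interlaces_bounds:
  assumes "interlaces kap \<mu>"
  shows "length kap \<le> length \<mu>" "sum_list kap \<le> sum_list \<mu>" "\<mu> \<in> partitions \<Longrightarrow> length \<mu> \<le> Suc (length kap)"
proof -
  have kap: "kap \<in> partitions" using assms by (simp add: interlaces_def)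
  show len: "length kap \<le> length \<mu>"
  proof (rule ccontr)
    assume "\<not> ?thesis"
    then have "0 < nth_default 0 kap (length \<mu>)"
      by (simp add: nth_default_partition_pos_iff[OF kap])
    moreover have "nth_default 0 kap (length \<mu>) \<le> nth_default 0 \<mu> (length \<mu>)"
      using assms by (simp add: interlaces_def)
    ultimately show False by (simp add: nth_default_def)
  qed
  have "sum_list kap = (\<Sum>i<length \<mu>. nth_default 0 kap i)"
    unfolding sum_list_pad[of "length \<mu>" kap, symmetric] using len
    by (simp add: sum_list_sum_nth length_pad nth_pad lessThan_atLeast0)
  also have "\<dots> \<le> (\<Sum>i<length \<mu>. nth_default 0 \<mu> i)"
    using assms by (intro sum_mono) (simp add: interlaces_def)
  also have "\<dots> = sum_list \<mu>"
    by (simp add: sum_list_sum_nth lessThan_atLeast0 nth_default_def)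
  finally show "sum_list kap \<le> sum_list \<mu>" .
  assume mu: "\<mu> \<in> partitions"
  show "length \<mu> \<le> Suc (length kap)"
  proof (rule ccontr)
    assume "\<not> ?thesis"
    then have "0 < nth_default 0 \<mu> (Suc (length kap))"
      by (simp add: nth_default_partition_pos_iff[OF mu])
    moreover have "nth_default 0 \<mu> (Suc (length kap)) \<le> nth_default 0 kap (length kap)"
      using assms by (simp add: interlaces_def)
    ultimately show False by (simp add: nth_default_def)
  qed
qed

lemma finite_partitions_bounded:
  "finite {kap. length kap \<le> n \<and> sum_list kap \<le> (m :: nat)}"
proof (rule finite_subset)
  show "{kap. length kap \<le> n \<and> sum_list kap \<le> m} \<subseteq> {kap. set kap \<subseteq> {..m} \<and> length kap \<le> n}"
    using member_le_sum_list by fastforce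
qed (rule finite_lists_length_le, simp)

lemma finite_interlaces [simp]: "finite {kap. interlaces kap \<mu>}"
  by (rule finite_subset[OF _ finite_partitions_bounded[of "length \<mu>" "sum_list \<mu>"]])
     (auto dest: interlaces_bounds)

lemma skew_P_eq_0:
  assumes "\<mu> \<in> partitions" "length lam + N < length \<mu>"
  shows "skew_P t N lam \<mu> x = 0"
  using assms
proof (induction N arbitrary: \<mu>)
  case (Suc N)
  have "skew_P t N lam kap x = 0" if "interlaces kap \<mu>" for kap
    using that interlaces_bounds(3)[OF that Suc.prems(1)] Suc by (auto simp: interlaces_def)
  then show ?case by simp
qed auto

section \<open>Normalization: from branching coefficients to psi\<close>

definition HL_v_gen :: "'a::field \<Rightarrow> nat list \<Rightarrow> 'a" where
  "HL_v_gen t ms = (\<Prod>x\<in>set ms. qpoch t t (count_list ms x) / (1 - t) ^ count_list ms x)"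

lemma qpoch_0 [simp]: "qpoch a t 0 = 1"
  by (simp add: qpoch_def)

lemma qpoch_self_Suc: "qpoch t t (Suc m) = qpoch t t m * (1 - t ^ Suc m)"
  by (simp add: qpoch_def)

text \<open>The normalizing factors absorb
  \<open>1 + ... + t ^ l = (1 - t ^ Suc l) / (1 - t)\<close>, which occurs for
  \<open>m = Suc l\<close>. Only a multiplicity that is larger in the smaller list keeps a factor,
  and that is the one in psi.\<close>

lemma mult_weight_qpoch:
  assumes "l \<le> Suc m" "m \<le> Suc l" "t \<noteq> (1 :: 'a :: field)"
  shows "mult_weight t m l * (qpoch t t l / (1 - t) ^ l) =
     qpoch t t m / (1 - t) ^ m * (if l = Suc m then 1 - t ^ l else 1)"
proof -
  consider "l = m" | "l = Suc m" | "m = Suc l" using assms by linarith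
  then show ?thesis
  proof cases
    case 3
    have "(1 - t) * (\<Sum>i\<le>l. t ^ i) = 1 - t ^ Suc l"
      unfolding one_diff_power_eq[of t "Suc l"] lessThan_Suc_atMost ..
    moreover have "1 - t \<noteq> 0" using assms(3) by simp
    ultimately have "(\<Sum>i\<le>l. t ^ i) = (1 - t ^ Suc l) / (1 - t)" by (metis nonzero_mult_div_cancel_left)
    then show ?thesis
      unfolding 3 mult_weight_simps qpoch_self_Suc by simp
  qed (use assms(3) in \<open>simp_all add: qpoch_self_Suc\<close>)
qed

lemma HL_v_gen_superset:
  assumes "finite X" "set ms \<subseteq> X"
  shows "HL_v_gen t ms = (\<Prod>x\<in>X. qpoch t t (count_list ms x) / (1 - t) ^ count_list ms x)"
  unfolding HL_v_gen_def
  by (rule prod.mono_neutral_left) (use assms in \<open>auto simp: count_list_0_iff\<close>)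

lemma branch_coeff_HL_v_gen:
  assumes mu: "\<mu> \<in> partitions" "length \<mu> \<le> Suc k" and kap: "interlaces kap \<mu>" "length kap \<le> k"
    and t: "t \<noteq> (1 :: 'a :: field)"
  shows "branch_coeff t (pad (Suc k) \<mu>) (pad k kap) * HL_v_gen t (pad k kap) =
    HL_v_gen t (pad (Suc k) \<mu>) * HL_psi t \<mu> kap"
proof -
  define ms ls where "ms = pad (Suc k) \<mu>" and "ls = pad k kap"
  define M where "M = sum_list \<mu>"
  have ls: "ls \<in> interlacing ms"
    using bij_betwE[OF bij_betw_pad_interlaces[OF mu]] kap by (auto simp: ms_def ls_def)
  have srt: "sorted_wrt (\<ge>) ms" unfolding ms_def by (rule sorted_pad[OF mu(1)])
  have kp: "kap \<in> partitions" using kap by (simp add: interlaces_def)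
  have sub: "set ms \<subseteq> {..M}" "set ls \<subseteq> {..M}"
    using member_le_sum_list[of _ ms] member_le_sum_list[of _ ls] interlaces_bounds(2)[OF kap(1)]
    by (auto simp: M_def ms_def ls_def intro: order_trans)
  \<comment> \<open>The padded lists have \<open>k - length kap\<close> and
    \<open>Suc k - length \<mu>\<close> zeros. As \<mu> has at most one row more than
    \<open>kap\<close>, the value 0 never gains a copy and gives no factor of psi.\<close>
  have n0: "count_list ls 0 \<noteq> Suc (count_list ms 0)"
    using interlaces_bounds(3)[OF kap(1) mu(1)] kap(2) mu kp
    by (auto simp: ls_def ms_def count_list_pad partitions_def)
  have "HL_psi t \<mu> kap = (\<Prod>x\<in>{x\<in>{..M}. count_list ls x = Suc (count_list ms x)}. 1 - t ^ count_list ls x)"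
    unfolding HL_psi_def
  proof (rule prod.cong)
    have "0 < x" "x \<le> M" if "x \<in> set kap" for x
      using that kp sub(2) by (auto simp: partitions_def ls_def pad_def intro: gr0I)
    moreover note n0
    ultimately show "{x \<in> set kap. count_list kap x = Suc (count_list \<mu> x)} =
        {x \<in> {..M}. count_list ls x = Suc (count_list ms x)}"
      by (auto simp: ls_def ms_def count_list_pad split: if_splits) (metis count_notin nat.distinct(1))+
    fix x assume "x \<in> {x \<in> {..M}. count_list ls x = Suc (count_list ms x)}"
    with n0 have "x \<noteq> 0" by (cases "x = 0") auto
    then show "1 - t ^ count_list kap x = 1 - t ^ count_list ls x"
      by (simp add: ls_def count_list_pad)
  qed
  also have "\<dots> = (\<Prod>x\<le>M. if count_list ls x = Suc (count_list ms x) then 1 - t ^ count_list ls x else 1)"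
    by (rule prod.inter_filter) simp
  finally have psi: "HL_psi t \<mu> kap = \<dots>" .
  show ?thesis
    unfolding ms_def[symmetric] ls_def[symmetric] psi branch_coeff_eq_mult_prod[OF ls srt sub(1)]
      mult_prod_def HL_v_gen_superset[OF finite_atMost sub(1)] HL_v_gen_superset[OF finite_atMost sub(2)]
      prod.distrib[symmetric]
    by (rule prod.cong) (use mult_weight_qpoch[OF count_list_interlacing[OF ls srt] t] in auto)
qed

theorem hl_sum_eq_skew_P:
  assumes two: "(2 :: 'a :: field) \<noteq> 0" and t: "t \<noteq> (1 :: 'a)"
    and inj: "inj_on x {..<k}" and mu: "\<mu> \<in> partitions" "length \<mu> \<le> k"
  shows "hl_sum t k (pad k \<mu>) x = HL_v_gen t (pad k \<mu>) * skew_P t k [] \<mu> x"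
  using inj mu
proof (induction k arbitrary: \<mu>)
  case 0
  have "{\<sigma>. \<sigma> permutes ({} :: nat set)} = {id}" by (auto simp: permutes_empty)
  then show ?case
    using 0 by (simp add: hl_sum_def symmetrize_def hl_kernel_def HL_v_gen_def pad_def)
next
  case (Suc k)
  let ?ms = "pad (Suc k) \<mu>"
  have "hl_sum t (Suc k) ?ms x = (\<Sum>ls\<in>interlacing ?ms.
     branch_coeff t ?ms ls * x k ^ (sum_list ?ms - sum_list ls) * hl_sum t k ls x)"
    by (rule hl_sum_branching[OF two Suc.prems(1) sorted_pad[OF Suc.prems(2)] length_pad[OF Suc.prems(3)]])
  also have "\<dots> = (\<Sum>kap | interlaces kap \<mu> \<and> length kap \<le> k.
     branch_coeff t ?ms (pad k kap) * x k ^ (sum_list ?ms - sum_list (pad k kap)) * hl_sum t k (pad k kap) x)"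
    by (rule sum.reindex_bij_betw[OF bij_betw_pad_interlaces[OF Suc.prems(2,3)], symmetric])
  also have "\<dots> = (\<Sum>kap | interlaces kap \<mu> \<and> length kap \<le> k.
     HL_v_gen t ?ms * (HL_psi t \<mu> kap * x k ^ (sum_list \<mu> - sum_list kap) * skew_P t k [] kap x))"
  proof (intro sum.cong refl, clarify)
    fix kap assume kap: "interlaces kap \<mu>" "length kap \<le> k"
    have IH: "hl_sum t k (pad k kap) x = HL_v_gen t (pad k kap) * skew_P t k [] kap x"
      by (rule Suc.IH) (use Suc.prems(1) kap in \<open>auto simp: interlaces_def inj_on_def\<close>)
    show "branch_coeff t ?ms (pad k kap) * x k ^ (sum_list ?ms - sum_list (pad k kap)) * hl_sum t k (pad k kap) x =
       HL_v_gen t ?ms * (HL_psi t \<mu> kap * x k ^ (sum_list \<mu> - sum_list kap) * skew_P t k [] kap x)"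
      unfolding IH sum_list_pad
      using arg_cong[OF branch_coeff_HL_v_gen[OF Suc.prems(2,3) kap t],
          of "\<lambda>c. c * (x k ^ (sum_list \<mu> - sum_list kap) * skew_P t k [] kap x)"]
      by (simp only: mult_ac)
  qed
  also have "\<dots> = HL_v_gen t ?ms * (\<Sum>kap | interlaces kap \<mu> \<and> length kap \<le> k.
     HL_psi t \<mu> kap * x k ^ (sum_list \<mu> - sum_list kap) * skew_P t k [] kap x)"
    by (simp add: sum_distrib_left)
  \<comment> \<open>The chain sum also runs over \<open>kap\<close> with \<open>Suc k\<close> rows;
    these have no chains of \<open>k\<close> steps from the empty partition.\<close>
  also have "(\<Sum>kap | interlaces kap \<mu> \<and> length kap \<le> k.
     HL_psi t \<mu> kap * x k ^ (sum_list \<mu> - sum_list kap) * skew_P t k [] kap x) = skew_P t (Suc k) [] \<mu> x"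
    unfolding skew_P.simps
    by (rule sum.mono_neutral_left[OF finite_interlaces])
      (auto simp: interlaces_def intro!: mult_eq_0_iff[THEN iffD2] skew_P_eq_0)
  finally show ?case .
qed

section \<open>Polynomials and their evaluation\<close>

locale ring_morphism =
  fixes h :: "'a::comm_ring_1 \<Rightarrow> 'b::comm_ring_1"
  assumes add: "h (a + b) = h a + h b" and mult: "h (a * b) = h a * h b" and one: "h 1 = 1"
begin

lemma zero: "h 0 = 0"
  using add[of 0 0] by simp

lemma diff: "h (a - b) = h a - h b"
  using add[of "a - b" b] by (simp add: algebra_simps)

lemma sum: "h (sum f A) = (\<Sum>a\<in>A. h (f a))"
  by (induction A rule: infinite_finite_induct) (auto simp: add zero)

lemma prod: "h (prod f A) = (\<Prod>a\<in>A. h (f a))"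
  by (induction A rule: infinite_finite_induct) (auto simp: mult one)

lemma power: "h (a ^ n) = h a ^ n"
  by (induction n) (auto simp: mult one)

lemma HL_psi: "h (HL_psi t \<mu> kap) = HL_psi (h t) \<mu> kap"
  by (simp only: HL_psi_def prod diff power one)

lemma skew_P: "h (skew_P t N lam \<mu> x) = skew_P (h t) N lam \<mu> (\<lambda>i. h (x i))"
  by (induction N arbitrary: \<mu>) (auto simp: sum mult power HL_psi zero one)

lemma qpoch: "h (qpoch a t m) = qpoch (h a) (h t) m"
  by (simp add: qpoch_def prod diff power mult one)

end

lemma ring_morphism_compose:
  assumes "ring_morphism f" "ring_morphism g"
  shows "ring_morphism (\<lambda>a. f (g a))"
  using assms by (simp add: ring_morphism_def)

lemma ring_morphism_id: "ring_morphism id"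
  by (simp add: ring_morphism_def)

lemma ring_morphism_mConst: "ring_morphism mConst"
  by (simp add: ring_morphism_def mConst_def single_add mult_single)

lemma ring_morphism_to_fract: "ring_morphism to_fract"
  by (simp add: ring_morphism_def)

lemma ring_morphism_of_real: "ring_morphism (of_real :: real \<Rightarrow> complex)"
  by (simp add: ring_morphism_def)

definition mono_val :: "(nat \<Rightarrow> 'a::comm_semiring_1) \<Rightarrow> (nat \<Rightarrow>\<^sub>0 nat) \<Rightarrow> 'a" where
  "mono_val x m = (\<Prod>i\<in>Poly_Mapping.keys m. x i ^ Poly_Mapping.lookup m i)"

lemma mono_val_superset:
  assumes "finite A" "Poly_Mapping.keys m \<subseteq> A"
  shows "mono_val x m = (\<Prod>i\<in>A. x i ^ Poly_Mapping.lookup m i)"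
  unfolding mono_val_def
  by (rule prod.mono_neutral_left) (use assms in \<open>auto simp: in_keys_iff\<close>)

lemma mono_val_add: "mono_val x (m + n) = mono_val x m * mono_val x n"
proof -
  define A where "A = Poly_Mapping.keys m \<union> Poly_Mapping.keys n"
  have A: "finite A" "Poly_Mapping.keys (m + n) \<subseteq> A" "Poly_Mapping.keys m \<subseteq> A" "Poly_Mapping.keys n \<subseteq> A"
    using keys_add[of m n] by (auto simp: A_def)
  show ?thesis
    unfolding mono_val_superset[OF A(1,2)] mono_val_superset[OF A(1,3)] mono_val_superset[OF A(1,4)]
    by (simp add: lookup_add power_add prod.distrib)
qed

lemma mpoly_sum_single: "p = (\<Sum>m\<in>Poly_Mapping.keys p. Poly_Mapping.single m (Poly_Mapping.lookup p m))"
  by (rule poly_mapping_eqI) (auto simp: lookup_sum lookup_single when_def in_keys_iff)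

context
  fixes h :: "complex \<Rightarrow> 'a::comm_ring_1" and x :: "nat \<Rightarrow> 'a"
  assumes h: "ring_morphism h"
begin

interpretation h: ring_morphism h by (rule h)

lemma insertion_superset:
  assumes "finite A" "Poly_Mapping.keys p \<subseteq> A"
  shows "insertion h x p = (\<Sum>m\<in>A. h (Poly_Mapping.lookup p m) * mono_val x m)"
  unfolding insertion_def mono_val_def
  by (rule sum.mono_neutral_left) (use assms in \<open>auto simp: in_keys_iff h.zero\<close>)

lemma insertion_add: "insertion h x (p + q) = insertion h x p + insertion h x q"
proof -
  define A where "A = Poly_Mapping.keys p \<union> Poly_Mapping.keys q"
  have A: "finite A" "Poly_Mapping.keys (p + q) \<subseteq> A" "Poly_Mapping.keys p \<subseteq> A" "Poly_Mapping.keys q \<subseteq> A"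
    using keys_add[of p q] by (auto simp: A_def)
  show ?thesis
    unfolding insertion_superset[OF A(1,2)] insertion_superset[OF A(1,3)] insertion_superset[OF A(1,4)]
    by (simp add: lookup_add h.add distrib_right sum.distrib)
qed

lemma insertion_single: "insertion h x (Poly_Mapping.single m c) = h c * mono_val x m"
  by (subst insertion_superset[of "{m}"]) auto

lemma insertion_0: "insertion h x 0 = 0"
  by (simp add: insertion_def)

lemma insertion_sum: "insertion h x (sum f A) = (\<Sum>a\<in>A. insertion h x (f a))"
  by (induction A rule: infinite_finite_induct) (auto simp: insertion_add insertion_0)

lemma insertion_mult: "insertion h x (p * q) = insertion h x p * insertion h x q"
proof -
  let ?l = Poly_Mapping.lookup and ?s = Poly_Mapping.single
  have "p * q = (\<Sum>m\<in>Poly_Mapping.keys p. \<Sum>n\<in>Poly_Mapping.keys q. ?s (m + n) (?l p m * ?l q n))"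
    by (subst mpoly_sum_single[of p], subst mpoly_sum_single[of q]) (simp only: sum_product mult_single)
  then have "insertion h x (p * q) = (\<Sum>m\<in>Poly_Mapping.keys p. \<Sum>n\<in>Poly_Mapping.keys q.
      (h (?l p m) * mono_val x m) * (h (?l q n) * mono_val x n))"
    by (simp add: insertion_sum insertion_single mono_val_add h.mult mult_ac)
  then show ?thesis
    by (simp add: insertion_superset[OF finite_keys order_refl] sum_product)
qed

lemma insertion_mConst: "insertion h x (mConst c) = h c"
  unfolding mConst_def insertion_single by (simp add: mono_val_def)

lemma insertion_mVar: "insertion h x (mVar i) = x i"
  unfolding mVar_def insertion_single by (simp add: mono_val_def h.one)

lemma ring_morphism_insertion: "ring_morphism (insertion h x)"
  by unfold_locales (simp_all add: insertion_add insertion_mult insertion_mConst h.one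
      flip: ring_morphism.one[OF ring_morphism_mConst])

end

lemma insertion_insertion:
  "insertion id y (insertion mConst x p) = insertion id (\<lambda>i. insertion id y (x i)) p"
proof -
  interpret e: ring_morphism "insertion id y"
    by (rule ring_morphism_insertion[OF ring_morphism_id])
  have "insertion id y (insertion mConst x p) = (\<Sum>m\<in>Poly_Mapping.keys p.
      insertion id y (mConst (Poly_Mapping.lookup p m)) *
      (\<Prod>i\<in>Poly_Mapping.keys m. insertion id y (x i) ^ Poly_Mapping.lookup m i))"
    unfolding insertion_def[of mConst] by (simp add: e.sum e.mult e.prod e.power)
  also have "\<dots> = insertion id (\<lambda>i. insertion id y (x i)) p"
    unfolding insertion_mConst[OF ring_morphism_id] insertion_def[of id "\<lambda>i. insertion id y (x i)"] ..
  finally show ?thesis .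
qed

lemma power_combination_eq_0:
  fixes c :: "nat \<Rightarrow> complex"
  assumes "finite E" "\<And>z. (\<Sum>e\<in>E. c e * z ^ e) = 0" "e \<in> E"
  shows "c e = 0"
proof -
  define p where "p = (\<Sum>e\<in>E. monom (c e) e)"
  have "poly p z = 0" for z
    using assms(2)[of z] by (simp add: p_def poly_sum poly_monom)
  then have "p = 0" using poly_all_0_iff_0 by blast
  moreover have "coeff p e = c e"
    using assms(1,3) by (simp add: p_def coeff_sum)
  ultimately show ?thesis by simp
qed

text \<open>With the other variables fixed, the sum is a polynomial in the last one, so the terms
  with a given last exponent vanish on their own and the induction continues with one variable
  fewer.\<close>

lemma monomial_combination_eq_0:
  fixes c :: "'b \<Rightarrow> complex" and g :: "'b \<Rightarrow> nat \<Rightarrow> nat"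
  assumes "finite A" "\<And>x. (\<Sum>a\<in>A. c a * (\<Prod>i<N. x i ^ g a i)) = 0"
    and "\<And>a b. a \<in> A \<Longrightarrow> b \<in> A \<Longrightarrow> (\<And>i. i < N \<Longrightarrow> g a i = g b i) \<Longrightarrow> a = b" and "a \<in> A"
  shows "c a = 0"
  using assms
proof (induction N arbitrary: A)
  case 0
  then have "A = {a}" by auto
  then show ?case using 0(2) by simp
next
  case (Suc N)
  define B where "B = {b \<in> A. g b N = g a N}"
  have "(\<Sum>b\<in>B. c b * (\<Prod>i<N. x i ^ g b i)) = 0" for x
  proof -
    define C where "C = (\<lambda>e. \<Sum>b | b \<in> A \<and> g b N = e. c b * (\<Prod>i<N. x i ^ g b i))"
    have "(\<Sum>e\<in>(\<lambda>b. g b N) ` A. C e * z ^ e) = 0" for z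
    proof -
      have "(\<Sum>e\<in>(\<lambda>b. g b N) ` A. C e * z ^ e) =
         (\<Sum>e\<in>(\<lambda>b. g b N) ` A. \<Sum>b | b \<in> A \<and> g b N = e. c b * (\<Prod>i<N. x i ^ g b i) * z ^ g b N)"
        unfolding C_def sum_distrib_right by (intro sum.cong) auto
      also have "\<dots> = (\<Sum>b\<in>A. c b * (\<Prod>i<N. x i ^ g b i) * z ^ g b N)"
        by (rule sum.image_gen[OF Suc.prems(1), symmetric])
      also have "\<dots> = (\<Sum>b\<in>A. c b * (\<Prod>i<Suc N. (x(N := z)) i ^ g b i))"
        by (simp add: mult.assoc)
      finally show ?thesis using Suc.prems(2)[of "x(N := z)"] by simp
    qed
    from power_combination_eq_0[OF _ this, of "g a N"] have "C (g a N) = 0"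
      using Suc.prems(1,4) by auto
    then show ?thesis by (simp add: C_def B_def)
  qed
  moreover have "b = b'" if "b \<in> B" "b' \<in> B" "\<And>i. i < N \<Longrightarrow> g b i = g b' i" for b b'
  proof (rule Suc.prems(3))
    show "g b i = g b' i" if "i < Suc N" for i
      using that \<open>b \<in> B\<close> \<open>b' \<in> B\<close> \<open>\<And>i. i < N \<Longrightarrow> g b i = g b' i\<close>
      by (cases "i = N") (auto simp: B_def)
  qed (use that in \<open>auto simp: B_def\<close>)
  ultimately show ?case
    using Suc.IH[of B] Suc.prems(1,4) by (auto simp: B_def)
qed

lemma finite_vars: "\<exists>N. in_vars N p"
proof -
  have "finite (\<Union>m\<in>Poly_Mapping.keys p. Poly_Mapping.keys m)" by simp
  then obtain N where "(\<Union>m\<in>Poly_Mapping.keys p. Poly_Mapping.keys m) \<subseteq> {..<N}"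
    using finite_nat_bounded by blast
  then show ?thesis by (auto simp: in_vars_def intro!: exI[of _ N])
qed

text \<open>This reduces identities in \<open>mpoly\<close> to identities between complex values,
  where chain sums are easier to compare.\<close>

lemma mpoly_eq_0I:
  assumes "\<And>x. insertion id x p = 0"
  shows "p = 0"
proof (rule ccontr)
  assume "p \<noteq> 0"
  then obtain m where m: "m \<in> Poly_Mapping.keys p" by (metis keys_eq_empty equals0I)
  obtain N where N: "in_vars N p" using finite_vars by blast
  have "Poly_Mapping.lookup p m = 0"
  proof (rule monomial_combination_eq_0[where A = "Poly_Mapping.keys p" and g = Poly_Mapping.lookup and N = N])
    show "(\<Sum>m\<in>Poly_Mapping.keys p. Poly_Mapping.lookup p m * (\<Prod>i<N. x i ^ Poly_Mapping.lookup m i)) = 0" for x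
    proof -
      have "insertion id x p = (\<Sum>m\<in>Poly_Mapping.keys p. Poly_Mapping.lookup p m * mono_val x m)"
        by (simp add: insertion_def mono_val_def)
      also have "\<dots> = (\<Sum>m\<in>Poly_Mapping.keys p. Poly_Mapping.lookup p m * (\<Prod>i<N. x i ^ Poly_Mapping.lookup m i))"
        by (intro sum.cong refl arg_cong2[of _ _ _ _ "(*)"] mono_val_superset)
           (use N in \<open>auto simp: in_vars_def\<close>)
      finally show ?thesis using assms by simp
    qed
    fix a b assume ab: "a \<in> Poly_Mapping.keys p" "b \<in> Poly_Mapping.keys p"
      and eq: "\<And>i. i < N \<Longrightarrow> Poly_Mapping.lookup a i = Poly_Mapping.lookup b i"
    show "a = b"
    proof (rule poly_mapping_eqI)
      fix i
      have "Poly_Mapping.lookup m i = 0" if "m \<in> Poly_Mapping.keys p" "\<not> i < N" for m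
        using that N by (metis in_vars_def in_keys_iff subsetD lessThan_iff)
      then show "Poly_Mapping.lookup a i = Poly_Mapping.lookup b i"
        using eq[of i] ab by (cases "i < N") auto
    qed
  qed (use m in auto)
  with m show False by (simp add: in_keys_iff)
qed

lemma mpoly_eqI:
  assumes "\<And>x. insertion id x p = insertion id x q"
  shows "p = q"
proof -
  interpret ring_morphism "insertion id x" for x
    by (rule ring_morphism_insertion[OF ring_morphism_id])
  have "p - q = 0" by (rule mpoly_eq_0I) (simp add: diff assms)
  then show ?thesis by simp
qed

lemma in_vars_add: "in_vars N p \<Longrightarrow> in_vars N q \<Longrightarrow> in_vars N (p + q)"
  using keys_add[of p q] unfolding in_vars_def by blast

lemma in_vars_mult: "in_vars N p \<Longrightarrow> in_vars N q \<Longrightarrow> in_vars N (p * q)"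
  using keys_mult[of p q] keys_add unfolding in_vars_def by (fastforce dest!: subsetD)

lemma in_vars_single: "Poly_Mapping.keys m \<subseteq> {..<N} \<Longrightarrow> in_vars N (Poly_Mapping.single m c)"
  by (simp add: in_vars_def)

section \<open>Hall--Littlewood polynomials\<close>

lemma HL_v_eq_gen: "HL_v t k lam = HL_v_gen t (pad k lam)"
  by (simp add: HL_v_def HL_v_gen_def pad_def Let_def)

lemma HL_v_gen_morphism:
  fixes h :: "'a::field \<Rightarrow> 'b::field"
  assumes h: "ring_morphism h" and nz: "h (1 - t) \<noteq> 0" "t \<noteq> 1"
  shows "h (HL_v_gen t ms) = HL_v_gen (h t) ms"
proof -
  interpret ring_morphism h by (rule h)
  have "h (a / (1 - t) ^ n) = h a / (1 - h t) ^ n" for a n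
  proof -
    have "h (a / (1 - t) ^ n) * (1 - h t) ^ n = h (a / (1 - t) ^ n * (1 - t) ^ n)"
      by (simp only: mult power diff one)
    also have "\<dots> = h a" using nz(2) by simp
    finally show ?thesis using nz(1) by (simp add: diff one eq_divide_eq)
  qed
  then show ?thesis by (simp add: HL_v_gen_def prod qpoch)
qed

lemma HL_v_gen_pos:
  fixes t :: real
  assumes "0 < t" "t < 1"
  shows "HL_v_gen t ms > 0"
proof -
  have "0 < 1 - t * t ^ i" for i
    using power_less_one_iff[of t "Suc i"] assms by simp
  then have "0 < qpoch t t n" for n
    unfolding qpoch_def by (intro prod_pos) auto
  then show ?thesis
    unfolding HL_v_gen_def using assms by (intro prod_pos) auto
qed

definition mReal :: "real \<Rightarrow> mpoly" where "mReal t = mConst (of_real t)"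

definition fract_const :: "real \<Rightarrow> mpoly fract" where
  "fract_const a = to_fract (mConst (of_real a))"

definition fract_var :: "nat \<Rightarrow> mpoly fract" where
  "fract_var i = to_fract (mVar i)"

lemma ring_morphism_fract_const: "ring_morphism fract_const"
  unfolding fract_const_def
  by (intro ring_morphism_compose[OF ring_morphism_to_fract]
      ring_morphism_compose[OF ring_morphism_mConst] ring_morphism_of_real)

lemma fract_const_eq_0_iff: "fract_const a = 0 \<longleftrightarrow> a = 0"
  by (simp add: fract_const_def mConst_def) (metis lookup_single_eq lookup_zero of_real_eq_0_iff single_zero)

lemma inj_fract_var: "inj fract_var"
proof (rule injI)
  fix i j assume "fract_var i = fract_var j"
  then have "insertion id (\<lambda>n. if n = i then 1 else 0) (mVar i) =
      insertion id (\<lambda>n. if n = i then 1 else 0) (mVar j)"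
    by (simp add: fract_var_def)
  then show "i = j"
    unfolding insertion_mVar[OF ring_morphism_id] by (auto split: if_splits)
qed

context
  fixes t :: real
  assumes t: "0 < t" "t < 1"
begin

lemma to_fract_skew_P:
  "to_fract (skew_P (mReal t) N lam \<mu> x) = skew_P (fract_const t) N lam \<mu> (\<lambda>i. to_fract (x i))"
  by (simp add: ring_morphism.skew_P[OF ring_morphism_to_fract] mReal_def fract_const_def)

lemma fract_const_HL_v: "fract_const (HL_v t k lam) = HL_v_gen (fract_const t) (pad k lam)"
  unfolding HL_v_eq_gen
  by (rule HL_v_gen_morphism[OF ring_morphism_fract_const]) (use t in \<open>auto simp: fract_const_eq_0_iff\<close>)

lemma fract_const_HL_v_nonzero: "HL_v_gen (fract_const t) (pad k lam) \<noteq> 0"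
  unfolding fract_const_HL_v[symmetric] fract_const_eq_0_iff HL_v_eq_gen
  using HL_v_gen_pos[OF t, of "pad k lam"] by simp

lemma fract_const_two: "(2 :: mpoly fract) \<noteq> 0"
proof -
  interpret ring_morphism fract_const by (rule ring_morphism_fract_const)
  have "fract_const (1 + 1) = 1 + 1" unfolding add one ..
  then show ?thesis using fract_const_eq_0_iff[of "1 + 1"] by (metis one_add_one zero_neq_numeral)
qed

lemma fract_const_neq_1: "fract_const t \<noteq> 1"
proof -
  interpret ring_morphism fract_const by (rule ring_morphism_fract_const)
  show ?thesis using t fract_const_eq_0_iff[of "t - 1"] by (simp add: diff one)
qed

lemma hl_sum_fract:
  assumes "inj_on x {..<k}" "\<mu> \<in> partitions" "length \<mu> \<le> k"
  shows "hl_sum (fract_const t) k (pad k \<mu>) x =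
    HL_v_gen (fract_const t) (pad k \<mu>) * skew_P (fract_const t) k [] \<mu> x"
  by (rule hl_sum_eq_skew_P[OF fract_const_two fract_const_neq_1 assms])

text \<open>The chain sum is the polynomial behind the rational symmetrization formula, and it is
  unique because \<open>to_fract\<close> is injective. With more than \<open>k\<close> parts both
  sides are 0.\<close>

lemma HL_P_eq_skew_P:
  assumes "lam \<in> partitions"
  shows "HL_P t k lam = skew_P (mReal t) k [] lam mVar"
proof (cases "length lam \<le> k")
  case True
  have "HL_P_rat t k lam = 1 / HL_v_gen (fract_const t) (pad k lam) *
      hl_sum (fract_const t) k (pad k lam) fract_var"
    unfolding HL_P_rat_def Let_def fract_const_def[symmetric] fract_var_def[symmetric] fract_const_HL_v
      hl_sum_def symmetrize_def hl_kernel_def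
    by (simp add: nth_pad)
  also have "\<dots> = to_fract (skew_P (mReal t) k [] lam mVar)"
    unfolding hl_sum_fract[OF inj_on_subset[OF inj_fract_var subset_UNIV] assms True] to_fract_skew_P
    using fract_const_HL_v_nonzero[of k lam] by (simp add: fract_var_def[abs_def])
  finally show ?thesis using True by (simp add: HL_P_def)
next
  case False
  then show ?thesis by (simp add: HL_P_def skew_P_eq_0[OF assms])
qed

text \<open>The chain sum is not visibly symmetric. It inherits symmetry from the symmetrization
  sum, by using \<open>hl_sum_fract\<close> at the original and at the permuted variables and
  cancelling the normalization.\<close>

lemma skew_P_empty_permute:
  assumes "\<sigma> permutes {..<k}" "\<mu> \<in> partitions"
  shows "skew_P (mReal t) k [] \<mu> (\<lambda>i. mVar (\<sigma> i)) = skew_P (mReal t) k [] \<mu> mVar"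
proof (cases "length \<mu> \<le> k")
  case True
  have inj: "inj_on fract_var {..<k}" "inj_on (fract_var \<circ> \<sigma>) {..<k}"
    using inj_fract_var permutes_inj[OF assms(1)] by (auto simp: inj_on_def)
  have "HL_v_gen (fract_const t) (pad k \<mu>) * skew_P (fract_const t) k [] \<mu> (fract_var \<circ> \<sigma>) =
     HL_v_gen (fract_const t) (pad k \<mu>) * skew_P (fract_const t) k [] \<mu> fract_var"
    unfolding hl_sum_fract[OF inj(1) assms(2) True, symmetric] hl_sum_fract[OF inj(2) assms(2) True, symmetric]
    unfolding hl_sum_def by (rule symmetrize_permute[OF assms(1)])
  then have "skew_P (fract_const t) k [] \<mu> (fract_var \<circ> \<sigma>) = skew_P (fract_const t) k [] \<mu> fract_var"
    using fract_const_HL_v_nonzero by simp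
  then have "to_fract (skew_P (mReal t) k [] \<mu> (\<lambda>i. mVar (\<sigma> i))) = to_fract (skew_P (mReal t) k [] \<mu> mVar)"
    unfolding to_fract_skew_P by (simp add: fract_var_def[abs_def] o_def)
  then show ?thesis by simp
qed (simp add: skew_P_eq_0[OF assms(2)])

lemma eval_skew_P:
  "insertion id y (skew_P (mReal t) N lam \<mu> x) =
     skew_P (complex_of_real t) N lam \<mu> (\<lambda>i. insertion id y (x i))"
  by (simp add: ring_morphism.skew_P[OF ring_morphism_insertion[OF ring_morphism_id]] mReal_def
      insertion_mConst[OF ring_morphism_id])

lemma eval_skew_P_mVar:
  "insertion id y (skew_P (mReal t) N lam \<mu> mVar) = skew_P (complex_of_real t) N lam \<mu> y"
  by (simp add: eval_skew_P insertion_mVar[OF ring_morphism_id])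

lemma insertion_mConst_skew_P:
  "insertion mConst x (skew_P (mReal t) N lam \<mu> mVar) = skew_P (mReal t) N lam \<mu> x"
  by (simp add: ring_morphism.skew_P[OF ring_morphism_insertion[OF ring_morphism_mConst]] mReal_def
      insertion_mConst[OF ring_morphism_mConst] insertion_mVar[OF ring_morphism_mConst])

end

section \<open>Cutting chains and linear independence\<close>

lemma skew_P_cong:
  assumes "\<And>i. i < N \<Longrightarrow> x i = y i"
  shows "skew_P t N lam \<mu> x = skew_P t N lam \<mu> y"
  using assms by (induction N arbitrary: \<mu>) auto

text \<open>Coarser than containment of diagrams, but finite and inherited along
  \<open>interlaces\<close>, which is enough for an index set.\<close>

definition sub_partitions :: "nat list \<Rightarrow> nat list set" where
  "sub_partitions \<mu> = {kap \<in> partitions. length kap \<le> length \<mu> \<and> sum_list kap \<le> sum_list \<mu>}"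

lemma finite_sub_partitions: "finite (sub_partitions \<mu>)"
  by (rule finite_subset[OF _ finite_partitions_bounded[of "length \<mu>" "sum_list \<mu>"]])
     (auto simp: sub_partitions_def)

lemma sub_partitions_interlaces: "interlaces kap \<mu> \<Longrightarrow> sub_partitions kap \<subseteq> sub_partitions \<mu>"
  using interlaces_bounds[of kap \<mu>] by (auto simp: sub_partitions_def)

lemma skew_P_support:
  assumes "\<mu> \<in> partitions" "skew_P t N lam \<mu> x \<noteq> 0"
  shows "lam \<in> sub_partitions \<mu>"
  using assms
proof (induction N arbitrary: \<mu>)
  case 0
  then show ?case by (auto simp: sub_partitions_def split: if_splits)
next
  case (Suc N)
  have "\<exists>kap. interlaces kap \<mu> \<and> skew_P t N lam kap x \<noteq> 0"
  proof (rule ccontr)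
    assume "\<not> ?thesis"
    then have "skew_P t (Suc N) lam \<mu> x = 0" by simp
    with Suc.prems show False by simp
  qed
  then show ?case
    using Suc.IH sub_partitions_interlaces by (fastforce simp: interlaces_def)
qed

text \<open>A chain of \<open>k + N\<close> steps is cut at its partition after \<open>k\<close>
  steps. The index set \<open>A\<close> is arbitrary because the induction passes to smaller
  partitions while the range of summation has to stay the same.\<close>

lemma skew_P_add:
  assumes "finite A" "sub_partitions \<mu> \<subseteq> A" "\<mu> \<in> partitions"
  shows "skew_P t (k + N) lam \<mu> x = (\<Sum>kap\<in>A. skew_P t k lam kap x * skew_P t N kap \<mu> (\<lambda>i. x (k + i)))"
  using assms(2,3)
proof (induction N arbitrary: \<mu>)
  case 0
  then have "\<mu> \<in> A" by (auto simp: sub_partitions_def)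
  then show ?case using assms(1) by (simp add: if_distrib[of "(*) _"] cong: if_cong)
next
  case (Suc N)
  have IH: "skew_P t (k + N) lam kap x =
      (\<Sum>kap'\<in>A. skew_P t k lam kap' x * skew_P t N kap' kap (\<lambda>i. x (k + i)))" if "interlaces kap \<mu>" for kap
    by (rule Suc.IH) (use that Suc.prems sub_partitions_interlaces[OF that] in \<open>auto simp: interlaces_def\<close>)
  have "skew_P t (k + Suc N) lam \<mu> x = (\<Sum>kap | interlaces kap \<mu>. \<Sum>kap'\<in>A.
      skew_P t k lam kap' x * (HL_psi t \<mu> kap * x (k + N) ^ (sum_list \<mu> - sum_list kap) *
        skew_P t N kap' kap (\<lambda>i. x (k + i))))"
    by (simp add: IH sum_distrib_left mult_ac)
  also have "\<dots> = (\<Sum>kap'\<in>A. skew_P t k lam kap' x * skew_P t (Suc N) kap' \<mu> (\<lambda>i. x (k + i)))"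
    by (subst sum.swap) (simp add: sum_distrib_left)
  finally show ?case .
qed

lemma interlaces_refl: "\<mu> \<in> partitions \<Longrightarrow> interlaces \<mu> \<mu>"
  using partition_antimono[of \<mu>] by (auto simp: interlaces_def)

lemma sum_list_nth_default:
  fixes lam :: "nat list"
  assumes "length lam \<le> k"
  shows "sum_list lam = (\<Sum>i<k. nth_default 0 lam i)"
proof -
  have "sum_list (pad k lam) = (\<Sum>i<k. nth_default 0 lam i)"
    using assms by (simp add: sum_list_sum_nth length_pad nth_pad lessThan_atLeast0 del: sum_list_pad)
  then show ?thesis by simp
qed

lemma partition_eq_if_le:
  assumes "kap \<in> partitions" "\<mu> \<in> partitions" "\<And>i. nth_default 0 kap i \<le> nth_default 0 \<mu> i"
    and "sum_list kap = sum_list \<mu>"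
  shows "kap = \<mu>"
proof (rule partition_eqI[OF assms(1,2)])
  fix i
  define k where "k = Suc (i + length kap + length \<mu>)"
  show "nth_default 0 kap i = nth_default 0 \<mu> i"
  proof (rule sum_mono_inv[where I = "{..<k}" and f = "nth_default 0 kap" and g = "nth_default 0 \<mu>"])
    show "sum (nth_default 0 kap) {..<k} = sum (nth_default 0 \<mu>) {..<k}"
      using sum_list_nth_default[of kap k] sum_list_nth_default[of \<mu> k] assms(4) by (simp add: k_def)
  qed (use assms(3) in \<open>auto simp: k_def\<close>)
qed

lemma HL_psi_eq_1:
  assumes "\<And>x. count_list kap x \<le> count_list \<mu> x"
  shows "HL_psi t \<mu> kap = 1"
proof -
  have "{x. x \<in> set kap \<and> count_list kap x = Suc (count_list \<mu> x)} = {}"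
    using assms by (simp add: Suc_n_not_le_n) (metis Suc_n_not_le_n)
  then show ?thesis by (simp only: HL_psi_def prod.empty)
qed

text \<open>Removing the last row of a partition picks out, among the partitions with nonzero coefficient
  and minimal row \<open>k\<close>, a single one with the given power of the last variable.\<close>

theorem skew_P_independent:
  fixes t :: complex and c :: "nat list \<Rightarrow> complex"
  assumes "finite L" "L \<subseteq> {lam \<in> partitions. length lam \<le> k}"
    and "\<And>x. (\<Sum>lam\<in>L. c lam * skew_P t k [] lam x) = 0" and "lam \<in> L"
  shows "c lam = 0"
  using assms
proof (induction k arbitrary: L c lam)
  case 0
  then have "L = {[]}" "lam = []" by auto
  then show ?case using 0(3) by simp
next
  case (Suc k)
  show ?case
  proof (rule ccontr)
    assume "c lam \<noteq> 0"
    then have "\<exists>l0. (l0 \<in> L \<and> c l0 \<noteq> 0) \<and>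
        (\<forall>lam. lam \<in> L \<and> c lam \<noteq> 0 \<longrightarrow> nth_default 0 l0 k \<le> nth_default 0 lam k)"
      using Suc.prems(4)
        ex_has_least_nat[of "\<lambda>lam. lam \<in> L \<and> c lam \<noteq> 0" lam "\<lambda>lam. nth_default 0 lam k"] by simp
    then obtain l0 where l0: "l0 \<in> L" "c l0 \<noteq> 0"
      and least: "\<And>lam. lam \<in> L \<Longrightarrow> c lam \<noteq> 0 \<Longrightarrow> nth_default 0 l0 k \<le> nth_default 0 lam k"
      by blast
    have l0p: "l0 \<in> partitions" "length l0 \<le> Suc k" using l0(1) Suc.prems(2) by auto
    define k0 where "k0 = take k l0"
    have nd: "nth_default 0 k0 i = (if i < k then nth_default 0 l0 i else 0)" for i
      by (auto simp: k0_def nth_default_def)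
    have k0p: "k0 \<in> partitions" "length k0 \<le> k"
      using l0p by (auto simp: k0_def partitions_def sorted_wrt_take dest: in_set_takeD)
    have k0l0: "interlaces k0 l0"
    proof -
      have "nth_default 0 l0 (Suc i) \<le> nth_default 0 l0 i" for i
        by (rule partition_antimono[OF l0p(1)]) simp
      moreover have "nth_default 0 l0 (Suc i) = 0" if "\<not> i < k" for i
        using that l0p(2) by (simp add: nth_default_beyond)
      ultimately show ?thesis
        unfolding interlaces_def nd using k0p(1) by simp
    qed
    define KK where "KK = {kap. (\<exists>lam\<in>L. interlaces kap lam) \<and> length kap \<le> k}"
    have finKK: "finite KK"
      by (rule finite_subset[of _ "\<Union>lam\<in>L. {kap. interlaces kap lam}"]) (use Suc.prems(1) in \<open>auto simp: KK_def\<close>)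
    \<comment> \<open>For a fixed value \<open>z\<close> of the last variable,
      \<open>d z kap\<close> is the coefficient of the polynomial of \<open>kap\<close> in the first
      \<open>k\<close> variables, so the induction hypothesis applies to it.\<close>
    define d where "d = (\<lambda>z kap. \<Sum>lam | lam \<in> L \<and> interlaces kap lam.
       c lam * HL_psi t lam kap * z ^ (sum_list lam - sum_list kap))"
    have d0: "d z k0 = 0" for z
    proof (rule Suc.IH[OF finKK])
      show "KK \<subseteq> {lam \<in> partitions. length lam \<le> k}" by (auto simp: KK_def interlaces_def)
      show "k0 \<in> KK" using k0l0 l0(1) k0p by (auto simp: KK_def)
      fix x
      define y where "y = x(k := z)"
      have yx: "skew_P t k [] kap y = skew_P t k [] kap x" for kap
        by (rule skew_P_cong) (simp add: y_def)
      have "0 = (\<Sum>lam\<in>L. c lam * skew_P t (Suc k) [] lam y)"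
        using Suc.prems(3) by simp
      also have "\<dots> = (\<Sum>lam\<in>L. \<Sum>kap | kap \<in> KK \<and> interlaces kap lam.
          c lam * HL_psi t lam kap * z ^ (sum_list lam - sum_list kap) * skew_P t k [] kap x)"
      proof (intro sum.cong refl)
        fix lam assume lam: "lam \<in> L"
        have "skew_P t (Suc k) [] lam y = (\<Sum>kap | interlaces kap lam.
            HL_psi t lam kap * z ^ (sum_list lam - sum_list kap) * skew_P t k [] kap x)"
          by (simp add: yx) (simp add: y_def)
        also have "\<dots> = (\<Sum>kap | kap \<in> KK \<and> interlaces kap lam.
            HL_psi t lam kap * z ^ (sum_list lam - sum_list kap) * skew_P t k [] kap x)"
          by (rule sum.mono_neutral_right[OF finite_interlaces])
             (use lam in \<open>auto simp: KK_def interlaces_def intro!: skew_P_eq_0\<close>)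
        finally show "c lam * skew_P t (Suc k) [] lam y = (\<Sum>kap | kap \<in> KK \<and> interlaces kap lam.
            c lam * HL_psi t lam kap * z ^ (sum_list lam - sum_list kap) * skew_P t k [] kap x)"
          by (simp add: sum_distrib_left mult.assoc)
      qed
      also have "\<dots> = (\<Sum>kap\<in>KK. d z kap * skew_P t k [] kap x)"
        unfolding d_def sum_distrib_right
        by (rule sum.swap_restrict[OF Suc.prems(1) finKK])
      finally show "(\<Sum>kap\<in>KK. d z kap * skew_P t k [] kap x) = 0" by simp
    qed
    define S where "S = {lam \<in> L. interlaces k0 lam}"
    define w where "w = (\<lambda>lam. sum_list lam - sum_list k0)"
    \<comment> \<open>The coefficient of \<open>z ^ e\<close> in \<open>d z k0\<close>; the exponent
      fixes the size of \<open>lam\<close>.\<close>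
    define C where "C = (\<lambda>e. \<Sum>lam | lam \<in> S \<and> w lam = e. c lam * HL_psi t lam k0)"
    have finS: "finite S" using Suc.prems(1) by (simp add: S_def)
    have "(\<Sum>e\<in>w ` S. C e * z ^ e) = 0" for z
    proof -
      have "(\<Sum>e\<in>w ` S. C e * z ^ e) =
          (\<Sum>e\<in>w ` S. \<Sum>lam | lam \<in> S \<and> w lam = e. c lam * HL_psi t lam k0 * z ^ w lam)"
        unfolding C_def sum_distrib_right by (intro sum.cong) auto
      also have "\<dots> = (\<Sum>lam\<in>S. c lam * HL_psi t lam k0 * z ^ w lam)"
        by (rule sum.image_gen[OF finS, symmetric])
      also have "\<dots> = d z k0" by (simp add: d_def S_def w_def)
      finally show ?thesis using d0 by simp
    qed
    then have "C (w l0) = 0"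
      by (rule power_combination_eq_0[rotated]) (use finS l0 k0l0 in \<open>auto simp: S_def\<close>)
    moreover have "C (w l0) = (\<Sum>lam\<in>{l0}. c lam * HL_psi t lam k0)"
      unfolding C_def
    proof (rule sum.mono_neutral_right)
      \<comment> \<open>A competitor \<open>lam\<close> has the size of \<open>l0\<close>. Its first
        \<open>k\<close> rows are at least those of \<open>k0\<close>, and its row \<open>k\<close>
        is at least that of \<open>l0\<close> by minimality, so it equals \<open>l0\<close>.\<close>
      show "\<forall>lam\<in>{lam \<in> S. w lam = w l0} - {l0}. c lam * HL_psi t lam k0 = 0"
      proof (rule ballI, rule ccontr)
        fix lam assume lam: "lam \<in> {lam \<in> S. w lam = w l0} - {l0}" and "c lam * HL_psi t lam k0 \<noteq> 0"
        then have nz: "c lam \<noteq> 0" by auto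
        have lp: "lam \<in> partitions" "length lam \<le> Suc k" "lam \<in> L" "interlaces k0 lam"
          using lam Suc.prems(2) by (auto simp: S_def)
        have "sum_list lam = sum_list l0"
          using lam interlaces_bounds(2)[OF lp(4)] interlaces_bounds(2)[OF k0l0] by (auto simp: w_def)
        moreover have "nth_default 0 l0 i \<le> nth_default 0 lam i" for i
        proof -
          consider "i < k" | "i = k" | "i > k" by linarith
          then show ?thesis
          proof cases
            case 1
            have "nth_default 0 k0 i \<le> nth_default 0 lam i" using lp(4) by (simp add: interlaces_def)
            then show ?thesis using nd[of i] 1 by simp
          next
            case 2
            then show ?thesis using least[OF lp(3) nz] by simp
          qed (use l0p in \<open>simp add: nth_default_def\<close>)
        qed
        ultimately have "l0 = lam" using partition_eq_if_le[OF l0p(1) lp(1)] by simp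
        with lam show False by simp
      qed
    qed (use Suc.prems(1) l0 k0l0 in \<open>auto simp: S_def\<close>)
    \<comment> \<open>\<open>k0\<close> is an initial segment of \<open>l0\<close>, so no
      multiplicity grows and the surviving coefficient is \<open>c l0\<close> itself.\<close>
    moreover have "HL_psi t l0 k0 = 1"
      by (rule HL_psi_eq_1) (metis append_take_drop_id count_list_append k0_def le_add1)
    ultimately show False using l0(2) by simp
  qed
qed

section \<open>Skew Hall--Littlewood functions\<close>

lemma in_vars_mConst: "in_vars N (mConst c)"
  unfolding mConst_def by (rule in_vars_single) simp

lemma in_vars_mVar: "i < N \<Longrightarrow> in_vars N (mVar i)"
  unfolding mVar_def by (rule in_vars_single) simp

lemma in_vars_sum: "(\<And>a. a \<in> A \<Longrightarrow> in_vars N (f a)) \<Longrightarrow> in_vars N (sum f A)"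
  by (induction A rule: infinite_finite_induct) (auto intro: in_vars_add simp: in_vars_def[of _ 0])

lemma in_vars_one: "in_vars N 1"
  by (simp add: in_vars_def)

lemma in_vars_power: "in_vars N p \<Longrightarrow> in_vars N (p ^ n)"
  by (induction n) (auto intro: in_vars_mult in_vars_one)

lemma HL_psi_mReal: "HL_psi (mReal t) \<mu> kap = mConst (HL_psi (of_real t) \<mu> kap)"
  by (simp add: mReal_def ring_morphism.HL_psi[OF ring_morphism_mConst])

lemma in_vars_mono: "in_vars N p \<Longrightarrow> N \<le> M \<Longrightarrow> in_vars M p"
  by (force simp: in_vars_def)

lemma in_vars_skew_P: "in_vars N (skew_P (mReal t) N lam \<mu> mVar)"
proof (induction N arbitrary: \<mu>)
  case 0
  then show ?case by (simp add: in_vars_def)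
next
  case (Suc N)
  show ?case
    unfolding skew_P.simps HL_psi_mReal
    by (intro in_vars_sum in_vars_mult in_vars_mConst in_vars_power in_vars_mVar)
       (auto intro: in_vars_mono[OF Suc.IH])
qed

section \<open>Bounded degree and stability in the number of variables\<close>

definition mono_degree :: "(nat \<Rightarrow>\<^sub>0 nat) \<Rightarrow> nat" where
  "mono_degree m = (\<Sum>i\<in>Poly_Mapping.keys m. Poly_Mapping.lookup m i)"

lemma mono_degree_add: "mono_degree (m + n) = mono_degree m + mono_degree n"
  unfolding mono_degree_def by (rule setsum_keys_plus_distrib) auto

lemma total_degree_le_iff: "total_degree_le d p \<longleftrightarrow> (\<forall>m\<in>Poly_Mapping.keys p. mono_degree m \<le> d)"
  by (simp add: total_degree_le_def mono_degree_def)

lemma total_degree_le_add: "total_degree_le d p \<Longrightarrow> total_degree_le d q \<Longrightarrow> total_degree_le d (p + q)"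
  unfolding total_degree_le_iff using keys_add[of p q] by blast

lemma total_degree_le_sum: "(\<And>a. a \<in> A \<Longrightarrow> total_degree_le d (f a)) \<Longrightarrow> total_degree_le d (sum f A)"
  by (induction A rule: infinite_finite_induct) (auto intro: total_degree_le_add simp: total_degree_le_iff[of _ 0])

lemma total_degree_le_mult:
  assumes "total_degree_le d p" "total_degree_le e q"
  shows "total_degree_le (d + e) (p * q)"
  unfolding total_degree_le_iff
proof
  fix m assume "m \<in> Poly_Mapping.keys (p * q)"
  then obtain a b where "a \<in> Poly_Mapping.keys p" "b \<in> Poly_Mapping.keys q" "m = a + b"
    using keys_mult[of p q] by blast
  then show "mono_degree m \<le> d + e"
    using assms by (auto simp: total_degree_le_iff mono_degree_add intro: add_mono)
qed

lemma total_degree_le_mConst: "total_degree_le 0 (mConst c)"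
  by (simp add: total_degree_le_iff mConst_def mono_degree_def)

lemma total_degree_le_mVar_power: "total_degree_le n (mVar i ^ n)"
proof (induction n)
  case (Suc n)
  have "total_degree_le 1 (mVar i)"
    by (simp add: total_degree_le_iff mVar_def mono_degree_def)
  from total_degree_le_mult[OF this Suc] show ?case by simp
qed (simp add: total_degree_le_iff mono_degree_def)

lemma total_degree_le_skew_P: "total_degree_le (sum_list \<mu>) (skew_P (mReal t) N lam \<mu> mVar)"
proof (induction N arbitrary: \<mu>)
  case 0
  then show ?case by (simp add: total_degree_le_iff mono_degree_def)
next
  case (Suc N)
  show ?case
    unfolding skew_P.simps HL_psi_mReal
  proof (rule total_degree_le_sum)
    fix kap assume "kap \<in> {kap. interlaces kap \<mu>}"
    then have "sum_list \<mu> = 0 + (sum_list \<mu> - sum_list kap) + sum_list kap"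
      using interlaces_bounds(2) by fastforce
    then show "total_degree_le (sum_list \<mu>) (mConst (HL_psi (complex_of_real t) \<mu> kap) *
        mVar N ^ (sum_list \<mu> - sum_list kap) * skew_P (mReal t) N lam kap mVar)"
      using total_degree_le_mult[OF total_degree_le_mult[OF total_degree_le_mConst total_degree_le_mVar_power] Suc.IH]
      by metis
  qed
qed

text \<open>A last step from a strictly smaller partition has positive degree in the last variable,
  so only the constant step survives. This gives the compatibility required in
  \<open>symmetric_functions\<close>.\<close>

lemma skew_P_Suc_last_zero:
  assumes "\<mu> \<in> partitions" "x N = 0"
  shows "skew_P t (Suc N) lam \<mu> x = skew_P t N lam \<mu> x"
proof -
  have "skew_P t (Suc N) lam \<mu> x = (\<Sum>kap\<in>{\<mu>}. HL_psi t \<mu> kap * x N ^ (sum_list \<mu> - sum_list kap) *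
      skew_P t N lam kap x)"
    unfolding skew_P.simps
  proof (rule sum.mono_neutral_right)
    show "\<forall>kap\<in>{kap. interlaces kap \<mu>} - {\<mu>}.
        HL_psi t \<mu> kap * x N ^ (sum_list \<mu> - sum_list kap) * skew_P t N lam kap x = 0"
    proof
      fix kap assume kap: "kap \<in> {kap. interlaces kap \<mu>} - {\<mu>}"
      then have "sum_list kap \<noteq> sum_list \<mu>"
        using partition_eq_if_le[OF _ assms(1), of kap] by (auto simp: interlaces_def)
      then have pos: "0 < sum_list \<mu> - sum_list kap"
        using kap interlaces_bounds(2)[of kap \<mu>] by auto
      show "HL_psi t \<mu> kap * x N ^ (sum_list \<mu> - sum_list kap) * skew_P t N lam kap x = 0"
        by (simp only: assms(2) zero_power[OF pos] mult_zero_left mult_zero_right)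
    qed
  qed (use interlaces_refl[OF assms(1)] in auto)
  then show ?thesis by (simp add: HL_psi_eq_1)
qed

text \<open>The cut-off at \<open>k\<close> rows is essential for uniqueness: longer partitions have
  the zero polynomial in \<open>k\<close> variables, so their coefficients would be
  arbitrary.\<close>

definition skew_coeff :: "real \<Rightarrow> nat \<Rightarrow> nat \<Rightarrow> nat list \<Rightarrow> nat list \<Rightarrow> mpoly" where
  "skew_coeff t k N \<mu> lam =
     (if lam \<in> partitions \<and> length lam \<le> k then skew_P (mReal t) N lam \<mu> mVar else 0)"

context
  fixes t :: real
  assumes t: "0 < t" "t < 1"
begin

lemma skew_expansion_skew_coeff:
  assumes mu: "\<mu> \<in> partitions"
  shows "skew_expansion t k N \<mu> (skew_coeff t k N \<mu>)"
proof -
  have sub: "{lam. skew_coeff t k N \<mu> lam \<noteq> 0} \<subseteq> sub_partitions \<mu>"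
    using skew_P_support[OF mu] by (auto simp: skew_coeff_def split: if_splits)
  have "HL_P t (k + N) \<mu> = (\<Sum>lam\<in>sub_partitions \<mu>.
      skew_P (mReal t) k [] lam mVar * skew_P (mReal t) N lam \<mu> (\<lambda>i. mVar (k + i)))"
    unfolding HL_P_eq_skew_P[OF t mu]
    by (rule skew_P_add[OF finite_sub_partitions order_refl mu])
  also have "\<dots> = (\<Sum>lam | skew_coeff t k N \<mu> lam \<noteq> 0.
      skew_P (mReal t) k [] lam mVar * skew_P (mReal t) N lam \<mu> (\<lambda>i. mVar (k + i)))"
  proof (rule sum.mono_neutral_right[OF finite_sub_partitions sub], rule ballI)
    fix lam assume lam: "lam \<in> sub_partitions \<mu> - {lam. skew_coeff t k N \<mu> lam \<noteq> 0}"
    then have lp: "lam \<in> partitions" by (simp add: sub_partitions_def)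
    show "skew_P (mReal t) k [] lam mVar * skew_P (mReal t) N lam \<mu> (\<lambda>i. mVar (k + i)) = 0"
    proof (cases "length lam \<le> k")
      case True
      with lam lp have "skew_P (mReal t) N lam \<mu> mVar = 0" by (simp add: skew_coeff_def)
      then have "skew_P (mReal t) N lam \<mu> (\<lambda>i. mVar (k + i)) = 0"
        using insertion_mConst_skew_P[OF t, of "\<lambda>i. mVar (k + i)" N lam \<mu>] by (simp add: insertion_def)
      then show ?thesis by simp
    qed (simp add: skew_P_eq_0[OF lp])
  qed
  also have "\<dots> = (\<Sum>lam | skew_coeff t k N \<mu> lam \<noteq> 0.
      insertion mConst (\<lambda>i. mVar (k + i)) (skew_coeff t k N \<mu> lam) * HL_P t k lam)"
    by (rule sum.cong)
       (auto simp: skew_coeff_def HL_P_eq_skew_P[OF t] insertion_mConst_skew_P[OF t] split: if_splits)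
  finally show ?thesis
    unfolding skew_expansion_def
    using finite_subset[OF sub finite_sub_partitions] in_vars_skew_P
    by (auto simp: skew_coeff_def in_vars_def[of _ 0] split: if_splits)
qed

text \<open>The values \<open>y\<close> of the last \<open>N\<close> variables are held fixed. As an
  identity in the first \<open>k\<close> variables, the expansion then determines the evaluated
  coefficients by \<open>skew_P_independent\<close>.\<close>

lemma skew_expansion_unique:
  assumes c: "skew_expansion t k N \<mu> c" and d: "skew_expansion t k N \<mu> d"
  shows "c = d"
proof
  fix lam
  define L where "L = {lam. c lam \<noteq> 0} \<union> {lam. d lam \<noteq> 0}"
  have L: "finite L" "L \<subseteq> {lam \<in> partitions. length lam \<le> k}"
    using c d by (auto simp: L_def skew_expansion_def)
  have eval: "insertion id (\<lambda>i. if i < k then x i else y (i - k)) (HL_P t (k + N) \<mu>) =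
      (\<Sum>lam\<in>L. insertion id y (b lam) * skew_P (of_real t) k [] lam x)"
    if b: "skew_expansion t k N \<mu> b" "{lam. b lam \<noteq> 0} \<subseteq> L" for b and x y :: "nat \<Rightarrow> complex"
  proof -
    define z where "z = (\<lambda>i. if i < k then x i else y (i - k))"
    interpret ring_morphism "insertion id z"
      by (rule ring_morphism_insertion[OF ring_morphism_id])
    have "insertion id z (HL_P t (k + N) \<mu>) = (\<Sum>lam | b lam \<noteq> 0.
        insertion id z (insertion mConst (\<lambda>i. mVar (k + i)) (b lam)) * insertion id z (HL_P t k lam))"
      using b by (simp only: skew_expansion_def sum mult)
    also have "\<dots> = (\<Sum>lam | b lam \<noteq> 0. insertion id y (b lam) * skew_P (of_real t) k [] lam x)"
    proof (intro sum.cong refl arg_cong2[of _ _ _ _ "(*)"])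
      fix lam assume "lam \<in> {lam. b lam \<noteq> 0}"
      then have lam: "lam \<in> partitions" using b by (auto simp: skew_expansion_def)
      show "insertion id z (insertion mConst (\<lambda>i. mVar (k + i)) (b lam)) = insertion id y (b lam)"
        by (simp add: insertion_insertion insertion_mVar[OF ring_morphism_id] z_def)
      show "insertion id z (HL_P t k lam) = skew_P (of_real t) k [] lam x"
        unfolding HL_P_eq_skew_P[OF t lam] eval_skew_P_mVar[OF t]
        by (rule skew_P_cong) (simp add: z_def)
    qed
    also have "\<dots> = (\<Sum>lam\<in>L. insertion id y (b lam) * skew_P (of_real t) k [] lam x)"
      by (rule sum.mono_neutral_left) (use L b in \<open>auto simp: insertion_0[OF ring_morphism_id]\<close>)
    finally show ?thesis unfolding z_def .
  qed
  show "c lam = d lam"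
  proof (cases "lam \<in> L")
    case True
    show ?thesis
    proof (rule mpoly_eqI)
      fix y
      have "insertion id y (c lam) - insertion id y (d lam) = 0"
      proof (rule skew_P_independent[OF L _ True])
        fix x
        show "(\<Sum>lam\<in>L. (insertion id y (c lam) - insertion id y (d lam)) * skew_P (of_real t) k [] lam x) = 0"
          using eval[OF c, of x y] eval[OF d, of x y]
          by (simp add: L_def left_diff_distrib sum_subtractf)
      qed
      then show "insertion id y (c lam) = insertion id y (d lam)" by simp
    qed
  qed (simp add: L_def)
qed

lemma skew_HL_poly_eq:
  assumes "\<mu> \<in> partitions" "lam \<in> partitions" "length lam \<le> k"
  shows "skew_HL_poly t k N \<mu> lam = skew_P (mReal t) N lam \<mu> mVar"
proof -
  have "(THE c. skew_expansion t k N \<mu> c) = skew_coeff t k N \<mu>"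
  proof (rule the_equality)
    show "skew_expansion t k N \<mu> (skew_coeff t k N \<mu>)"
      by (rule skew_expansion_skew_coeff[OF assms(1)])
    then show "c = skew_coeff t k N \<mu>" if "skew_expansion t k N \<mu> c" for c
      using that skew_expansion_unique by blast
  qed
  then show ?thesis using assms by (simp add: skew_HL_poly_def skew_coeff_def)
qed

text \<open>The polynomial of \<mu> in \<open>k + N\<close> variables is symmetric in the last
  \<open>N\<close>, and comparing coefficients in the first \<open>k\<close> transfers this to the
  skew sums. Taking \<open>k = length lam\<close> makes \<open>lam\<close> occur in the
  expansion.\<close>

lemma skew_P_permute:
  fixes y :: "nat \<Rightarrow> complex"
  assumes \<sigma>: "\<sigma> permutes {..<N}" and mu: "\<mu> \<in> partitions" and lam: "lam \<in> partitions"
  shows "skew_P (of_real t) N lam \<mu> (y \<circ> \<sigma>) = skew_P (of_real t) N lam \<mu> y"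
proof (cases "lam \<in> sub_partitions \<mu>")
  case True
  define k where "k = length lam"
  define \<tau> where "\<tau> = (\<lambda>i. if i < k then i else k + \<sigma> (i - k))"
  have \<tau>: "\<tau> permutes {..<k + N}"
  proof (rule inj_imp_permutes)
    show "inj_on \<tau> {..<k + N}"
      by (auto simp: inj_on_def \<tau>_def inj_eq[OF permutes_inj[OF \<sigma>]] split: if_splits)
    show "\<tau> i \<in> {..<k + N}" if "i \<in> {..<k + N}" for i
      using that permutes_in_image[OF \<sigma>, of "i - k"] by (auto simp: \<tau>_def)
    show "\<tau> i = i" if "i \<notin> {..<k + N}" for i
      using that permutes_not_in[OF \<sigma>, of "i - k"] by (auto simp: \<tau>_def)
  qed simp
  define L where "L = {kap \<in> sub_partitions \<mu>. length kap \<le> k}"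
  have "skew_P (of_real t) N lam \<mu> (y \<circ> \<sigma>) - skew_P (of_real t) N lam \<mu> y = 0"
  proof (rule skew_P_independent[where L = L and k = k and
      c = "\<lambda>lam. skew_P (of_real t) N lam \<mu> (y \<circ> \<sigma>) - skew_P (of_real t) N lam \<mu> y"])
    fix x :: "nat \<Rightarrow> complex"
    have expand: "skew_P (of_real t) (k + N) [] \<mu> (\<lambda>i. if i < k then x i else w (i - k)) =
        (\<Sum>kap\<in>L. skew_P (of_real t) N kap \<mu> w * skew_P (of_real t) k [] kap x)" for w
    proof -
      have x: "skew_P (complex_of_real t) k [] kap (\<lambda>i. if i < k then x i else w (i - k)) = skew_P (of_real t) k [] kap x" for kap
        by (rule skew_P_cong) simp
      have "skew_P (of_real t) (k + N) [] \<mu> (\<lambda>i. if i < k then x i else w (i - k)) =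
        (\<Sum>kap\<in>sub_partitions \<mu>. skew_P (of_real t) N kap \<mu> w * skew_P (of_real t) k [] kap x)"
        by (subst skew_P_add[OF finite_sub_partitions order_refl mu]) (simp add: x mult.commute)
      also have "\<dots> = (\<Sum>kap\<in>L. skew_P (of_real t) N kap \<mu> w * skew_P (of_real t) k [] kap x)"
        by (rule sum.mono_neutral_right[OF finite_sub_partitions])
           (auto simp: L_def sub_partitions_def intro!: skew_P_eq_0)
      finally show ?thesis .
    qed
    define z where "z = (\<lambda>i. if i < k then x i else y (i - k))"
    have "insertion id z (skew_P (mReal t) (k + N) [] \<mu> (\<lambda>i. mVar (\<tau> i))) =
        insertion id z (skew_P (mReal t) (k + N) [] \<mu> mVar)"
      by (simp only: skew_P_empty_permute[OF t \<tau> mu])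
    then have "skew_P (of_real t) (k + N) [] \<mu> (\<lambda>i. z (\<tau> i)) = skew_P (of_real t) (k + N) [] \<mu> z"
      by (simp add: eval_skew_P[OF t] insertion_mVar[OF ring_morphism_id])
    moreover have "(\<lambda>i. z (\<tau> i)) = (\<lambda>i. if i < k then x i else (y \<circ> \<sigma>) (i - k))"
      by (auto simp: z_def \<tau>_def)
    ultimately have "skew_P (of_real t) (k + N) [] \<mu> (\<lambda>i. if i < k then x i else (y \<circ> \<sigma>) (i - k)) =
        skew_P (of_real t) (k + N) [] \<mu> (\<lambda>i. if i < k then x i else y (i - k))"
      by (simp only: z_def)
    then show "(\<Sum>kap\<in>L. (skew_P (of_real t) N kap \<mu> (y \<circ> \<sigma>) - skew_P (of_real t) N kap \<mu> y) *
        skew_P (of_real t) k [] kap x) = 0"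
      unfolding expand by (simp add: left_diff_distrib sum_subtractf)
  next
    show "finite L" using finite_sub_partitions[of \<mu>] by (simp add: L_def)
  qed (use True in \<open>auto simp: L_def k_def sub_partitions_def\<close>)
  then show ?thesis by simp
next
  case False
  then show ?thesis using skew_P_support[OF mu] by metis
qed

lemma skew_P_symmetric_function:
  assumes mu: "\<mu> \<in> partitions" and lam: "lam \<in> partitions"
  shows "(\<lambda>N. skew_P (mReal t) N lam \<mu> mVar) \<in> symmetric_functions"
  unfolding symmetric_functions_def mem_Collect_eq
proof (intro conjI allI exI)
  fix N
  show "symmetric_in N (skew_P (mReal t) N lam \<mu> mVar)"
    unfolding symmetric_in_def
  proof (intro conjI allI impI in_vars_skew_P mpoly_eqI)
    fix \<sigma> y assume \<sigma>: "\<sigma> permutes {..<N}"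
    show "insertion id y (insertion mConst (\<lambda>i. mVar (\<sigma> i)) (skew_P (mReal t) N lam \<mu> mVar)) =
        insertion id y (skew_P (mReal t) N lam \<mu> mVar)"
      using skew_P_permute[OF \<sigma> mu lam, of y]
      by (simp add: insertion_mConst_skew_P[OF t] eval_skew_P[OF t] insertion_mVar[OF ring_morphism_id] o_def)
  qed
  show "insertion mConst (\<lambda>i. if i < N then mVar i else 0) (skew_P (mReal t) (Suc N) lam \<mu> mVar) =
      skew_P (mReal t) N lam \<mu> mVar"
    unfolding insertion_mConst_skew_P[OF t]
    by (subst skew_P_Suc_last_zero[OF mu]) (auto intro!: skew_P_cong)
qed (rule total_degree_le_skew_P)

lemma skew_HL_P_eq_skew_P:
  assumes mu: "\<mu> \<in> partitions" and lam: "lam \<in> partitions"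
  shows "skew_HL_P t \<mu> lam N = skew_P (mReal t) N lam \<mu> mVar"
proof -
  define g where "g = (\<lambda>N. skew_P (mReal t) N lam \<mu> mVar)"
  have "skew_HL_P t \<mu> lam = g"
    unfolding skew_HL_P_def
  proof (rule the_equality)
    show "g \<in> symmetric_functions \<and> (\<forall>k\<ge>length lam. \<forall>\<^sub>F N in sequentially. g N = skew_HL_poly t k N \<mu> lam)"
      using skew_P_symmetric_function[OF mu lam] by (simp add: g_def skew_HL_poly_eq[OF mu lam])
  next
    fix f assume f: "f \<in> symmetric_functions \<and>
      (\<forall>k\<ge>length lam. \<forall>\<^sub>F N in sequentially. f N = skew_HL_poly t k N \<mu> lam)"
    then have "\<forall>\<^sub>F N in sequentially. f N = g N"
      by (auto simp: g_def skew_HL_poly_eq[OF mu lam])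
    then obtain M where M: "\<And>N. N \<ge> M \<Longrightarrow> f N = g N"
      by (auto simp: eventually_sequentially)
    \<comment> \<open>Setting the last variable to 0 carries agreement from \<open>Suc N\<close>
      down to \<open>N\<close>, so eventual agreement becomes agreement everywhere.\<close>
    have step: "f N = g N" if "f (Suc N) = g (Suc N)" for N
    proof -
      have "f N = insertion mConst (\<lambda>i. if i < N then mVar i else 0) (f (Suc N))"
        using f by (simp add: symmetric_functions_def)
      moreover have "g N = insertion mConst (\<lambda>i. if i < N then mVar i else 0) (g (Suc N))"
        using skew_P_symmetric_function[OF mu lam] by (simp add: symmetric_functions_def g_def)
      ultimately show ?thesis using that by simp
    qed
    show "f = g"
    proof
      fix N
      show "f N = g N"
      proof (cases "N \<le> M")
        case True
        then show ?thesis
          by (induction rule: inc_induct) (use M step in auto)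
      qed (use M in simp)
    qed
  qed
  then show ?thesis by (simp add: g_def)
qed

end

section \<open>Signatures and their conjugates\<close>

lemma SigD: "lam \<in> Sig n \<Longrightarrow> length lam = n"
  by (simp add: Sig_def)

lemma Sig_antimono: "lam \<in> Sig n \<Longrightarrow> i \<le> j \<Longrightarrow> j < n \<Longrightarrow> lam ! j \<le> lam ! i"
  by (cases "i = j") (auto simp: Sig_def sorted_wrt_iff_nth_less)

lemma conj_part_card: "conj_part lam x = card {i. i < length lam \<and> x \<le> lam ! i}"
  by (simp add: conj_part_def length_filter_conv_card)

lemma conj_part_le: "lam \<in> Sig n \<Longrightarrow> conj_part lam x \<le> n"
  by (simp add: conj_part_def Sig_def) (metis length_filter_le)

text \<open>The rows of size at least \<open>x\<close> form an initial segment.\<close>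

lemma less_conj_part_iff:
  assumes "lam \<in> Sig n"
  shows "i < conj_part lam x \<longleftrightarrow> i < n \<and> x \<le> lam ! i"
proof
  assume i: "i < conj_part lam x"
  show "i < n \<and> x \<le> lam ! i"
  proof (rule ccontr)
    assume neg: "\<not> (i < n \<and> x \<le> lam ! i)"
    have "j < i" if "j < length lam" "x \<le> lam ! j" for j
    proof (rule ccontr)
      assume "\<not> j < i"
      then have "lam ! j \<le> lam ! i" "i < n"
        using that Sig_antimono[OF assms, of i j] SigD[OF assms] by auto
      with that neg show False by simp
    qed
    then have "card {j. j < length lam \<and> x \<le> lam ! j} \<le> card {..<i}"
      by (intro card_mono) auto
    then show False using i by (simp add: conj_part_card)
  qed
next
  assume i: "i < n \<and> x \<le> lam ! i"
  then have "{..i} \<subseteq> {j. j < length lam \<and> x \<le> lam ! j}"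
    using Sig_antimono[OF assms] SigD[OF assms] by (fastforce intro: order_trans)
  then have "card {..i} \<le> conj_part lam x"
    unfolding conj_part_card by (intro card_mono) auto
  then show "i < conj_part lam x" by simp
qed

lemma conj_part_antimono: "x \<le> y \<Longrightarrow> conj_part lam y \<le> conj_part lam x"
  unfolding conj_part_card by (rule card_mono) auto

lemma conj_part_Suc_int: "conj_part lam (x :: int) = conj_part lam (x + 1) + count_list lam x"
  by (induction lam) (auto simp: conj_part_def)

lemma Sig_eqI:
  assumes "lam \<in> Sig n" "\<mu> \<in> Sig n" "\<And>x. conj_part lam x = conj_part \<mu> x"
  shows "lam = \<mu>"
proof (rule nth_equalityI)
  show "length lam = length \<mu>" using assms by (simp add: SigD)
  fix i assume "i < length lam"
  then have "x \<le> lam ! i \<longleftrightarrow> x \<le> \<mu> ! i" for x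
    using less_conj_part_iff[OF assms(1), of i x] less_conj_part_iff[OF assms(2), of i x] assms SigD
    by auto
  then show "lam ! i = \<mu> ! i" by (metis order_antisym order_refl)
qed

definition sig_le :: "int list \<Rightarrow> int list \<Rightarrow> bool" where
  "sig_le lam \<nu> \<longleftrightarrow> (\<forall>x. conj_part lam x \<le> conj_part \<nu> x)"

lemma sig_le_iff_nth:
  assumes "lam \<in> Sig n" "\<nu> \<in> Sig n"
  shows "sig_le lam \<nu> \<longleftrightarrow> (\<forall>i<n. lam ! i \<le> \<nu> ! i)"
proof
  assume *: "sig_le lam \<nu>"
  show "\<forall>i<n. lam ! i \<le> \<nu> ! i"
  proof (intro allI impI)
    fix i assume "i < n"
    then have "i < conj_part lam (lam ! i)" using less_conj_part_iff[OF assms(1)] by simp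
    then have "i < conj_part \<nu> (lam ! i)" using * by (auto simp: sig_le_def intro: less_le_trans)
    then show "lam ! i \<le> \<nu> ! i" using less_conj_part_iff[OF assms(2)] by simp
  qed
next
  assume *: "\<forall>i<n. lam ! i \<le> \<nu> ! i"
  show "sig_le lam \<nu>"
    unfolding sig_le_def
  proof
    fix x
    have "i < conj_part \<nu> x" if "i < conj_part lam x" for i
      using that * less_conj_part_iff[OF assms(1)] less_conj_part_iff[OF assms(2)] by force
    then show "conj_part lam x \<le> conj_part \<nu> x" by (meson leI less_irrefl)
  qed
qed

text \<open>The horizontal strip condition: each column gains at most one box. The two halves of
  \<open>prec_Q\<close> correspond separately to the two column inequalities.\<close>

lemma prec_Q_iff_conj_part:
  assumes "lam \<in> Sig n" "kap \<in> Sig n"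
  shows "prec_Q n lam kap \<longleftrightarrow>
    (\<forall>x. conj_part lam x \<le> conj_part kap x \<and> conj_part kap x \<le> Suc (conj_part lam x))"
proof -
  have "(\<forall>i. Suc i < n \<longrightarrow> kap ! Suc i \<le> lam ! i) \<longleftrightarrow> (\<forall>x. conj_part kap x \<le> Suc (conj_part lam x))"
  proof
    assume *: "\<forall>i. Suc i < n \<longrightarrow> kap ! Suc i \<le> lam ! i"
    show "\<forall>x. conj_part kap x \<le> Suc (conj_part lam x)"
    proof
      fix x
      have "i < conj_part lam x" if "Suc i < conj_part kap x" for i
        using that * less_conj_part_iff[OF assms(1)] less_conj_part_iff[OF assms(2)] by force
      from this[of "conj_part lam x"] show "conj_part kap x \<le> Suc (conj_part lam x)"
        by (meson leI less_irrefl)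
    qed
  next
    assume *: "\<forall>x. conj_part kap x \<le> Suc (conj_part lam x)"
    show "\<forall>i. Suc i < n \<longrightarrow> kap ! Suc i \<le> lam ! i"
    proof (intro allI impI)
      fix i assume "Suc i < n"
      then have "Suc i < conj_part kap (kap ! Suc i)" using less_conj_part_iff[OF assms(2)] by simp
      then have "i < conj_part lam (kap ! Suc i)" using * by (metis Suc_less_eq less_le_trans)
      then show "kap ! Suc i \<le> lam ! i" using less_conj_part_iff[OF assms(1)] by simp
    qed
  qed
  moreover have "(\<forall>i<n. lam ! i \<le> kap ! i) \<longleftrightarrow> (\<forall>x. conj_part lam x \<le> conj_part kap x)"
    using sig_le_iff_nth[OF assms] by (simp add: sig_le_def)
  ultimately show ?thesis unfolding prec_Q_def by blast
qed

definition parts_within :: "int \<Rightarrow> int \<Rightarrow> int list \<Rightarrow> bool" where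
  "parts_within lo hi lam \<longleftrightarrow> (\<forall>y\<in>set lam. lo \<le> y \<and> y \<le> hi)"

lemma conj_part_low: "parts_within lo hi lam \<Longrightarrow> lam \<in> Sig n \<Longrightarrow> x \<le> lo \<Longrightarrow> conj_part lam x = n"
  by (auto simp: conj_part_def parts_within_def Sig_def intro!: arg_cong[of _ _ length] filter_True)

lemma conj_part_high: "parts_within lo hi lam \<Longrightarrow> hi < x \<Longrightarrow> conj_part lam x = 0"
  by (auto simp: conj_part_def parts_within_def filter_empty_conv)

text \<open>Row \<open>i\<close> is \<open>lo\<close> plus the number of columns in
  \<open>{lo<..hi}\<close> longer than \<open>i\<close>. It serves to decide which sets of added
  boxes come from a signature.\<close>

lemma exists_Sig_conj_part:
  fixes c :: "int \<Rightarrow> nat"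
  assumes anti: "\<And>x. c (x + 1) \<le> c x" and low: "\<And>x. x \<le> lo \<Longrightarrow> c x = n"
    and high: "\<And>x. hi < x \<Longrightarrow> c x = 0" and "lo \<le> hi"
  shows "\<exists>lam\<in>Sig n. \<forall>x. conj_part lam x = c x"
proof -
  have anti': "c y \<le> c x" if "x \<le> y" for x y
    using that by (induction y rule: int_ge_induct) (use anti order_trans in blast)+
  define lam where "lam = map (\<lambda>i. lo + int (card {x\<in>{lo<..hi}. i < c x})) [0..<n]"
  have nth: "lam ! i = lo + int (card {x\<in>{lo<..hi}. i < c x})" if "i < n" for i
    using that by (simp add: lam_def)
  have len: "length lam = n" by (simp add: lam_def)
  have fin: "finite {x\<in>{lo<..hi}. i < c x}" for i
    by (rule finite_subset[of _ "{lo<..hi}"]) auto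
  have lam: "lam \<in> Sig n"
    unfolding Sig_def mem_Collect_eq sorted_wrt_iff_nth_less len
  proof (intro conjI refl allI impI)
    fix i j assume ij: "i < j" "j < n"
    have "card {x\<in>{lo<..hi}. j < c x} \<le> card {x\<in>{lo<..hi}. i < c x}"
      using ij by (intro card_mono[OF fin]) auto
    then show "lam ! j \<le> lam ! i" using ij nth by simp
  qed
  have mem: "y \<le> lam ! i \<longleftrightarrow> i < c y" if i: "i < n" for i y
  proof -
    let ?S = "{x\<in>{lo<..hi}. i < c x}"
    show ?thesis
    proof
      assume y: "i < c y"
      have "y \<le> hi" using y high by (metis leI not_less_zero)
      have "{lo<..y} \<subseteq> ?S" using anti' y \<open>y \<le> hi\<close> by (auto intro: less_le_trans)
      then have "card {lo<..y} \<le> card ?S" by (intro card_mono[OF fin]) auto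
      then show "y \<le> lam ! i" unfolding nth[OF i] by simp
    next
      assume y: "y \<le> lam ! i"
      show "i < c y"
      proof (rule ccontr)
        assume neg: "\<not> i < c y"
        then have "lo < y" using low i by (metis leI)
        have "x < y" if "i < c x" for x
          using that anti'[of y x] neg by (meson leI less_le_trans)
        then have "?S \<subseteq> {lo<..<y}" by auto
        then have "card ?S \<le> card {lo<..<y}" by (intro card_mono) auto
        then show False using y \<open>lo < y\<close> unfolding nth[OF i] by simp
      qed
    qed
  qed
  have cn: "c x \<le> n" for x
    using anti'[of "min x lo" x] low[of "min x lo"] by simp
  have "conj_part lam x = c x" for x
  proof -
    have "{i. i < length lam \<and> x \<le> lam ! i} = {..<c x}"
      using mem cn[of x] len by auto
    then show ?thesis by (simp add: conj_part_card)
  qed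
  with lam show ?thesis by blast
qed

lemma sum_list_conj_part:
  assumes "parts_within lo hi lam"
  shows "sum_list lam = int (length lam) * lo + (\<Sum>x\<in>{lo<..hi}. int (conj_part lam x))"
  using assms
proof (induction lam)
  case (Cons y lam)
  have "(\<Sum>x\<in>{lo<..hi}. int (conj_part (y # lam) x)) =
     (\<Sum>x\<in>{lo<..hi}. int (conj_part lam x)) + (\<Sum>x\<in>{lo<..hi}. if x \<le> y then 1 else 0)"
    unfolding sum.distrib[symmetric] by (intro sum.cong) (auto simp: conj_part_def)
  also have "(\<Sum>x\<in>{lo<..hi}. if x \<le> y then 1 else 0) = (\<Sum>x\<in>{x\<in>{lo<..hi}. x \<le> y}. 1 :: int)"
    by (rule sum.inter_filter[symmetric]) simp
  also have "{x\<in>{lo<..hi}. x \<le> y} = {lo<..y}" using Cons.prems by (auto simp: parts_within_def)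
  also have "(\<Sum>x\<in>{lo<..y}. 1) = y - lo" using Cons.prems by (simp add: parts_within_def)
  finally show ?case using Cons by (simp add: parts_within_def algebra_simps)
qed (simp add: conj_part_def)

lemma card_triangle: "card {(i, j). a \<le> i \<and> i < j \<and> j < (b :: nat)} = (b - a) choose 2"
proof (induction b)
  case (Suc b)
  show ?case
  proof (cases "a \<le> b")
    case True
    have "{(i, j). a \<le> i \<and> i < j \<and> j < Suc b} =
        {(i, j). a \<le> i \<and> i < j \<and> j < b} \<union> (\<lambda>i. (i, b)) ` {a..<b}"
      by (auto simp: less_Suc_eq)
    moreover have "finite {(i, j). a \<le> i \<and> i < j \<and> j < b}"
      by (rule finite_subset[of _ "{..<b} \<times> {..<b}"]) auto
    ultimately have "card {(i, j). a \<le> i \<and> i < j \<and> j < Suc b} = ((b - a) choose 2) + (b - a)"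
      using Suc by (simp add: card_Un_disjoint[OF _ finite_imageI] disjoint_iff card_image inj_on_def)
        (subst card_Un_disjoint; auto simp: card_image inj_on_def)?
    then show ?thesis using True by (simp add: Suc_diff_le numeral_2_eq_2)
  next
    case False
    then have "{(i, j). a \<le> i \<and> i < j \<and> j < Suc b} = {}" "Suc b - a = 0" by auto
    then show ?thesis by (simp only: card.empty) (simp add: binomial_eq_0)
  qed
qed simp

text \<open>Double counting of the triples \<open>i < j\<close> and \<open>x\<close> with
  \<open>lam ! i < x \<le> \<nu> ! j\<close>. For fixed \<open>x\<close> the condition reads
  \<open>conj_part lam x \<le> i\<close> and \<open>j < conj_part \<nu> x\<close>.\<close>

lemma n_skew_sig_conj_part:
  assumes lam: "lam \<in> Sig n" "parts_within lo hi lam" and nu: "\<nu> \<in> Sig n" "parts_within lo hi \<nu>"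
  shows "n_skew_sig \<nu> lam = (\<Sum>x\<in>{lo<..hi}. (conj_part \<nu> x - conj_part lam x) choose 2)"
proof -
  define P where "P = (SIGMA j:{..<n}. {..<j})"
  have "n_skew_sig \<nu> lam = (\<Sum>(j, i)\<in>P. nat (max (\<nu> ! j - lam ! i) 0))"
    using nu by (simp add: n_skew_sig_def SigD P_def sum.Sigma)
  also have "\<dots> = (\<Sum>(j, i)\<in>P. card {x\<in>{lo<..hi}. lam ! i < x \<and> x \<le> \<nu> ! j})"
  proof (intro sum.cong refl, clarify)
    fix j i assume "(j, i) \<in> P"
    then have "lo \<le> lam ! i" "\<nu> ! j \<le> hi"
      using lam nu by (auto simp: P_def parts_within_def SigD)
    then have "{x\<in>{lo<..hi}. lam ! i < x \<and> x \<le> \<nu> ! j} = {lam ! i<..\<nu> ! j}" by auto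
    then show "nat (max (\<nu> ! j - lam ! i) 0) = card {x\<in>{lo<..hi}. lam ! i < x \<and> x \<le> \<nu> ! j}"
      by (simp add: max_def)
  qed
  also have "\<dots> = (\<Sum>(j, i)\<in>P. \<Sum>x\<in>{lo<..hi}. if lam ! i < x \<and> x \<le> \<nu> ! j then 1 else 0)"
    by (intro sum.cong refl) (auto simp: sum.inter_filter[symmetric])
  also have "\<dots> = (\<Sum>x\<in>{lo<..hi}. \<Sum>(j, i)\<in>P. if lam ! i < x \<and> x \<le> \<nu> ! j then 1 else 0)"
    by (subst sum.swap) (simp add: case_prod_unfold)
  also have "\<dots> = (\<Sum>x\<in>{lo<..hi}. (conj_part \<nu> x - conj_part lam x) choose 2)"
  proof (rule sum.cong[OF refl])
    fix x
    have "(\<Sum>(j, i)\<in>P. if lam ! i < x \<and> x \<le> \<nu> ! j then 1 else 0) =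
        card {p\<in>P. lam ! snd p < x \<and> x \<le> \<nu> ! fst p}"
      by (simp add: case_prod_unfold sum.inter_filter[symmetric] P_def)
    also have "\<dots> = card {(i, j). conj_part lam x \<le> i \<and> i < j \<and> j < conj_part \<nu> x}"
    proof (rule bij_betw_same_card[of prod.swap])
      have 1: "conj_part lam x \<le> i \<and> i < j \<and> j < conj_part \<nu> x"
        if "(j, i) \<in> P" "lam ! i < x" "x \<le> \<nu> ! j" for i j
        using that less_conj_part_iff[OF lam(1), of i x] less_conj_part_iff[OF nu(1), of j x]
        by (auto simp: P_def not_less not_le)
      have 2: "(j, i) \<in> P \<and> lam ! i < x \<and> x \<le> \<nu> ! j"
        if "conj_part lam x \<le> i" "i < j" "j < conj_part \<nu> x" for i j
        using that less_conj_part_iff[OF lam(1), of i x] less_conj_part_iff[OF nu(1), of j x]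
        by (auto simp: P_def not_less not_le)
      show "bij_betw prod.swap {p\<in>P. lam ! snd p < x \<and> x \<le> \<nu> ! fst p}
          {(i, j). conj_part lam x \<le> i \<and> i < j \<and> j < conj_part \<nu> x}"
        by (intro bij_betw_byWitness[where f' = prod.swap]) (auto dest: 1 2)
    qed
    finally show "(\<Sum>(j, i)\<in>P. if lam ! i < x \<and> x \<le> \<nu> ! j then 1 else 0) =
        (conj_part \<nu> x - conj_part lam x) choose 2"
      unfolding card_triangle .
  qed
  finally show ?thesis .
qed

section \<open>The recurrence for the limit\<close>

text \<open>The claimed limit at \<open>u = 1\<close>. It is real, so the recurrence can be proved
  over the reals, and the power of \<open>u\<close> enters only in
  \<open>skew_HL_Q_tendsto\<close>.\<close>

definition Q_limit :: "real \<Rightarrow> int list \<Rightarrow> int list \<Rightarrow> real" where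
  "Q_limit t \<nu> lam = t ^ n_skew_sig \<nu> lam *
     (\<Prod>x\<in>set \<nu> \<union> set lam.
        qpoch (t powi (1 + int (conj_part \<nu> x) - int (conj_part lam x))) t (count_list lam x)
        / qpoch t t (count_list lam x))"

text \<open>The factor of a column, in terms of the difference \<open>d\<close> of the conjugate parts and the
  multiplicity \<open>m\<close> in the smaller signature.\<close>

definition column_weight :: "real \<Rightarrow> nat \<Rightarrow> nat \<Rightarrow> real" where
  "column_weight t d m = t ^ (d choose 2) * qpoch t t (d + m) / (qpoch t t d * qpoch t t m)"

text \<open>The probability that a box is added to a column (\<open>a\<close>) given whether one is added to the next
  (\<open>b\<close>). For \<open>d = m = 0\<close> and \<open>b\<close> it is \<open>0 / 0 = 0\<close>, so the two cases still sum to 1.\<close>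

definition column_prob :: "real \<Rightarrow> nat \<Rightarrow> nat \<Rightarrow> bool \<Rightarrow> bool \<Rightarrow> real" where
  "column_prob t d m a b =
     (let p = (if b then (1 - t ^ d) / (1 - t ^ (d + m)) else 1 - t ^ d) in if a then p else 1 - p)"

text \<open>A chain of choices from right to left, started without a box at \<open>hi + 1\<close>.
  The leftmost choice affects no other factor, so its two cases are summed first and give 1.\<close>

lemma sum_Pow_markov:
  fixes g :: "int \<Rightarrow> bool \<Rightarrow> bool \<Rightarrow> real"
  assumes "\<And>x b. g x True b + g x False b = 1"
  shows "(\<Sum>A\<in>Pow {hi - int k<..hi}. \<Prod>x\<in>{hi - int k<..hi}. g x (x \<in> A) (x + 1 \<in> A)) = 1"
proof (induction k)
  case (Suc k)
  define I where "I = {hi - int k<..hi}"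
  define l where "l = hi - int k"
  have I': "{hi - int (Suc k)<..hi} = insert l I" and l: "l \<notin> I" "finite I"
    by (auto simp: I_def l_def)
  define F where "F = (\<lambda>A. \<Prod>x\<in>insert l I. g x (x \<in> A) (x + 1 \<in> A))"
  have F: "F B = (\<Prod>x\<in>I. g x (x \<in> B) (x + 1 \<in> B)) * g l False (l + 1 \<in> B)"
    "F (insert l B) = (\<Prod>x\<in>I. g x (x \<in> B) (x + 1 \<in> B)) * g l True (l + 1 \<in> B)" if "B \<in> Pow I" for B
  proof -
    have "l \<notin> B" "x \<in> I \<Longrightarrow> x \<noteq> l" "x \<in> I \<Longrightarrow> x + 1 \<noteq> l" for x
      using that l by (auto simp: I_def l_def)
    then show "F B = (\<Prod>x\<in>I. g x (x \<in> B) (x + 1 \<in> B)) * g l False (l + 1 \<in> B)"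
      "F (insert l B) = (\<Prod>x\<in>I. g x (x \<in> B) (x + 1 \<in> B)) * g l True (l + 1 \<in> B)"
      using l by (auto simp: F_def mult.commute intro!: prod.cong)
  qed
  have "sum F (Pow (insert l I)) = sum F (Pow I) + sum F (insert l ` Pow I)"
    unfolding Pow_insert by (rule sum.union_disjoint) (use l in auto)
  also have "sum F (insert l ` Pow I) = (\<Sum>B\<in>Pow I. F (insert l B))"
    by (rule sum.reindex_cong[of "insert l"]) (use l in \<open>auto simp: inj_on_def\<close>)
  also have "sum F (Pow I) + (\<Sum>B\<in>Pow I. F (insert l B)) =
      (\<Sum>B\<in>Pow I. (\<Prod>x\<in>I. g x (x \<in> B) (x + 1 \<in> B)) * (g l True (l + 1 \<in> B) + g l False (l + 1 \<in> B)))"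
    unfolding sum.distrib[symmetric] by (intro sum.cong refl) (simp add: F distrib_left)
  also have "\<dots> = 1"
    using Suc by (simp add: assms I_def)
  finally show ?case unfolding I' F_def .
qed simp

text \<open>The bound by \<nu> makes the set finite: the first row of a signature interlacing
  \<open>lam\<close> from above is otherwise unbounded.\<close>

definition up_set :: "nat \<Rightarrow> int list \<Rightarrow> int list \<Rightarrow> int list set" where
  "up_set n \<nu> lam = {kap \<in> Sig n. prec_Q n lam kap \<and> sig_le kap \<nu>}"

lemma parts_within_between:
  assumes "lam \<in> Sig n" "parts_within lo hi lam" "\<nu> \<in> Sig n" "parts_within lo hi \<nu>"
    and "kap \<in> Sig n" "sig_le lam kap" "sig_le kap \<nu>"
  shows "parts_within lo hi kap"
  unfolding parts_within_def
proof
  fix y assume "y \<in> set kap"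
  then obtain i where i: "i < n" "y = kap ! i" using SigD[OF assms(5)] by (auto simp: in_set_conv_nth)
  then have "lam ! i \<le> y" "y \<le> \<nu> ! i"
    using assms sig_le_iff_nth by blast+
  moreover have "lo \<le> lam ! i" "\<nu> ! i \<le> hi"
    using assms i by (auto simp: parts_within_def SigD)
  ultimately show "lo \<le> y \<and> y \<le> hi" by simp
qed

lemma exists_parts_within: "\<exists>lo hi. lo \<le> hi \<and> parts_within lo hi lam \<and> parts_within lo hi \<nu>"
proof -
  define S where "S = insert 0 (set lam \<union> set \<nu>)"
  have "finite S" "0 \<in> S" by (auto simp: S_def)
  then have "Min S \<le> Max S" by (meson Max_ge Min_le order_trans)
  moreover have "parts_within (Min S) (Max S) lam" "parts_within (Min S) (Max S) \<nu>"
    by (auto simp: parts_within_def S_def intro: Min_le Max_ge)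
  ultimately show ?thesis by blast
qed

context
  fixes t :: real
  assumes t: "0 < t" "t < 1"
begin

lemma one_minus_power_pos: "0 < m \<Longrightarrow> 0 < 1 - t ^ m"
  using t power_less_one_iff[of t m] by simp

lemma qpoch_self_pos: "0 < qpoch t t m"
  unfolding qpoch_def
  using one_minus_power_pos[of "Suc i" for i] by (intro prod_pos) simp

lemma qpoch_shift: "qpoch (t ^ Suc d) t m = qpoch t t (d + m) / qpoch t t d"
proof (induction m)
  case (Suc m)
  have "qpoch (t ^ Suc d) t (Suc m) = qpoch (t ^ Suc d) t m * (1 - t ^ Suc (d + m))"
    by (simp add: qpoch_def power_add mult_ac)
  then show ?case using Suc qpoch_self_Suc[of t "d + m"] by simp
qed (use qpoch_self_pos[of d] in simp)

text \<open>Values between \<open>lo\<close> and \<open>hi\<close> that occur in neither signature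
  have multiplicity 0 and add no quotient. By \<open>qpoch_shift\<close> each column carries a power
  of \<open>t\<close> times a \<open>t\<close>-binomial coefficient.\<close>

lemma Q_limit_columns:
  assumes lam: "lam \<in> Sig n" "parts_within lo hi lam" and nu: "\<nu> \<in> Sig n" "parts_within lo hi \<nu>"
    and le: "sig_le lam \<nu>"
  shows "Q_limit t \<nu> lam = (\<Prod>x\<in>{lo..hi}. column_weight t (conj_part \<nu> x - conj_part lam x) (count_list lam x))"
proof -
  define d where "d = (\<lambda>x. conj_part \<nu> x - conj_part lam x)"
  define f where "f = (\<lambda>x. qpoch t t (d x + count_list lam x) / (qpoch t t (d x) * qpoch t t (count_list lam x)))"
  have f1: "f x = 1" if "x \<notin> set \<nu> \<union> set lam" for x
    using that qpoch_self_pos[of "d x"] by (simp add: f_def)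
  have fx: "qpoch (t powi (1 + int (conj_part \<nu> x) - int (conj_part lam x))) t (count_list lam x)
        / qpoch t t (count_list lam x) = f x" for x
  proof -
    have "1 + int (conj_part \<nu> x) - int (conj_part lam x) = int (Suc (d x))"
      using le by (auto simp: sig_le_def d_def of_nat_diff)
    then show ?thesis
      by (simp only: power_int_of_nat qpoch_shift f_def divide_divide_eq_left)
  qed
  have "(\<Prod>x\<in>set \<nu> \<union> set lam.
        qpoch (t powi (1 + int (conj_part \<nu> x) - int (conj_part lam x))) t (count_list lam x)
        / qpoch t t (count_list lam x)) = (\<Prod>x\<in>{lo..hi}. f x)"
    unfolding fx using lam nu f1 by (intro prod.mono_neutral_left) (auto simp: parts_within_def)
  moreover have "t ^ n_skew_sig \<nu> lam = (\<Prod>x\<in>{lo..hi}. t ^ (d x choose 2))"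
  proof -
    have "(\<Prod>x\<in>{lo..hi}. t ^ (d x choose 2)) = (\<Prod>x\<in>{lo<..hi}. t ^ (d x choose 2))"
    proof (rule prod.mono_neutral_right)
      show "\<forall>x\<in>{lo..hi} - {lo<..hi}. t ^ (d x choose 2) = 1"
      proof
        fix x assume "x \<in> {lo..hi} - {lo<..hi}"
        then have "d x = 0"
          using conj_part_low[OF lam(2,1)] conj_part_low[OF nu(2,1)] by (auto simp: d_def)
        then show "t ^ (d x choose 2) = 1" by (simp add: binomial_eq_0)
      qed
    qed auto
    then show ?thesis
      unfolding n_skew_sig_conj_part[OF lam nu] d_def by (simp add: power_sum)
  qed
  ultimately show ?thesis
    by (simp add: Q_limit_def column_weight_def f_def d_def prod.distrib[symmetric])
qed

text \<open>A box in column \<open>x\<close> (\<open>a\<close>) lowers the difference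
  \<open>d\<close> and raises the multiplicity of \<open>x\<close>; a box in column
  \<open>x + 1\<close> (\<open>b\<close>) lowers that multiplicity. The first factor is the one of
  \<open>HL_phi\<close>, and \<open>column_prob\<close> is the resulting ratio of weights.\<close>

lemma column_weight_step:
  assumes a: "of_bool a \<le> d" and b: "of_bool b \<le> m + of_bool a"
  shows "(if a \<and> \<not> b then 1 - t ^ Suc m else 1) * t ^ (d - of_bool a) *
      column_weight t (d - of_bool a) (m + of_bool a - of_bool b) =
    column_weight t d m * column_prob t d m a b"
proof -
  have q: "qpoch t t k \<noteq> 0" for k using qpoch_self_pos[of k] by simp
  have w: "1 - t * t ^ k \<noteq> 0" for k using one_minus_power_pos[of "Suc k"] by simp
  have ch: "Suc e choose 2 = e + (e choose 2)" for e by (simp add: numeral_2_eq_2)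
  consider "\<not> a" "\<not> b" | "a" "\<not> b" | m' where "\<not> a" b "m = Suc m'" | d' where a b "d = Suc d'"
    using a b by (cases a; cases b; cases m; cases d) auto
  then show ?thesis
  proof cases
    case 1
    then show ?thesis by (simp add: column_weight_def column_prob_def)
  next
    case 2
    then obtain d' where d: "d = Suc d'" using a by (cases d) auto
    show ?thesis using 2 q w
      by (simp add: d column_weight_def column_prob_def qpoch_self_Suc ch power_add field_simps)
  next
    case 3
    have "1 - (1 - t ^ d) / (1 - t ^ (d + m)) = t ^ d * (1 - t ^ m) / (1 - t ^ (d + m))"
      using w[of "d + m'"] 3 by (simp add: field_simps power_add)
    then show ?thesis using 3 q w
      by (simp add: column_weight_def column_prob_def qpoch_self_Suc)
  next
    case 4
    show ?thesis using 4 q w[of "d' + m"] w[of d']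
      by (simp add: column_weight_def column_prob_def qpoch_self_Suc ch power_add)
  qed
qed

theorem Q_limit_recurrence:
  assumes lam: "lam \<in> Sig n" and nu: "\<nu> \<in> Sig n" and le: "sig_le lam \<nu>"
  shows "(\<Sum>kap\<in>up_set n \<nu> lam. HL_phi t kap lam * t powi (sum_list \<nu> - sum_list kap) * Q_limit t \<nu> kap) =
    Q_limit t \<nu> lam" and "finite (up_set n \<nu> lam)"
proof -
  obtain lo hi where lohi: "lo \<le> hi" and bl: "parts_within lo hi lam" and bn: "parts_within lo hi \<nu>"
    using exists_parts_within by blast
  define d where "d = (\<lambda>x. conj_part \<nu> x - conj_part lam x)"
  define m where "m = count_list lam"
  define g where "g = (\<lambda>x. column_prob t (d x) (m x))"
  define W where "W = (\<lambda>A. \<Prod>x\<in>{lo<..hi}. g x (x \<in> A) (x + 1 \<in> A))"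
  define cols where "cols = (\<lambda>kap. {x\<in>{lo<..hi}. conj_part kap x = Suc (conj_part lam x)})"
  have leD: "conj_part lam x \<le> conj_part \<nu> x" for x using le by (simp add: sig_le_def)
  \<comment> \<open>Both columns at \<open>lo\<close> have full length \<open>n\<close>, so no box
    can be added there. Hence \<open>cols\<close> leaves \<open>lo\<close> out, and its factor is
    shown to be 1 in \<open>wlo\<close>.\<close>
  have dlo: "d lo = 0"
    using conj_part_low[OF bl lam order_refl] conj_part_low[OF bn nu order_refl] by (simp add: d_def)
  have up: "kap \<in> Sig n" "sig_le lam kap" "parts_within lo hi kap" "sig_le kap \<nu>"
      "\<And>x. conj_part kap x = conj_part lam x + of_bool (x \<in> cols kap)" if "kap \<in> up_set n \<nu> lam" for kap
  proof -
    show k: "kap \<in> Sig n" and le': "sig_le kap \<nu>" using that by (auto simp: up_set_def)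
    have c: "conj_part lam x \<le> conj_part kap x \<and> conj_part kap x \<le> Suc (conj_part lam x)" for x
      using that prec_Q_iff_conj_part[OF lam k] by (auto simp: up_set_def)
    then show lk: "sig_le lam kap" by (simp add: sig_le_def)
    show b: "parts_within lo hi kap" by (rule parts_within_between[OF lam bl nu bn k lk le'])
    show "conj_part kap x = conj_part lam x + of_bool (x \<in> cols kap)" for x
    proof (cases "x \<in> {lo<..hi}")
      case True
      then show ?thesis using c[of x] by (auto simp: cols_def)
    next
      case False
      then have "conj_part kap x = conj_part lam x"
        using conj_part_low[OF bl lam, of x] conj_part_low[OF b k, of x]
          conj_part_high[OF bl, of x] conj_part_high[OF b, of x] by force
      then show ?thesis using False by (auto simp: cols_def)
    qed
  qed
  have inj: "inj_on cols (up_set n \<nu> lam)"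
  proof (rule inj_onI)
    fix kap kap' assume k: "kap \<in> up_set n \<nu> lam" "kap' \<in> up_set n \<nu> lam" "cols kap = cols kap'"
    show "kap = kap'"
      by (rule Sig_eqI[OF up(1)[OF k(1)] up(1)[OF k(2)]]) (simp add: up(5)[OF k(1)] up(5)[OF k(2)] k(3))
  qed
  have sub: "cols ` up_set n \<nu> lam \<subseteq> Pow {lo<..hi}"
    by (auto simp: cols_def)
  show "finite (up_set n \<nu> lam)"
    using inj sub by (metis finite_Pow_iff finite_greaterThanAtMost_int finite_imageD finite_subset)
  \<comment> \<open>a set of columns that does not come from a signature has a step of probability 0\<close>
  have zero: "W A = 0" if A: "A \<in> Pow {lo<..hi} - cols ` up_set n \<nu> lam" for A
  proof (rule ccontr)
    assume "W A \<noteq> 0"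
    then have gnz: "g x (x \<in> A) (x + 1 \<in> A) \<noteq> 0" if "x \<in> {lo<..hi}" for x
      using that by (auto simp: W_def)
    have dpos: "0 < d x" if "x \<in> A" for x
    proof (rule ccontr)
      assume "\<not> 0 < d x"
      moreover have "x \<in> {lo<..hi}" using that A by auto
      ultimately show False using gnz[of x] that by (simp add: g_def column_prob_def Let_def split: if_splits)
    qed
    define c where "c = (\<lambda>x. conj_part lam x + of_bool (x \<in> A))"
    have cle: "c x \<le> conj_part \<nu> x" for x
      using dpos[of x] leD[of x] by (auto simp: c_def d_def)
    have clow: "c x = n" if "x \<le> lo" for x
      using that A conj_part_low[OF bl lam] by (auto simp: c_def)
    have chigh: "c x = 0" if "hi < x" for x
      using that A conj_part_high[OF bl] by (auto simp: c_def)
    \<comment> \<open>Monotonicity is at risk only where a box is added at \<open>x + 1\<close> but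
      not at \<open>x\<close>. If no part of \<open>lam\<close> equals \<open>x\<close>, this has
      probability \<open>1 - (1 - t ^ d x) / (1 - t ^ d x) = 0\<close>; the column \<open>lo\<close>
      is safe because it has length \<open>n\<close>.\<close>
    have anti: "c (x + 1) \<le> c x" for x
    proof (cases "x + 1 \<in> A \<and> x \<notin> A")
      case True
      show ?thesis
      proof (cases "x = lo")
        case True
        then show ?thesis using clow[of lo] cle[of "lo + 1"] conj_part_le[OF nu, of "lo + 1"] by simp
      next
        case False
        then have x: "x \<in> {lo<..hi}" using True A by auto
        have "m x \<noteq> 0"
        proof
          assume m0: "m x = 0"
          have "d (x + 1) \<le> d x"
            using m0 conj_part_Suc_int[of lam x] conj_part_antimono[of x "x + 1" \<nu>]
            by (simp add: d_def m_def)
          then have "0 < d x" using dpos[of "x + 1"] True by simp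
          then have "g x False True = 0"
            using one_minus_power_pos[of "d x"] m0 by (simp add: g_def column_prob_def)
          then show False using gnz[OF x] True by simp
        qed
        then show ?thesis using True conj_part_Suc_int[of lam x] by (simp add: c_def m_def)
      qed
    next
      case False
      then show ?thesis using conj_part_antimono[of x "x + 1" lam] by (auto simp: c_def)
    qed
    obtain kap where kap: "kap \<in> Sig n" "\<And>x. conj_part kap x = c x"
      using exists_Sig_conj_part[of c lo n hi, OF anti clow chigh lohi] by blast
    have "prec_Q n lam kap"
      unfolding prec_Q_iff_conj_part[OF lam kap(1)] kap(2) by (simp add: c_def)
    moreover have "sig_le kap \<nu>" unfolding sig_le_def kap(2) using cle by simp
    ultimately have "kap \<in> up_set n \<nu> lam" using kap(1) by (simp add: up_set_def)
    moreover have "cols kap = A" using A by (auto simp: cols_def kap(2) c_def split: if_splits)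
    ultimately show False using A by blast
  qed
  have summand: "HL_phi t kap lam * t powi (sum_list \<nu> - sum_list kap) * Q_limit t \<nu> kap =
      Q_limit t \<nu> lam * W (cols kap)" if kap: "kap \<in> up_set n \<nu> lam" for kap
  proof -
    note u = up[OF kap]
    define a where "a = (\<lambda>x. x \<in> cols kap)"
    have ck: "conj_part kap x = conj_part lam x + of_bool (a x)" for x
      unfolding a_def by (rule u(5))
    have ale: "of_bool (a x) \<le> d x" for x
    proof -
      have "conj_part kap x \<le> conj_part \<nu> x" using u(4) by (simp add: sig_le_def)
      then show ?thesis unfolding ck d_def by linarith
    qed
    \<comment> \<open>A multiplicity is the difference of two adjacent columns; the additive form
      avoids truncated subtraction.\<close>
    have mk: "count_list kap x + of_bool (a (x + 1)) = m x + of_bool (a x)" for x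
      using conj_part_Suc_int[of kap x] conj_part_Suc_int[of lam x] unfolding ck m_def by linarith
    have dk: "conj_part \<nu> x - conj_part kap x = d x - of_bool (a x)" for x
      unfolding ck d_def by simp
    have notlo: "\<not> a lo" by (simp add: a_def cols_def)
    have phi: "HL_phi t kap lam = (\<Prod>x\<in>{lo..hi}. if a x \<and> \<not> a (x + 1) then 1 - t ^ Suc (m x) else 1)"
    proof -
      have iff: "count_list kap x = count_list lam x + 1 \<longleftrightarrow> a x \<and> \<not> a (x + 1)" for x
        using mk[of x] unfolding m_def by (cases "a x"; cases "a (x + 1)") auto
      have "{x. count_list kap x = count_list lam x + 1} = {x\<in>{lo..hi}. a x \<and> \<not> a (x + 1)}"
        unfolding iff by (auto simp: a_def cols_def)
      then have "HL_phi t kap lam = (\<Prod>x\<in>{x\<in>{lo..hi}. a x \<and> \<not> a (x + 1)}. 1 - t ^ count_list kap x)"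
        by (simp add: HL_phi_def)
      also have "\<dots> = (\<Prod>x\<in>{x\<in>{lo..hi}. a x \<and> \<not> a (x + 1)}. 1 - t ^ Suc (m x))"
        using mk by (intro prod.cong) (auto simp: m_def iff[symmetric])
      finally show ?thesis by (subst (asm) prod.inter_filter) auto
    qed
    have pw: "t powi (sum_list \<nu> - sum_list kap) = (\<Prod>x\<in>{lo..hi}. t ^ (d x - of_bool (a x)))"
    proof -
      have "sum_list \<nu> - sum_list kap = (\<Sum>x\<in>{lo<..hi}. int (conj_part \<nu> x) - int (conj_part kap x))"
        unfolding sum_list_conj_part[OF bn] sum_list_conj_part[OF u(3)] SigD[OF nu] SigD[OF u(1)]
        by (simp add: sum_subtractf)
      also have "\<dots> = int (\<Sum>x\<in>{lo<..hi}. d x - of_bool (a x))"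
        unfolding of_nat_sum
      proof (rule sum.cong[OF refl])
        fix x
        have "conj_part kap x \<le> conj_part \<nu> x" using u(4) by (simp add: sig_le_def)
        then show "int (conj_part \<nu> x) - int (conj_part kap x) = int (d x - of_bool (a x))"
          unfolding dk[symmetric] by (simp add: of_nat_diff)
      qed
      also have "(\<Sum>x\<in>{lo<..hi}. d x - of_bool (a x)) = (\<Sum>x\<in>{lo..hi}. d x - of_bool (a x))"
        by (rule sum.mono_neutral_left) (use dlo in \<open>auto simp: not_less intro: order_antisym\<close>)
      finally show ?thesis by (simp only: power_int_of_nat power_sum)
    qed
    have wlo: "g lo (lo \<in> cols kap) (lo + 1 \<in> cols kap) = 1"
      using dlo notlo by (simp add: g_def column_prob_def a_def)
    have "HL_phi t kap lam * t powi (sum_list \<nu> - sum_list kap) * Q_limit t \<nu> kap =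
      (\<Prod>x\<in>{lo..hi}. (if a x \<and> \<not> a (x + 1) then 1 - t ^ Suc (m x) else 1) * t ^ (d x - of_bool (a x)) *
         column_weight t (d x - of_bool (a x)) (count_list kap x))"
      unfolding phi pw Q_limit_columns[OF u(1,3) nu bn u(4)] dk by (simp add: prod.distrib)
    also have "\<dots> = (\<Prod>x\<in>{lo..hi}. column_weight t (d x) (m x) * g x (a x) (a (x + 1)))"
    proof (rule prod.cong[OF refl])
      fix x
      have "count_list kap x = m x + of_bool (a x) - of_bool (a (x + 1))"
        and "of_bool (a (x + 1)) \<le> m x + of_bool (a x)" using mk[of x] by linarith+
      then show "(if a x \<and> \<not> a (x + 1) then 1 - t ^ Suc (m x) else 1) * t ^ (d x - of_bool (a x)) *
         column_weight t (d x - of_bool (a x)) (count_list kap x) =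
         column_weight t (d x) (m x) * g x (a x) (a (x + 1))"
        using column_weight_step[OF ale] unfolding g_def by simp
    qed
    also have "\<dots> = Q_limit t \<nu> lam * (\<Prod>x\<in>{lo..hi}. g x (a x) (a (x + 1)))"
      unfolding prod.distrib Q_limit_columns[OF lam bl nu bn le] by (simp add: d_def m_def)
    also have "(\<Prod>x\<in>{lo..hi}. g x (a x) (a (x + 1))) = W (cols kap)"
      unfolding W_def a_def
      by (rule prod.mono_neutral_right) (use wlo in \<open>auto simp: not_less intro: order_antisym\<close>)
    finally show ?thesis .
  qed
  have "(\<Sum>kap\<in>up_set n \<nu> lam. HL_phi t kap lam * t powi (sum_list \<nu> - sum_list kap) * Q_limit t \<nu> kap) =
      Q_limit t \<nu> lam * (\<Sum>kap\<in>up_set n \<nu> lam. W (cols kap))"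
    by (simp add: summand sum_distrib_left)
  also have "(\<Sum>kap\<in>up_set n \<nu> lam. W (cols kap)) = sum W (cols ` up_set n \<nu> lam)"
    by (simp add: sum.reindex[OF inj])
  also have "\<dots> = sum W (Pow {lo<..hi})"
    by (rule sum.mono_neutral_left) (use sub zero in auto)
  also have "\<dots> = 1"
  proof -
    have "lo = hi - int (nat (hi - lo))" using lohi by simp
    moreover have "g x True b + g x False b = 1" for x b
      by (simp add: g_def column_prob_def Let_def)
    ultimately show ?thesis
      using sum_Pow_markov[of g hi "nat (hi - lo)"] unfolding W_def by simp
  qed
  finally show "(\<Sum>kap\<in>up_set n \<nu> lam. HL_phi t kap lam * t powi (sum_list \<nu> - sum_list kap) * Q_limit t \<nu> kap) =
    Q_limit t \<nu> lam" by simp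
qed

end

section \<open>Principal specialization of the dual skew functions\<close>

text \<open>The distance to the fixed point of \<open>L = r * L + A\<close> contracts by
  \<open>r\<close> up to an error tending to 0. Once the errors are below
  \<open>e / 2 * (1 - r)\<close>, they accumulate to at most \<open>e / 2\<close>.\<close>

lemma affine_recursion_tendsto:
  fixes Z a :: "nat \<Rightarrow> 'a::real_normed_field"
  assumes r: "0 \<le> r" "r < 1" and rec: "\<And>J. Z (Suc J) = of_real r * Z J + a J" and a: "a \<longlonglongrightarrow> A"
  shows "Z \<longlonglongrightarrow> A / (1 - of_real r)"
proof -
  define L where "L = A / (1 - of_real r)"
  have r1: "(1 :: 'a) - of_real r \<noteq> 0" using r by (metis less_irrefl of_real_1 of_real_eq_iff right_minus_eq)
  have L: "L = of_real r * L + A" using r1 by (simp add: L_def field_simps)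
  have step: "norm (Z (Suc J) - L) \<le> r * norm (Z J - L) + norm (a J - A)" for J
  proof -
    have "Z (Suc J) - L = of_real r * (Z J - L) + (a J - A)"
      using rec[of J] L by (simp add: algebra_simps)
    then show ?thesis
      using norm_triangle_ineq[of "of_real r * (Z J - L)" "a J - A"] r by (simp add: norm_mult)
  qed
  show ?thesis
    unfolding L_def[symmetric]
  proof (rule LIMSEQ_I)
    fix e :: real assume e: "0 < e"
    then have "0 < e / 2 * (1 - r)" using r by simp
    from LIMSEQ_D[OF a this] obtain N where N: "\<And>J. J \<ge> N \<Longrightarrow> norm (a J - A) < e / 2 * (1 - r)"
      by blast
    have bound: "norm (Z (N + k) - L) \<le> r ^ k * norm (Z N - L) + e / 2" for k
    proof (induction k)
      case (Suc k)
      have "norm (Z (N + Suc k) - L) \<le> r * norm (Z (N + k) - L) + e / 2 * (1 - r)"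
        using step[of "N + k"] N[of "N + k"] by simp
      also have "r * norm (Z (N + k) - L) \<le> r * (r ^ k * norm (Z N - L) + e / 2)"
        using Suc r by (intro mult_left_mono)
      finally show ?case by (simp add: algebra_simps diff_divide_distrib)
    qed (use e in simp)
    have "(\<lambda>k. r ^ k * norm (Z N - L)) \<longlonglongrightarrow> 0"
      using r by (intro tendsto_mult_left_zero LIMSEQ_power_zero) simp
    from LIMSEQ_D[OF this, of "e / 2"] e
    obtain K where K: "\<And>k. k \<ge> K \<Longrightarrow> \<bar>r ^ k * norm (Z N - L)\<bar> < e / 2"
      by (auto simp: abs_mult)
    have "norm (Z J - L) < e" if "J \<ge> N + K" for J
    proof -
      have "\<bar>r ^ (J - N) * norm (Z N - L)\<bar> < e / 2" using that by (intro K) simp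
      moreover have "norm (Z J - L) \<le> r ^ (J - N) * norm (Z N - L) + e / 2"
        using bound[of "J - N"] that by simp
      ultimately show ?thesis by linarith
    qed
    then show "\<exists>M. \<forall>J\<ge>M. norm (Z J - L) < e" by blast
  qed
qed

lemma Q_chains_0: "Q_chains n 0 \<nu> lam = (if lam = \<nu> \<and> lam \<in> Sig n then {[lam]} else {})"
  by (auto simp: Q_chains_def length_Suc_conv)

lemma Q_chains_Suc:
  assumes "lam \<in> Sig n"
  shows "Q_chains n (Suc J) \<nu> lam = (\<Union>kap\<in>{kap\<in>Sig n. prec_Q n lam kap}. (#) lam ` Q_chains n J \<nu> kap)"
proof (intro equalityI subsetI)
  fix c assume c: "c \<in> Q_chains n (Suc J) \<nu> lam"
  then obtain c' where c': "c = lam # c'" "length c' = Suc J"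
    by (cases c) (auto simp: Q_chains_def)
  have "prec_Q n lam (c' ! 0)" and "\<forall>i<J. prec_Q n (c' ! i) (c' ! Suc i)"
    using c by (auto simp: Q_chains_def c'(1) All_less_Suc2)
  moreover have "c' ! 0 \<in> Sig n" using c c' by (cases c') (auto simp: Q_chains_def)
  ultimately show "c \<in> (\<Union>kap\<in>{kap\<in>Sig n. prec_Q n lam kap}. (#) lam ` Q_chains n J \<nu> kap)"
    using c c' by (auto simp: Q_chains_def)
qed (use assms in \<open>auto simp: Q_chains_def All_less_Suc2\<close>)

lemma prec_Q_sig_le: "lam \<in> Sig n \<Longrightarrow> kap \<in> Sig n \<Longrightarrow> prec_Q n lam kap \<Longrightarrow> sig_le lam kap"
  by (simp add: prec_Q_iff_conj_part sig_le_def)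

lemma Q_chains_empty:
  assumes "lam \<in> Sig n" "\<not> sig_le lam \<nu>"
  shows "Q_chains n J \<nu> lam = {}"
  using assms
proof (induction J arbitrary: lam)
  case 0
  then show ?case by (auto simp: Q_chains_0 sig_le_def)
next
  case (Suc J)
  have "Q_chains n J \<nu> kap = {}" if "kap \<in> Sig n" "prec_Q n lam kap" for kap
    using Suc that prec_Q_sig_le[OF Suc.prems(1) that] by (auto simp: sig_le_def intro: order_trans)
  then show ?case using Q_chains_Suc[OF Suc.prems(1)] by auto
qed

lemma skew_HL_Q_eq_0: "lam \<in> Sig n \<Longrightarrow> \<not> sig_le lam \<nu> \<Longrightarrow> skew_HL_Q t n \<nu> lam J y = 0"
  by (simp add: skew_HL_Q_def Q_chains_empty)

lemma skew_HL_Q_0: "lam \<in> Sig n \<Longrightarrow> skew_HL_Q t n \<nu> lam 0 y = (if lam = \<nu> then 1 else 0)"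
  by (simp add: skew_HL_Q_def Q_chains_0)

lemma HL_phi_refl: "HL_phi t lam lam = 1"
  by (simp add: HL_phi_def)

lemma sig_le_refl: "sig_le lam lam"
  by (simp add: sig_le_def)

lemma sum_list_sig_less:
  assumes "lam \<in> Sig n" "kap \<in> Sig n" "sig_le lam kap" "lam \<noteq> kap"
  shows "sum_list lam < sum_list kap"
proof (rule ccontr)
  assume "\<not> ?thesis"
  have s: "sum_list xs = (\<Sum>i<n. xs ! i)" if "xs \<in> Sig n" for xs
    using that by (simp add: sum_list_sum_nth SigD lessThan_atLeast0)
  have le: "\<And>i. i \<in> {..<n} \<Longrightarrow> lam ! i \<le> kap ! i" using sig_le_iff_nth[OF assms(1,2)] assms(3) by simp
  then have "(\<Sum>i<n. lam ! i) \<le> (\<Sum>i<n. kap ! i)" by (rule sum_mono)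
  with \<open>\<not> ?thesis\<close> have eq: "(\<Sum>i<n. lam ! i) = (\<Sum>i<n. kap ! i)" using s assms by simp
  have "lam ! i = kap ! i" if "i < n" for i
    using sum_mono_inv[OF eq le] that by simp
  then have "lam = kap" using assms SigD by (auto intro!: nth_equalityI)
  with assms(4) show False by simp
qed

text \<open>The theorem admits \<open>u = 0\<close>, and for nonnegative exponents the addition law
  holds there as well.\<close>

lemma power_int_add_nonneg:
  fixes u :: "'a::division_ring"
  assumes "0 \<le> a" "0 \<le> b"
  shows "u powi (a + b) = u powi a * u powi b"
  using assms by (simp add: power_int_def nat_add_distrib power_add)

context
  fixes t :: real and n :: nat and \<nu> :: "int list"
  assumes t: "0 < t" "t < 1" and nu: "\<nu> \<in> Sig n"
begin

lemma finite_up_set: "finite (up_set n \<nu> lam)" if "lam \<in> Sig n"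
proof (cases "sig_le lam \<nu>")
  case False
  then have "up_set n \<nu> lam = {}"
    using prec_Q_sig_le[OF that] by (auto simp: up_set_def sig_le_def) (meson order_trans)
  then show ?thesis by simp
qed (rule Q_limit_recurrence(2)[OF t that nu])

lemma Q_chains_Suc_up_set:
  assumes "lam \<in> Sig n"
  shows "Q_chains n (Suc J) \<nu> lam = (\<Union>kap\<in>up_set n \<nu> lam. (#) lam ` Q_chains n J \<nu> kap)"
proof -
  have "kap \<in> up_set n \<nu> lam"
    if "kap \<in> Sig n" "prec_Q n lam kap" "c \<in> Q_chains n J \<nu> kap" for kap c
    using that Q_chains_empty[of kap n \<nu> J] by (auto simp: up_set_def)
  then show ?thesis
    unfolding Q_chains_Suc[OF assms] by (auto simp: up_set_def)
qed

lemma finite_Q_chains: "lam \<in> Sig n \<Longrightarrow> finite (Q_chains n J \<nu> lam)"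
proof (induction J arbitrary: lam)
  case (Suc J)
  then show ?case using finite_up_set by (auto simp: Q_chains_Suc_up_set up_set_def)
qed (simp add: Q_chains_0)

lemma skew_HL_Q_Suc:
  assumes lam: "lam \<in> Sig n"
  shows "skew_HL_Q t n \<nu> lam (Suc J) y = (\<Sum>kap\<in>up_set n \<nu> lam.
     y 0 powi (sum_list kap - sum_list lam) * of_real (HL_phi t kap lam) *
     skew_HL_Q t n \<nu> kap J (\<lambda>i. y (Suc i)))"
proof -
  define F where "F = (\<lambda>J (y :: nat \<Rightarrow> complex) c. \<Prod>i<J. y i powi (sum_list (c ! Suc i) - sum_list (c ! i)) *
     complex_of_real (HL_phi t (c ! Suc i) (c ! i)))"
  have Q: "skew_HL_Q t n \<nu> l J y = sum (F J y) (Q_chains n J \<nu> l)" for l J y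
    by (simp add: skew_HL_Q_def F_def)
  have hd: "c ! 0 = kap" if "c \<in> Q_chains n J \<nu> kap" for c kap
    using that by (simp add: Q_chains_def)
  have "skew_HL_Q t n \<nu> lam (Suc J) y =
      (\<Sum>kap\<in>up_set n \<nu> lam. sum (F (Suc J) y) ((#) lam ` Q_chains n J \<nu> kap))"
    unfolding Q Q_chains_Suc_up_set[OF lam]
  proof (rule sum.UNION_disjoint[OF finite_up_set[OF lam]])
    show "\<forall>kap\<in>up_set n \<nu> lam. finite ((#) lam ` Q_chains n J \<nu> kap)"
      using finite_Q_chains by (auto simp: up_set_def)
    show "\<forall>kap\<in>up_set n \<nu> lam. \<forall>kap'\<in>up_set n \<nu> lam. kap \<noteq> kap' \<longrightarrow>
        (#) lam ` Q_chains n J \<nu> kap \<inter> (#) lam ` Q_chains n J \<nu> kap' = {}"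
      by (auto dest: hd)
  qed
  also have "\<dots> = (\<Sum>kap\<in>up_set n \<nu> lam. \<Sum>c\<in>Q_chains n J \<nu> kap.
      y 0 powi (sum_list kap - sum_list lam) * of_real (HL_phi t kap lam) * F J (\<lambda>i. y (Suc i)) c)"
  proof (rule sum.cong[OF refl])
    fix kap
    have "sum (F (Suc J) y) ((#) lam ` Q_chains n J \<nu> kap) =
        (\<Sum>c\<in>Q_chains n J \<nu> kap. F (Suc J) y (lam # c))"
      by (rule sum.reindex_cong[of "(#) lam"]) auto
    also have "\<dots> = (\<Sum>c\<in>Q_chains n J \<nu> kap.
      y 0 powi (sum_list kap - sum_list lam) * of_real (HL_phi t kap lam) * F J (\<lambda>i. y (Suc i)) c)"
      by (rule sum.cong[OF refl]) (simp add: F_def prod.lessThan_Suc_shift hd del: prod.lessThan_Suc)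
    finally show "sum (F (Suc J) y) ((#) lam ` Q_chains n J \<nu> kap) = \<dots>" .
  qed
  finally show ?thesis by (simp add: Q sum_distrib_left)
qed

text \<open>Homogeneity: the exponents telescope along a chain. With \<open>s = t\<close> it
  expresses the values at the shifted sequence \<open>u t, u t ^ 2, ...\<close> by those at the
  original one.\<close>

lemma skew_HL_Q_scale:
  assumes "lam \<in> Sig n" and s: "s \<noteq> 0"
  shows "skew_HL_Q t n \<nu> lam J (\<lambda>i. s * y i) =
    s powi (sum_list \<nu> - sum_list lam) * skew_HL_Q t n \<nu> lam J y"
  using assms(1)
proof (induction J arbitrary: lam y)
  case (Suc J)
  have "skew_HL_Q t n \<nu> lam (Suc J) (\<lambda>i. s * y i) = (\<Sum>kap\<in>up_set n \<nu> lam.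
      (s * y 0) powi (sum_list kap - sum_list lam) * of_real (HL_phi t kap lam) *
      (s powi (sum_list \<nu> - sum_list kap) * skew_HL_Q t n \<nu> kap J (\<lambda>i. y (Suc i))))"
    unfolding skew_HL_Q_Suc[OF Suc.prems]
    by (intro sum.cong refl) (simp add: Suc.IH[where y = "\<lambda>i. y (Suc i)"] up_set_def)
  also have "\<dots> = (\<Sum>kap\<in>up_set n \<nu> lam. s powi (sum_list \<nu> - sum_list lam) *
      (y 0 powi (sum_list kap - sum_list lam) * of_real (HL_phi t kap lam) *
      skew_HL_Q t n \<nu> kap J (\<lambda>i. y (Suc i))))"
  proof (intro sum.cong refl)
    fix kap
    have "s powi (sum_list \<nu> - sum_list lam) =
        s powi (sum_list kap - sum_list lam) * s powi (sum_list \<nu> - sum_list kap)"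
      using power_int_add[of s "sum_list kap - sum_list lam" "sum_list \<nu> - sum_list kap"] s by simp
    then show "(s * y 0) powi (sum_list kap - sum_list lam) * of_real (HL_phi t kap lam) *
      (s powi (sum_list \<nu> - sum_list kap) * skew_HL_Q t n \<nu> kap J (\<lambda>i. y (Suc i))) =
      s powi (sum_list \<nu> - sum_list lam) *
      (y 0 powi (sum_list kap - sum_list lam) * of_real (HL_phi t kap lam) *
      skew_HL_Q t n \<nu> kap J (\<lambda>i. y (Suc i)))"
      by (simp add: power_int_mult_distrib mult_ac)
  qed
  also have "\<dots> = s powi (sum_list \<nu> - sum_list lam) * skew_HL_Q t n \<nu> lam (Suc J) y"
    unfolding skew_HL_Q_Suc[OF Suc.prems] by (simp add: sum_distrib_left)
  finally show ?case .
qed (simp add: skew_HL_Q_0)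

text \<open>At the largest \<open>x\<close> with \<open>conj_part \<nu> x < conj_part lam x\<close>,
  the deficit \<open>e\<close> is at most the multiplicity of \<open>x\<close> in
  \<open>lam\<close>, because column \<open>x + 1\<close> is in order. So \<open>qpoch\<close>
  contains the factor of index \<open>e - 1\<close>, which is
  \<open>1 - t powi (1 - e) * t ^ (e - 1) = 0\<close>.\<close>

lemma Q_limit_eq_0:
  assumes lam: "lam \<in> Sig n" and "\<not> sig_le lam \<nu>"
  shows "Q_limit t \<nu> lam = 0"
proof -
  obtain lo hi where bl: "parts_within lo hi lam" and bn: "parts_within lo hi \<nu>" using exists_parts_within by blast
  define S where "S = {x\<in>{lo<..hi}. conj_part \<nu> x < conj_part lam x}"
  have bad: "x \<in> S" if "conj_part \<nu> x < conj_part lam x" for x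
    using that conj_part_low[OF bl lam, of x] conj_part_low[OF bn nu, of x] conj_part_high[OF bl, of x]
    by (force simp: S_def)
  obtain x0 where "conj_part \<nu> x0 < conj_part lam x0"
    using assms(2) by (auto simp: sig_le_def not_le)
  then have "S \<noteq> {}" using bad by auto
  moreover have fin: "finite S" by (rule finite_subset[of _ "{lo<..hi}"]) (auto simp: S_def)
  ultimately have Max: "Max S \<in> S" by simp
  define x where "x = Max S"
  have x: "conj_part \<nu> x < conj_part lam x" using Max by (simp add: x_def S_def)
  have "x + 1 \<notin> S" using Max_ge[OF fin, of "x + 1"] by (auto simp: x_def)
  then have x1: "conj_part lam (x + 1) \<le> conj_part \<nu> (x + 1)" using bad[of "x + 1"] by linarith
  define e where "e = conj_part lam x - conj_part \<nu> x"
  have e: "0 < e" "e \<le> count_list lam x"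
    using x x1 conj_part_Suc_int[of lam x] conj_part_antimono[of x "x + 1" \<nu>] by (auto simp: e_def)
  then have mem: "x \<in> set lam" by (metis count_notin not_less)
  have "1 + int (conj_part \<nu> x) - int (conj_part lam x) = - int (e - 1)"
    using x by (simp add: e_def of_nat_diff)
  then have "qpoch (t powi (1 + int (conj_part \<nu> x) - int (conj_part lam x))) t (count_list lam x) =
      (\<Prod>i<count_list lam x. 1 - t powi (- int (e - 1)) * t ^ i)"
    by (simp only: qpoch_def)
  also have "\<dots> = 0"
  proof (rule prod_zero)
    have "1 - t powi (- int (e - 1)) * t ^ (e - 1) = 0"
      using t by (simp add: power_int_minus)
    then show "\<exists>i\<in>{..<count_list lam x}. 1 - t powi (- int (e - 1)) * t ^ i = 0"
      using e by (intro bexI[of _ "e - 1"]) auto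
  qed simp
  finally have "(\<Prod>x\<in>set \<nu> \<union> set lam.
        qpoch (t powi (1 + int (conj_part \<nu> x) - int (conj_part lam x))) t (count_list lam x)
        / qpoch t t (count_list lam x)) = 0"
    using mem by (intro prod_zero) (auto intro!: bexI[of _ x])
  then show ?thesis by (simp add: Q_limit_def)
qed

lemma Q_limit_self: "Q_limit t \<nu> \<nu> = 1"
proof -
  obtain lo hi where "parts_within lo hi \<nu>" using exists_parts_within by blast
  then show ?thesis
    using Q_limit_columns[OF t nu _ nu _ sig_le_refl, of lo hi] qpoch_self_pos[OF t]
    by (simp add: column_weight_def binomial_eq_0 less_imp_neq[symmetric])
qed

theorem skew_HL_Q_tendsto:
  fixes u :: complex
  assumes "lam \<in> Sig n"
  shows "(\<lambda>J. skew_HL_Q t n \<nu> lam J (\<lambda>i. u * of_real t ^ i)) \<longlonglongrightarrow>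
    u powi (sum_list \<nu> - sum_list lam) * of_real (Q_limit t \<nu> lam)"
proof (cases "sig_le lam \<nu>")
  case False
  then show ?thesis using assms by (simp add: skew_HL_Q_eq_0 Q_limit_eq_0)
next
  case True
  define Z where "Z = (\<lambda>lam J. skew_HL_Q t n \<nu> lam J (\<lambda>i. u * of_real t ^ i))"
  define W where "W = (\<lambda>lam. u powi (sum_list \<nu> - sum_list lam) * complex_of_real (Q_limit t \<nu> lam))"
  define w where "w = (\<lambda>lam kap. u powi (sum_list kap - sum_list lam) * of_real (HL_phi t kap lam) *
      of_real (t powi (sum_list \<nu> - sum_list kap)))"
  have Z_Suc: "Z lam (Suc J) = (\<Sum>kap\<in>up_set n \<nu> lam. w lam kap * Z kap J)" if "lam \<in> Sig n" for lam J
  proof -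
    have eq: "(\<lambda>i. u * complex_of_real t ^ Suc i) = (\<lambda>i. of_real t * (u * of_real t ^ i))"
      by (simp add: mult_ac)
    have tz: "complex_of_real t \<noteq> 0" using t by simp
    show ?thesis
      unfolding Z_def skew_HL_Q_Suc[OF that] eq
    proof (rule sum.cong[OF refl])
      fix kap assume "kap \<in> up_set n \<nu> lam"
      then have k: "kap \<in> Sig n" by (simp add: up_set_def)
      show "(u * complex_of_real t ^ 0) powi (sum_list kap - sum_list lam) * of_real (HL_phi t kap lam) *
          skew_HL_Q t n \<nu> kap J (\<lambda>i. of_real t * (u * of_real t ^ i)) =
        w lam kap * skew_HL_Q t n \<nu> kap J (\<lambda>i. u * of_real t ^ i)"
        unfolding skew_HL_Q_scale[OF k tz] w_def by (simp add: mult_ac)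
    qed
  qed
  have Z_0: "Z lam 0 = (if lam = \<nu> then 1 else 0)" if "lam \<in> Sig n" for lam
    using that by (simp add: Z_def skew_HL_Q_0)
  have W_rec: "W lam = (\<Sum>kap\<in>up_set n \<nu> lam. w lam kap * W kap)" if "lam \<in> Sig n" "sig_le lam \<nu>" for lam
  proof -
    have "(\<Sum>kap\<in>up_set n \<nu> lam. w lam kap * W kap) = (\<Sum>kap\<in>up_set n \<nu> lam.
        u powi (sum_list \<nu> - sum_list lam) *
        of_real (HL_phi t kap lam * t powi (sum_list \<nu> - sum_list kap) * Q_limit t \<nu> kap))"
    proof (rule sum.cong[OF refl])
      fix kap assume kap: "kap \<in> up_set n \<nu> lam"
      then have "sig_le lam kap" "sig_le kap \<nu>" "kap \<in> Sig n"
        using prec_Q_sig_le[OF that(1)] by (auto simp: up_set_def)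
      then have "0 \<le> sum_list kap - sum_list lam" "0 \<le> sum_list \<nu> - sum_list kap"
        using sum_list_sig_less[OF that(1), of kap] sum_list_sig_less[of kap n \<nu>] nu by force+
      from power_int_add_nonneg[OF this, of u]
      show "w lam kap * W kap = u powi (sum_list \<nu> - sum_list lam) *
        of_real (HL_phi t kap lam * t powi (sum_list \<nu> - sum_list kap) * Q_limit t \<nu> kap)"
        by (simp add: w_def W_def mult_ac)
    qed
    also have "\<dots> = u powi (sum_list \<nu> - sum_list lam) * of_real (\<Sum>kap\<in>up_set n \<nu> lam.
        HL_phi t kap lam * t powi (sum_list \<nu> - sum_list kap) * Q_limit t \<nu> kap)"
      by (simp add: sum_distrib_left)
    finally show ?thesis
      unfolding Q_limit_recurrence(1)[OF t that(1) nu that(2)] W_def by simp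
  qed
  have refl_up: "lam \<in> up_set n \<nu> lam" if "lam \<in> Sig n" "sig_le lam \<nu>" for lam
    using that by (simp add: up_set_def prec_Q_iff_conj_part)
  have w_self: "w lam lam = of_real (t powi (sum_list \<nu> - sum_list lam))" for lam
    by (simp add: w_def HL_phi_refl)
  have "Z lam \<longlonglongrightarrow> W lam"
    using assms True
  proof (induction "nat (sum_list \<nu> - sum_list lam)" arbitrary: lam rule: less_induct)
    case less
    note lam = less.prems
    show ?case
    proof (cases "lam = \<nu>")
      case eq: True
      have "up_set n \<nu> \<nu> = {\<nu>}"
      proof
        show "up_set n \<nu> \<nu> \<subseteq> {\<nu>}"
        proof
          fix kap assume "kap \<in> up_set n \<nu> \<nu>"
          then have k: "kap \<in> Sig n" "sig_le \<nu> kap" "sig_le kap \<nu>"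
            using prec_Q_sig_le[OF nu] by (auto simp: up_set_def)
          have "kap = \<nu>"
            by (rule Sig_eqI[OF k(1) nu]) (use k in \<open>auto simp: sig_le_def intro: order_antisym\<close>)
          then show "kap \<in> {\<nu>}" by simp
        qed
      qed (use refl_up[OF nu sig_le_refl] in simp)
      then have Z1: "Z \<nu> J = 1" for J
        by (induction J) (simp_all add: Z_0[OF nu] Z_Suc[OF nu] w_self)
      have "Z \<nu> = (\<lambda>_. 1)" "W \<nu> = 1" using Z1 by (auto simp: W_def Q_limit_self)
      then show ?thesis unfolding eq by (simp only: tendsto_const)
    next
      case False
      \<comment> \<open>The coefficient of \<open>Z lam J\<close> in the recursion for
        \<open>Z lam (Suc J)\<close>. All other terms belong to larger signatures, whose limits are
        known by induction.\<close>
      define r where "r = t powi (sum_list \<nu> - sum_list lam)"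
      define U where "U = up_set n \<nu> lam - {lam}"
      have pos: "0 < sum_list \<nu> - sum_list lam"
        using sum_list_sig_less[OF lam(1) nu lam(2) False] by simp
      have r: "0 \<le> r" "r < 1"
        using t pos power_less_one_iff[of t "nat (sum_list \<nu> - sum_list lam)"]
        by (auto simp: r_def power_int_def)
      have split: "sum f (up_set n \<nu> lam) = f lam + sum f U" for f :: "int list \<Rightarrow> complex"
        unfolding U_def by (rule sum.remove[OF finite_up_set[OF lam(1)] refl_up[OF lam]])
      have IH: "Z kap \<longlonglongrightarrow> W kap" if "kap \<in> U" for kap
      proof -
        have k: "kap \<in> Sig n" "sig_le lam kap" "sig_le kap \<nu>" "kap \<noteq> lam"
          using that prec_Q_sig_le[OF lam(1)] by (auto simp: U_def up_set_def)
        then have "sum_list lam < sum_list kap" using sum_list_sig_less[OF lam(1) k(1,2)] by auto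
        then have "nat (sum_list \<nu> - sum_list kap) < nat (sum_list \<nu> - sum_list lam)"
          using pos by simp
        from less.hyps[OF this k(1,3)] show ?thesis .
      qed
      have "(\<lambda>J. \<Sum>kap\<in>U. w lam kap * Z kap J) \<longlonglongrightarrow> (\<Sum>kap\<in>U. w lam kap * W kap)"
        by (intro tendsto_intros IH)
      moreover have "Z lam (Suc J) = of_real r * Z lam J + (\<Sum>kap\<in>U. w lam kap * Z kap J)" for J
        unfolding Z_Suc[OF lam(1)] split w_self r_def ..
      ultimately have "Z lam \<longlonglongrightarrow> (\<Sum>kap\<in>U. w lam kap * W kap) / (1 - of_real r)"
        by (intro affine_recursion_tendsto[OF r])
      moreover have "W lam = of_real r * W lam + (\<Sum>kap\<in>U. w lam kap * W kap)"
        using W_rec[OF lam] unfolding split w_self r_def .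
      then have "(\<Sum>kap\<in>U. w lam kap * W kap) = (1 - of_real r) * W lam"
        by (simp add: algebra_simps)
      moreover have "(1 :: complex) - of_real r \<noteq> 0"
        using r by (metis less_irrefl of_real_1 of_real_eq_iff right_minus_eq)
      ultimately show ?thesis by simp
    qed
  qed
  then show ?thesis unfolding Z_def W_def .
qed

end

section \<open>From partitions to signatures\<close>

definition sig_of :: "nat \<Rightarrow> nat list \<Rightarrow> int list" where
  "sig_of n lam = map int (pad n lam)"

text \<open>The factor usually written b, relating P and Q. For partitions the value 0 is not
  counted.\<close>

definition HL_b :: "real \<Rightarrow> nat list \<Rightarrow> real" where
  "HL_b t lam = (\<Prod>x\<in>set lam. qpoch t t (count_list lam x))"

lemma sig_of_Sig: "lam \<in> partitions \<Longrightarrow> length lam \<le> n \<Longrightarrow> sig_of n lam \<in> Sig n"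
  using sorted_pad[of lam n] by (simp add: sig_of_def Sig_def length_pad sorted_wrt_map)

lemma nth_sig_of: "length lam \<le> n \<Longrightarrow> i < n \<Longrightarrow> sig_of n lam ! i = int (nth_default 0 lam i)"
  by (simp add: sig_of_def length_pad nth_pad)

lemma sum_list_sig_of: "sum_list (sig_of n lam) = int (sum_list lam)"
proof -
  have "sum_list (map int xs) = int (sum_list xs)" for xs
    by (induction xs) auto
  then show ?thesis by (simp add: sig_of_def)
qed

lemma count_list_sig_of: "count_list (sig_of n lam) (int x) = count_list (pad n lam) x"
proof -
  have "count_list (map int xs) (int x) = count_list xs x" for xs
    by (induction xs) auto
  then show ?thesis by (simp add: sig_of_def)
qed

lemma conj_part_sig_of:
  assumes "0 < x" shows "conj_part (sig_of n lam) (int x) = conj_part lam x"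
proof -
  have "conj_part (map int xs) (int x) = conj_part xs x" for xs
    by (induction xs) (auto simp: conj_part_def)
  moreover have "conj_part (pad n lam) x = conj_part lam x"
    using assms by (simp add: pad_def conj_part_def)
  ultimately show ?thesis by (simp add: sig_of_def)
qed

lemma conj_part_sig_of_0: "length lam \<le> n \<Longrightarrow> conj_part (sig_of n lam) 0 = n"
  by (simp add: conj_part_def sig_of_def length_pad filter_map o_def)

lemma sig_of_inj:
  assumes "lam \<in> partitions" "\<mu> \<in> partitions" "sig_of n lam = sig_of n \<mu>"
  shows "lam = \<mu>"
proof -
  have "pad n lam = pad n \<mu>" using assms(3) by (simp add: sig_of_def inj_map_eq_map)
  then show ?thesis using of_padded_pad assms(1,2) by metis
qed

lemma prec_Q_sig_of:
  assumes "lam \<in> partitions" "length lam \<le> n" "length kap \<le> n"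
  shows "prec_Q n (sig_of n lam) (sig_of n kap) \<longleftrightarrow> interlaces lam kap"
proof -
  have "nth_default 0 lam i = 0" "nth_default 0 kap i = 0" if "\<not> i < n" for i
    using that assms by (simp_all add: nth_default_beyond)
  then have "(\<forall>i. nth_default 0 lam i \<le> nth_default 0 kap i) \<longleftrightarrow>
      (\<forall>i<n. nth_default 0 lam i \<le> nth_default 0 kap i)"
    and "(\<forall>i. nth_default 0 kap (Suc i) \<le> nth_default 0 lam i) \<longleftrightarrow>
      (\<forall>i. Suc i < n \<longrightarrow> nth_default 0 kap (Suc i) \<le> nth_default 0 lam i)"
    by (metis le0)+
  then show ?thesis
    using assms by (auto simp: prec_Q_def interlaces_def nth_sig_of)
qed

lemma sig_le_sig_of:
  assumes "lam \<in> partitions" "length lam \<le> n" "kap \<in> partitions" "length kap \<le> n"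
  shows "sig_le (sig_of n lam) (sig_of n kap) \<longleftrightarrow> (\<forall>i. nth_default 0 lam i \<le> nth_default 0 kap i)"
proof -
  have "nth_default 0 lam i = 0" if "\<not> i < n" for i
    using that assms by (simp add: nth_default_beyond)
  then have "(\<forall>i. nth_default 0 lam i \<le> nth_default 0 kap i) \<longleftrightarrow>
      (\<forall>i<n. nth_default 0 lam i \<le> nth_default 0 kap i)"
    by (metis le0)
  then show ?thesis
    using assms by (auto simp: sig_le_iff_nth[OF sig_of_Sig sig_of_Sig] nth_sig_of)
qed

text \<open>A signature above \<open>sig_of n lam\<close> has nonnegative entries, hence is a padded
  partition.\<close>

lemma bij_betw_sig_of:
  assumes lam: "lam \<in> partitions" "length lam \<le> n" and mu: "\<mu> \<in> partitions" "length \<mu> \<le> n"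
  shows "bij_betw (sig_of n) {kap \<in> partitions. length kap \<le> n \<and> interlaces lam kap \<and> sig_le (sig_of n kap) (sig_of n \<mu>)}
    (up_set n (sig_of n \<mu>) (sig_of n lam))" (is "bij_betw _ ?S ?U")
  unfolding bij_betw_def
proof (intro conjI equalityI subsetI)
  show "inj_on (sig_of n) ?S" using sig_of_inj by (auto intro!: inj_onI)
  show "k \<in> ?U" if "k \<in> sig_of n ` ?S" for k
    using that lam prec_Q_sig_of sig_of_Sig by (auto simp: up_set_def)
  show "k \<in> sig_of n ` ?S" if "k \<in> ?U" for k
  proof -
    have k: "k \<in> Sig n" "prec_Q n (sig_of n lam) k" "sig_le k (sig_of n \<mu>)"
      using that by (auto simp: up_set_def)
    have "0 \<le> k ! i" if "i < n" for i
    proof -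
      have "0 \<le> sig_of n lam ! i" using that lam by (simp add: nth_sig_of)
      also have "\<dots> \<le> k ! i" using k(2) that by (simp add: prec_Q_def)
      finally show ?thesis .
    qed
    then have nonneg: "\<forall>y\<in>set k. 0 \<le> y" using SigD[OF k(1)] by (auto simp: in_set_conv_nth)
    define kap where "kap = of_padded (map nat k)"
    have srt: "sorted_wrt (\<ge>) (map nat k)"
      using k(1) by (auto simp: Sig_def sorted_wrt_map nat_mono elim!: sorted_wrt_mono_rel[rotated])
    have kap: "kap \<in> partitions" "length kap \<le> n"
      using of_padded_partition[OF srt] length_of_padded[of "map nat k"] SigD[OF k(1)]
      by (auto simp: kap_def)
    have "pad n kap = map nat k"
      using pad_of_padded[OF srt] SigD[OF k(1)] by (simp add: kap_def)
    then have eq: "k = sig_of n kap"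
      using nonneg by (simp add: sig_of_def o_def map_idI)
    then show ?thesis
      using k kap lam prec_Q_sig_of[OF lam kap(2)] by auto
  qed
qed

text \<open>Psi records the multiplicities that are larger in \<open>lam\<close>, phi those larger
  in \<open>kap\<close>. At each value the claim is
  \<open>qpoch t t (Suc m) = qpoch t t m * (1 - t ^ Suc m)\<close>.\<close>

lemma HL_psi_eq_HL_phi:
  assumes kap: "kap \<in> partitions" "length kap \<le> n" and lam: "interlaces lam kap"
  shows "HL_psi t kap lam * HL_b t kap = HL_b t lam * HL_phi t (sig_of n kap) (sig_of n lam)"
proof -
  have lp: "lam \<in> partitions" using lam by (simp add: interlaces_def)
  define X where "X = set kap \<union> set lam"
  have pos: "x \<noteq> 0" if "x \<in> X" for x
  proof
    assume "x = 0"
    with that kap lp show False by (auto simp: X_def partitions_def)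
  qed
  have finX: "finite X" by (simp add: X_def)
  define k l where "k = count_list kap" and "l = count_list lam"
  have cnt: "l x \<le> Suc (k x)" "k x \<le> Suc (l x)" if "x \<noteq> 0" for x
  proof -
    have "pad (length kap) lam \<in> interlacing (pad (Suc (length kap)) kap)"
      using bij_betwE[OF bij_betw_pad_interlaces[OF kap(1), of "length kap"]]
        lam interlaces_bounds(1)[OF lam] by auto
    from count_list_interlacing[OF this sorted_pad[OF kap(1)], of x]
    show "l x \<le> Suc (k x)" "k x \<le> Suc (l x)" using that by (auto simp: count_list_pad k_def l_def)
  qed
  have b: "HL_b t kap = (\<Prod>x\<in>X. qpoch t t (k x))" "HL_b t lam = (\<Prod>x\<in>X. qpoch t t (l x))"
    unfolding HL_b_def k_def l_def
    by (rule prod.mono_neutral_left; auto simp: X_def count_list_0_iff)+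
  have psi: "HL_psi t kap lam = (\<Prod>x\<in>X. if l x = Suc (k x) then 1 - t ^ l x else 1)"
  proof -
    have "{x. x \<in> set lam \<and> count_list lam x = Suc (count_list kap x)} = {x\<in>X. l x = Suc (k x)}"
      by (auto simp: X_def k_def l_def count_list_0_iff) (metis count_notin nat.distinct(1))
    then have "HL_psi t kap lam = (\<Prod>x\<in>{x\<in>X. l x = Suc (k x)}. 1 - t ^ l x)"
      by (simp only: HL_psi_def l_def)
    then show ?thesis by (simp only: prod.inter_filter[OF finX])
  qed
  have phi: "HL_phi t (sig_of n kap) (sig_of n lam) = (\<Prod>x\<in>X. if k x = Suc (l x) then 1 - t ^ k x else 1)"
  proof -
    have c: "count_list (sig_of n kap) (int x) = k x" "count_list (sig_of n lam) (int x) = l x"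
      if "x \<noteq> 0" for x
      using that by (simp_all add: count_list_sig_of count_list_pad k_def l_def)
    have "{x. count_list (sig_of n kap) x = count_list (sig_of n lam) x + 1} = int ` {x\<in>X. k x = Suc (l x)}"
    proof (intro equalityI subsetI)
      fix y assume y: "y \<in> {x. count_list (sig_of n kap) x = count_list (sig_of n lam) x + 1}"
      then have "y \<in> set (sig_of n kap)" by (metis (mono_tags) Suc_eq_plus1 count_notin mem_Collect_eq nat.distinct(1))
      then obtain x where x: "y = int x" by (auto simp: sig_of_def)
      \<comment> \<open>On padded lists phi also sees the value 0, but \<open>kap\<close> has at
        least as many rows as \<open>lam\<close> and hence no more zeros.\<close>
      have "x \<noteq> 0"
      proof
        assume "x = 0"
        then have "n - length kap = Suc (n - length lam)"
          using y x kap(1) lp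
          by (simp add: count_list_sig_of[of n _ 0, simplified] count_list_pad partitions_def count_notin)
        then show False using interlaces_bounds(1)[OF lam] by simp
      qed
      then have "k x = Suc (l x)" using y x c by simp
      moreover have "x \<in> X" using \<open>k x = Suc (l x)\<close> by (metis UnI1 X_def count_notin k_def nat.distinct(1))
      ultimately show "y \<in> int ` {x\<in>X. k x = Suc (l x)}" using x by simp
    qed (use c pos in auto)
    then have "HL_phi t (sig_of n kap) (sig_of n lam) = (\<Prod>x\<in>{x\<in>X. k x = Suc (l x)}. 1 - t ^ count_list (sig_of n kap) (int x))"
      by (simp add: HL_phi_def prod.reindex)
    also have "\<dots> = (\<Prod>x\<in>{x\<in>X. k x = Suc (l x)}. 1 - t ^ k x)"
      by (rule prod.cong) (use c pos in auto)
    finally show ?thesis by (simp only: prod.inter_filter[OF finX])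
  qed
  show ?thesis
    unfolding b psi phi prod.distrib[symmetric]
  proof (rule prod.cong[OF refl])
    fix x assume "x \<in> X"
    then have "l x \<le> Suc (k x)" "k x \<le> Suc (l x)" using cnt pos by auto
    then consider "l x = Suc (k x)" | "k x = Suc (l x)" | "k x = l x" by linarith
    then show "(if l x = Suc (k x) then 1 - t ^ l x else 1) * qpoch t t (k x) =
        qpoch t t (l x) * (if k x = Suc (l x) then 1 - t ^ k x else 1)"
      by cases (simp_all add: qpoch_self_Suc)
  qed
qed

context
  fixes t :: real
  assumes t: "0 < t" "t < 1"
begin

text \<open>\<open>skew_P\<close> unfolds at the upper end of a chain, \<open>skew_HL_Q_Suc\<close>
  at the lower end. So \<open>skew_P_add\<close> with \<open>k = 1\<close> peels off the variable
  next to \<open>lam\<close>, and the ratios of \<open>HL_b\<close> telescope.\<close>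

lemma skew_P_eq_skew_HL_Q:
  fixes y :: "nat \<Rightarrow> complex"
  assumes mu: "\<mu> \<in> partitions" "length \<mu> \<le> n" and "lam \<in> partitions" "length lam \<le> n"
  shows "skew_P (of_real t) N lam \<mu> y * of_real (HL_b t \<mu>) =
    of_real (HL_b t lam) * skew_HL_Q t n (sig_of n \<mu>) (sig_of n lam) N y"
  using assms(3,4)
proof (induction N arbitrary: lam y)
  case 0
  then show ?case
    using sig_of_inj[OF 0(1) mu(1), of n] by (auto simp: skew_HL_Q_0 sig_of_Sig)
next
  case (Suc N)
  let ?nu = "sig_of n \<mu>"
  have nu: "?nu \<in> Sig n" by (rule sig_of_Sig[OF mu])
  have lamS: "sig_of n lam \<in> Sig n" by (rule sig_of_Sig[OF Suc.prems])
  define S where "S = {kap \<in> partitions. length kap \<le> n \<and> interlaces lam kap \<and> sig_le (sig_of n kap) ?nu}"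
  define w where "w = (\<lambda>kap. of_real (HL_psi t kap lam) * y 0 ^ (sum_list kap - sum_list lam) *
     of_real (HL_b t kap) * skew_HL_Q t n ?nu (sig_of n kap) N (\<lambda>i. y (Suc i)))"
  define v where "v = (\<lambda>kap. y 0 powi (sum_list (sig_of n kap) - sum_list (sig_of n lam)) *
       of_real (HL_phi t (sig_of n kap) (sig_of n lam)) *
       skew_HL_Q t n ?nu (sig_of n kap) N (\<lambda>i. y (Suc i)))"
  have one: "skew_P (of_real t) 1 lam kap y =
      (if interlaces lam kap then of_real (HL_psi t kap lam) * y 0 ^ (sum_list kap - sum_list lam) else 0)" for kap
  proof -
    have "skew_P (of_real t) (Suc 0) lam kap y = (\<Sum>l | interlaces l kap.
        if l = lam then HL_psi (of_real t) kap lam * y 0 ^ (sum_list kap - sum_list lam) else 0)"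
      unfolding skew_P.simps by (rule sum.cong) auto
    also have "\<dots> = (if interlaces lam kap
        then HL_psi (of_real t) kap lam * y 0 ^ (sum_list kap - sum_list lam) else 0)"
      by (simp add: sum.delta[OF finite_interlaces])
    finally show ?thesis
      by (simp add: ring_morphism.HL_psi[OF ring_morphism_of_real])
  qed
  have "skew_P (of_real t) (Suc N) lam \<mu> y = (\<Sum>kap\<in>sub_partitions \<mu>.
      skew_P (of_real t) 1 lam kap y * skew_P (of_real t) N kap \<mu> (\<lambda>i. y (Suc i)))"
    using skew_P_add[OF finite_sub_partitions order_refl mu(1), of "of_real t" 1 N lam y] by simp
  then have "skew_P (of_real t) (Suc N) lam \<mu> y * of_real (HL_b t \<mu>) = (\<Sum>kap\<in>sub_partitions \<mu>.
      skew_P (of_real t) 1 lam kap y * (skew_P (of_real t) N kap \<mu> (\<lambda>i. y (Suc i)) * of_real (HL_b t \<mu>)))"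
    by (simp only: sum_distrib_right mult.assoc)
  also have "\<dots> = (\<Sum>kap\<in>sub_partitions \<mu>. if interlaces lam kap then w kap else 0)"
  proof (rule sum.cong[OF refl])
    fix kap assume "kap \<in> sub_partitions \<mu>"
    then have "kap \<in> partitions" "length kap \<le> n" using mu by (auto simp: sub_partitions_def)
    then show "skew_P (of_real t) 1 lam kap y *
        (skew_P (of_real t) N kap \<mu> (\<lambda>i. y (Suc i)) * of_real (HL_b t \<mu>)) =
        (if interlaces lam kap then w kap else 0)"
      unfolding one by (subst Suc.IH) (simp_all add: w_def)
  qed
  also have "\<dots> = (\<Sum>kap\<in>S. w kap)"
  proof (rule sum.mono_neutral_cong_right[OF finite_sub_partitions])
    show "S \<subseteq> sub_partitions \<mu>"
    proof
      fix kap assume k: "kap \<in> S"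
      then have kp: "kap \<in> partitions" "length kap \<le> n" and le: "\<And>i. nth_default 0 kap i \<le> nth_default 0 \<mu> i"
        using sig_le_sig_of[OF _ _ mu] by (auto simp: S_def)
      have "sum_list kap \<le> sum_list \<mu>"
        unfolding sum_list_nth_default[OF kp(2)] sum_list_nth_default[OF mu(2)] by (intro sum_mono le)
      moreover have "length kap \<le> length \<mu>"
      proof (rule ccontr)
        assume "\<not> ?thesis"
        then have "0 < nth_default 0 kap (length \<mu>)" by (simp add: nth_default_partition_pos_iff[OF kp(1)])
        then show False using le[of "length \<mu>"] by (simp add: nth_default_def)
      qed
      ultimately show "kap \<in> sub_partitions \<mu>" using kp by (simp add: sub_partitions_def)
    qed
    show "\<forall>kap\<in>sub_partitions \<mu> - S. (if interlaces lam kap then w kap else 0) = 0"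
    proof
      fix kap assume k: "kap \<in> sub_partitions \<mu> - S"
      then have kp: "kap \<in> partitions" "length kap \<le> n" using mu by (auto simp: sub_partitions_def)
      with k have "interlaces lam kap \<Longrightarrow> \<not> sig_le (sig_of n kap) ?nu" by (auto simp: S_def)
      then show "(if interlaces lam kap then w kap else 0) = 0"
        using skew_HL_Q_eq_0[OF sig_of_Sig[OF kp]] by (simp add: w_def)
    qed
  qed (auto simp: S_def)
  also have "\<dots> = (\<Sum>kap\<in>S. of_real (HL_b t lam) *
      v kap)"
  proof (rule sum.cong[OF refl])
    fix kap assume "kap \<in> S"
    then have k: "kap \<in> partitions" "length kap \<le> n" "interlaces lam kap" by (auto simp: S_def)
    have "sum_list (sig_of n kap) - sum_list (sig_of n lam) = int (sum_list kap - sum_list lam)"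
      using interlaces_bounds(2)[OF k(3)] by (simp add: sum_list_sig_of of_nat_diff)
    then show "w kap = of_real (HL_b t lam) *
      v kap"
      using arg_cong[OF HL_psi_eq_HL_phi[OF k, of t], of complex_of_real]
      by (simp add: w_def v_def mult_ac) (simp add: mult.assoc[symmetric] mult.commute)?
  qed
  also have "\<dots> = of_real (HL_b t lam) * (\<Sum>kap\<in>S. v kap)"
    by (simp add: sum_distrib_left)
  also have "(\<Sum>kap\<in>S. v kap) =
     skew_HL_Q t n ?nu (sig_of n lam) (Suc N) y"
    unfolding skew_HL_Q_Suc[OF t nu lamS] S_def v_def
    by (rule sum.reindex_bij_betw[OF bij_betw_sig_of[OF Suc.prems mu]])
  finally show ?case .
qed

lemma n_skew_sig_of:
  assumes "length \<mu> \<le> n" "length lam \<le> n"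
  shows "n_skew_sig (sig_of n \<mu>) (sig_of n lam) = n_skew_part \<mu> lam"
proof -
  have "n_skew_sig (sig_of n \<mu>) (sig_of n lam) =
      (\<Sum>j<n. \<Sum>i<j. nth_default 0 \<mu> j - nth_default 0 lam i)"
    unfolding n_skew_sig_def
    using assms by (intro sum.cong) (auto simp: sig_of_def length_pad nth_pad max_def nat_diff_distrib)
  also have "\<dots> = (\<Sum>j<length \<mu>. \<Sum>i<j. nth_default 0 \<mu> j - nth_default 0 lam i)"
    by (rule sum.mono_neutral_right) (use assms in \<open>auto simp: nth_default_beyond\<close>)
  also have "\<dots> = n_skew_part \<mu> lam"
    unfolding n_skew_part_def by (intro sum.cong) (auto simp: nth_default_nth)
  finally show ?thesis .
qed

lemma HL_b_pos: "0 < HL_b t lam"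
  unfolding HL_b_def by (intro prod_pos) (simp add: qpoch_self_pos[OF t])

text \<open>The ratio of the \<open>HL_b\<close> exchanges the multiplicities of \<open>lam\<close>
  in the denominators for those of \<mu>. Padding adds the value 0, where both columns have length
  \<open>n\<close> and the factor is 1.\<close>

lemma Q_limit_sig_of:
  assumes mu: "\<mu> \<in> partitions" "length \<mu> \<le> n" and lam: "lam \<in> partitions" "length lam \<le> n"
  shows "HL_b t lam * Q_limit t (sig_of n \<mu>) (sig_of n lam) / HL_b t \<mu> =
    t ^ n_skew_part \<mu> lam * (\<Prod>x\<in>set \<mu> \<union> set lam.
       qpoch (t powi (1 + int (conj_part \<mu> x) - int (conj_part lam x))) t (count_list lam x)
       / qpoch t t (count_list \<mu> x))"
proof -
  define X where "X = set \<mu> \<union> set lam"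
  have fin: "finite X" and pos: "0 \<notin> X" using mu lam by (auto simp: X_def partitions_def)
  define q where "q = (\<lambda>x. qpoch (t powi (1 + int (conj_part \<mu> x) - int (conj_part lam x))) t (count_list lam x))"
  define h where "h = (\<lambda>z. qpoch (t powi (1 + int (conj_part (sig_of n \<mu>) z) - int (conj_part (sig_of n lam) z)))
     t (count_list (sig_of n lam) z) / qpoch t t (count_list (sig_of n lam) z))"
  have q0: "qpoch t t m \<noteq> 0" for m using qpoch_self_pos[OF t, of m] by simp
  have hx: "h (int x) = q x / qpoch t t (count_list lam x)" if "x \<in> X" for x
  proof -
    have "0 < x" using that pos by (cases x) auto
    then show ?thesis
      by (simp add: h_def q_def conj_part_sig_of count_list_sig_of count_list_pad)
  qed
  have h0: "h 0 = 1"
    using mu lam q0 by (simp add: h_def conj_part_sig_of_0)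
  have hout: "h z = 1" if "z \<notin> set (sig_of n \<mu>) \<union> set (sig_of n lam)" for z
    using that by (simp add: h_def count_notin)
  have "(\<Prod>z\<in>set (sig_of n \<mu>) \<union> set (sig_of n lam). h z) = (\<Prod>z\<in>insert 0 (int ` X). h z)"
    by (rule prod.mono_neutral_left)
       (use fin set_pad_subset[of n \<mu>] set_pad_subset[of n lam] hout in \<open>auto simp: sig_of_def X_def\<close>)
  also have "\<dots> = (\<Prod>z\<in>int ` X. h z)"
    using fin pos by (subst prod.insert) (auto simp: h0)
  also have "\<dots> = (\<Prod>x\<in>X. q x / qpoch t t (count_list lam x))"
    by (subst prod.reindex) (auto simp: hx)
  finally have G: "Q_limit t (sig_of n \<mu>) (sig_of n lam) =
      t ^ n_skew_part \<mu> lam * (\<Prod>x\<in>X. q x / qpoch t t (count_list lam x))"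
    using n_skew_sig_of mu lam by (simp add: Q_limit_def h_def)
  have b: "HL_b t \<mu> = (\<Prod>x\<in>X. qpoch t t (count_list \<mu> x))" "HL_b t lam = (\<Prod>x\<in>X. qpoch t t (count_list lam x))"
    unfolding HL_b_def by (rule prod.mono_neutral_left; auto simp: X_def count_list_0_iff)+
  have "(\<Prod>x\<in>X. qpoch t t (count_list lam x)) \<noteq> 0" using q0 fin by simp
  then show ?thesis
    unfolding G b X_def[symmetric] q_def[symmetric] prod_dividef by simp
qed

end

theorem theorem3p5:
  fixes t :: real and u :: complex
  assumes "0 < t" and "t < 1"
  shows
    "(\<forall>\<mu>\<in>partitions. \<forall>lam\<in>partitions.
        (\<lambda>N. insertion id (\<lambda>i. u * of_real t ^ i) (skew_HL_P t \<mu> lam N)) \<longlonglongrightarrow>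
          u powi (int (sum_list \<mu>) - int (sum_list lam)) *
          of_real (t ^ n_skew_part \<mu> lam *
            (\<Prod>x\<in>set \<mu> \<union> set lam.
               qpoch (t powi (1 + int (conj_part \<mu> x) - int (conj_part lam x))) t (count_list lam x)
               / qpoch t t (count_list \<mu> x)))) \<and>
     (\<forall>n. \<forall>\<nu>\<in>Sig n. \<forall>lam\<in>Sig n.
        (\<lambda>J. skew_HL_Q t n \<nu> lam J (\<lambda>i. u * of_real t ^ i)) \<longlonglongrightarrow>
          u powi (sum_list \<nu> - sum_list lam) *
          of_real (t ^ n_skew_sig \<nu> lam *
            (\<Prod>x\<in>set \<nu> \<union> set lam.
               qpoch (t powi (1 + int (conj_part \<nu> x) - int (conj_part lam x))) t (count_list lam x)
               / qpoch t t (count_list lam x))))"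
proof (intro conjI ballI allI)
  fix n \<nu> lam assume "\<nu> \<in> Sig n" "lam \<in> Sig n"
  then show "(\<lambda>J. skew_HL_Q t n \<nu> lam J (\<lambda>i. u * of_real t ^ i)) \<longlonglongrightarrow>
          u powi (sum_list \<nu> - sum_list lam) *
          of_real (t ^ n_skew_sig \<nu> lam *
            (\<Prod>x\<in>set \<nu> \<union> set lam.
               qpoch (t powi (1 + int (conj_part \<nu> x) - int (conj_part lam x))) t (count_list lam x)
               / qpoch t t (count_list lam x)))"
    by (rule skew_HL_Q_tendsto[OF assms, unfolded Q_limit_def])
next
  fix \<mu> lam assume mu: "\<mu> \<in> partitions" and lam: "lam \<in> partitions"
  \<comment> \<open>Room for both partitions, as \<open>lam\<close> may have more rows than
    \<mu>.\<close>
  define n where "n = length \<mu> + length lam"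
  define y where "y = (\<lambda>i. u * complex_of_real t ^ i)"
  have len: "length \<mu> \<le> n" "length lam \<le> n" by (auto simp: n_def)
  let ?Q = "\<lambda>N. skew_HL_Q t n (sig_of n \<mu>) (sig_of n lam) N y"
  have nz: "complex_of_real (HL_b t \<mu>) \<noteq> 0" using HL_b_pos[OF assms, of \<mu>] by simp
  have "insertion id y (skew_HL_P t \<mu> lam N) = of_real (HL_b t lam / HL_b t \<mu>) * ?Q N" for N
    using skew_P_eq_skew_HL_Q[OF assms mu len(1) lam len(2), of N y] nz
    by (simp add: skew_HL_P_eq_skew_P[OF assms mu lam] eval_skew_P_mVar[OF assms] field_simps)
  moreover have "(\<lambda>N. of_real (HL_b t lam / HL_b t \<mu>) * ?Q N) \<longlonglongrightarrow> of_real (HL_b t lam / HL_b t \<mu>) *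
      (u powi (sum_list (sig_of n \<mu>) - sum_list (sig_of n lam)) * of_real (Q_limit t (sig_of n \<mu>) (sig_of n lam)))"
    unfolding y_def
    by (intro tendsto_mult_left skew_HL_Q_tendsto[OF assms] sig_of_Sig mu lam len)
  ultimately have "(\<lambda>N. insertion id y (skew_HL_P t \<mu> lam N)) \<longlonglongrightarrow> of_real (HL_b t lam / HL_b t \<mu>) *
      (u powi (sum_list (sig_of n \<mu>) - sum_list (sig_of n lam)) * of_real (Q_limit t (sig_of n \<mu>) (sig_of n lam)))"
    by simp
  also have "of_real (HL_b t lam / HL_b t \<mu>) *
      (u powi (sum_list (sig_of n \<mu>) - sum_list (sig_of n lam)) * of_real (Q_limit t (sig_of n \<mu>) (sig_of n lam))) =
      u powi (int (sum_list \<mu>) - int (sum_list lam)) *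
      of_real (HL_b t lam * Q_limit t (sig_of n \<mu>) (sig_of n lam) / HL_b t \<mu>)"
    by (simp add: sum_list_sig_of)
  finally show "(\<lambda>N. insertion id (\<lambda>i. u * of_real t ^ i) (skew_HL_P t \<mu> lam N)) \<longlonglongrightarrow>
          u powi (int (sum_list \<mu>) - int (sum_list lam)) *
          of_real (t ^ n_skew_part \<mu> lam *
            (\<Prod>x\<in>set \<mu> \<union> set lam.
               qpoch (t powi (1 + int (conj_part \<mu> x) - int (conj_part lam x))) t (count_list lam x)
               / qpoch t t (count_list \<mu> x)))"
    unfolding Q_limit_sig_of[OF assms mu len(1) lam len(2)] y_def .
qed

end
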